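(* Let $s\in(0,1)$. Let $\Omega,A,O\subset\mathbb R^n$ be smooth, open, bounded, connected sets such that $A\Subset\Omega$, $\Omega\setminus\overline A$ is connected and $O\Subset\Omega\setminus\overline A$. Let $r_0>0$, $\theta\in(0,1)$ and $$K:=\{a\in C^1(\Omega,\mathbb R^{n\times n}_{sym}):\ \|a-\mathrm{Id}_{n\times n}\|_{C^1(\Omega)}\le r_0,\ \theta\le a\le\theta^{-1},\ a=\mathrm{Id}_{n\times n}\text{ in }\Omega\setminus A\}.$$ Let $\tilde L_{s,O}^a$ be the nonlocal source-to-solution operator associated with $a$. Then there exists $c>0$ such that for any $\varepsilon\in(0,r_0)$ small enough there exist $a_1,a_2\in K$ with $$\|\tilde L_{s,O}^{a_1}-\tilde L_{s,O}^{a_2}\|_{\widetilde{\mathcal H}^{-s}(O)\to\mathcal H^s(O)}\le\exp\Big(-c\,\varepsilon^{-\frac1{2+\frac7n}}\Big),\qquad\|a_1-a_2\|_{L^\infty(\Omega)}\ge\varepsilon.$$ In particular, if one has the stability property $$\|a_1-a_2\|_{L^\infty(\Omega)}\le\omega\big(\|\tilde L_{s,O}^{a_1}-\tilde L_{s,O}^{a_2}\|_{\widetilde{\mathcal H}^{-s}(O)\to\mathcal H^s(O)}\big)\quad\text{for all }a_1,a_2\in K$$ with a modulus of continuity $\omega$, then necessarily $\omega(t)\gtrsim|\log t|^{-(2+\frac7n)}$ for $t>0$ small.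
   Context: $\theta\le a\le\theta^{-1}$ means $\theta|\xi|^2\le\xi\cdot a(x)\xi\le\theta^{-1}|\xi|^2$ for all $x\in\Omega$, $\xi\in\mathbb R^n$. A modulus of continuity is a nondecreasing function $\omega:[0,\infty)\to[0,\infty)$ with $\omega(t)\to0$ as $t\to0$; $\omega(t)\gtrsim h(t)$ means $\omega(t)\ge c'h(t)$ for some constant $c'>0$. $L_a:=-\nabla\cdot a\nabla:H^1_0(\Omega)\to H^{-1}(\Omega)$ (Dirichlet realization), with $L^2(\Omega)$-orthonormal eigenfunctions $(\phi_k)_{k\ge1}$ and eigenvalues $0<\lambda_1\le\lambda_2\le\dots$; $L_a^su=\sum_k\lambda_k^s(u,\phi_k)_{L^2(\Omega)}\phi_k$. $\mathcal H^r(\Omega)=\{u:\sum_k\mu_k^r|(u,e_k)_{L^2(\Omega)}|^2<\infty\}$ with the corresponding norm, $(\mu_k,e_k)$ the eigenpairs of the Dirichlet Laplacian on $\Omega$ (duality pairing for $r<0$). $\mathcal H^r(O)=\{U|_O:U\in\mathcal H^r(\Omega)\}$ with quotient norm; $\widetilde{\mathcal H}^r(O)$ is the closure of $C_c^\infty(O)$ in $\mathcal H^r(\Omega)$. $\tilde L^a_{s,O}:\widetilde{\mathcal H}^{-s}(O)\to\mathcal H^s(O)$, $f\mapsto u^f|_O$, where $u^f\in\mathcal H^s(\Omega)$ is the unique solution of $L_a^su^f=f$ in $\Omega$ (with zero Dirichlet data on $\partial\Omega$ encoded in the space). *)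

theory Defs
  imports "HOL-Analysis.Analysis" "HOL-Probability.Essential_Supremum"
begin

definition pderiv_at :: "'n::finite \<Rightarrow> (real^'n \<Rightarrow> 'b::real_normed_vector) \<Rightarrow> real^'n \<Rightarrow> 'b" where
  "pderiv_at i f x = frechet_derivative f (at x) (axis i 1)"

primrec Ck_on ::
  "nat \<Rightarrow> (real^'n::finite) set \<Rightarrow> (real^'n \<Rightarrow> 'b::real_normed_vector) \<Rightarrow> bool" where
  "Ck_on 0 = (\<lambda>U f. continuous_on U f)"
| "Ck_on (Suc k) = (\<lambda>U f. (\<forall>x\<in>U. f differentiable (at x)) \<and> (\<forall>i. Ck_on k U (pderiv_at i f)))"

definition smooth_on :: "(real^'n::finite) set \<Rightarrow> (real^'n \<Rightarrow> 'b::real_normed_vector) \<Rightarrow> bool" where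
  "smooth_on U f \<longleftrightarrow> (\<forall>k. Ck_on k U f)"

text \<open>The boundary is smooth when the set is, near each of its boundary points, one side of a
  level set of a smooth function with nonvanishing gradient.\<close>

definition smooth_boundary :: "(real^'n::finite) set \<Rightarrow> bool" where
  "smooth_boundary S \<longleftrightarrow>
     (\<forall>p\<in>frontier S. \<exists>U (\<rho> :: real^'n \<Rightarrow> real).
        open U \<and> p \<in> U \<and> smooth_on U \<rho> \<and> (\<exists>i. pderiv_at i \<rho> p \<noteq> 0) \<and> S \<inter> U = {x\<in>U. \<rho> x < 0})"

definition smooth_domain :: "(real^'n::finite) set \<Rightarrow> bool" where
  "smooth_domain S \<longleftrightarrow> S \<noteq> {} \<and> open S \<and> bounded S \<and> connected S \<and> smooth_boundary S"

definition compactly_contained :: "(real^'n::finite) set \<Rightarrow> (real^'n) set \<Rightarrow> bool"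
    (infix "\<Subset>" 50) where
  "S \<Subset> T \<longleftrightarrow> compact (closure S) \<and> closure S \<subseteq> T"

definition test_functions :: "(real^'n::finite) set \<Rightarrow> (real^'n \<Rightarrow> real) set" where
  "test_functions S =
     {\<phi>. smooth_on UNIV \<phi> \<and> compact (closure {x. \<phi> x \<noteq> 0}) \<and> closure {x. \<phi> x \<noteq> 0} \<subseteq> S}"

text \<open>Elements of the function spaces below are representatives; functions that agree almost
  everywhere on the domain are to be identified.\<close>

definition L2 :: "(real^'n::finite) set \<Rightarrow> (real^'n \<Rightarrow> real) set" where
  "L2 \<Omega> = {u \<in> borel_measurable (lebesgue_on \<Omega>). integrable (lebesgue_on \<Omega>) (\<lambda>x. (u x)\<^sup>2)}"

definition L2_inner ::
  "(real^'n::finite) set \<Rightarrow> (real^'n \<Rightarrow> real) \<Rightarrow> (real^'n \<Rightarrow> real) \<Rightarrow> real" where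
  "L2_inner \<Omega> u v = (LINT x|lebesgue_on \<Omega>. u x * v x)"

definition is_weak_grad ::
  "(real^'n::finite) set \<Rightarrow> (real^'n \<Rightarrow> real) \<Rightarrow> (real^'n \<Rightarrow> real^'n) \<Rightarrow> bool" where
  "is_weak_grad \<Omega> u G \<longleftrightarrow>
     (\<forall>i. (\<lambda>x. G x $ i) \<in> L2 \<Omega> \<and>
          (\<forall>\<phi>\<in>test_functions \<Omega>. L2_inner \<Omega> u (pderiv_at i \<phi>) = - L2_inner \<Omega> (\<lambda>x. G x $ i) \<phi>))"

definition H1 :: "(real^'n::finite) set \<Rightarrow> (real^'n \<Rightarrow> real) set" where
  "H1 \<Omega> = {u \<in> L2 \<Omega>. \<exists>G. is_weak_grad \<Omega> u G}"

text \<open>For \<open>u\<close> in \<open>H1 \<Omega>\<close> the weak gradient is determined up to a null set of \<open>\<Omega>\<close>.\<close>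

definition weak_grad :: "(real^'n::finite) set \<Rightarrow> (real^'n \<Rightarrow> real) \<Rightarrow> real^'n \<Rightarrow> real^'n" where
  "weak_grad \<Omega> u = (SOME G. is_weak_grad \<Omega> u G)"

definition H1_norm :: "(real^'n::finite) set \<Rightarrow> (real^'n \<Rightarrow> real) \<Rightarrow> real" where
  "H1_norm \<Omega> u =
     sqrt ((LINT x|lebesgue_on \<Omega>. (u x)\<^sup>2) + (LINT x|lebesgue_on \<Omega>. (norm (weak_grad \<Omega> u x))\<^sup>2))"

definition H10 :: "(real^'n::finite) set \<Rightarrow> (real^'n \<Rightarrow> real) set" where
  "H10 \<Omega> =
     {u \<in> H1 \<Omega>. \<forall>\<delta>>0. \<exists>\<phi>\<in>test_functions \<Omega>. H1_norm \<Omega> (\<lambda>x. u x - \<phi> x) < \<delta>}"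

definition Linf_norm ::
  "(real^'n::finite) set \<Rightarrow> (real^'n \<Rightarrow> 'b::real_normed_vector) \<Rightarrow> ereal" where
  "Linf_norm \<Omega> F = esssup (lebesgue_on \<Omega>) (\<lambda>x. ereal (norm (F x)))"

text \<open>Eigenvalues are counted with multiplicity and indexed from \<open>0\<close>. The last condition,
  completeness in \<open>L2 \<Omega>\<close>, says that no eigenfunction has been left out.\<close>

definition is_dirichlet_eigensystem ::
  "(real^'n::finite) set \<Rightarrow> (real^'n \<Rightarrow> real^'n^'n) \<Rightarrow>
   (nat \<Rightarrow> real) \<Rightarrow> (nat \<Rightarrow> real^'n \<Rightarrow> real) \<Rightarrow> bool" where
  "is_dirichlet_eigensystem \<Omega> a lam \<phi> \<longleftrightarrow>
     0 < lam 0 \<and> mono lam \<and>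
     (\<forall>k. \<phi> k \<in> H10 \<Omega> \<and>
          (\<forall>v\<in>H10 \<Omega>. (LINT x|lebesgue_on \<Omega>. weak_grad \<Omega> v x \<bullet> (a x *v weak_grad \<Omega> (\<phi> k) x))
                        = lam k * L2_inner \<Omega> (\<phi> k) v)) \<and>
     (\<forall>j k. L2_inner \<Omega> (\<phi> j) (\<phi> k) = (if j = k then 1 else 0)) \<and>
     (\<forall>u\<in>L2 \<Omega>. (\<forall>k. L2_inner \<Omega> u (\<phi> k) = 0) \<longrightarrow> (AE x in lebesgue_on \<Omega>. u x = 0))"

text \<open>One eigensystem is selected; the fractional powers, spaces and norms defined from it do not
  depend on the selection.\<close>

definition dirichlet_eigensystem ::
  "(real^'n::finite) set \<Rightarrow> (real^'n \<Rightarrow> real^'n^'n) \<Rightarrow> (nat \<Rightarrow> real) \<times> (nat \<Rightarrow> real^'n \<Rightarrow> real)" where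
  "dirichlet_eigensystem \<Omega> a = (SOME p. is_dirichlet_eigensystem \<Omega> a (fst p) (snd p))"

definition eigval :: "(real^'n::finite) set \<Rightarrow> (real^'n \<Rightarrow> real^'n^'n) \<Rightarrow> nat \<Rightarrow> real" where
  "eigval \<Omega> a = fst (dirichlet_eigensystem \<Omega> a)"

definition eigfun ::
  "(real^'n::finite) set \<Rightarrow> (real^'n \<Rightarrow> real^'n^'n) \<Rightarrow> nat \<Rightarrow> real^'n \<Rightarrow> real" where
  "eigfun \<Omega> a = snd (dirichlet_eigensystem \<Omega> a)"

abbreviation lap_eigval :: "(real^'n::finite) set \<Rightarrow> nat \<Rightarrow> real" where
  "lap_eigval \<Omega> \<equiv> eigval \<Omega> (\<lambda>x. mat 1)"

abbreviation lap_eigfun :: "(real^'n::finite) set \<Rightarrow> nat \<Rightarrow> real^'n \<Rightarrow> real" where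
  "lap_eigfun \<Omega> \<equiv> eigfun \<Omega> (\<lambda>x. mat 1)"

text \<open>The space of order \<open>s \<ge> 0\<close> consists of functions. The space of order \<open>-s\<close> is realised as its
  dual: an element is a bounded linear functional on \<open>Hs \<Omega> s\<close> (its values elsewhere carry no
  meaning), and \<open>(f, e\<^sub>k)\<close> is \<open>f (lap_eigfun \<Omega> k)\<close>.\<close>

definition Hs :: "(real^'n::finite) set \<Rightarrow> real \<Rightarrow> (real^'n \<Rightarrow> real) set" where
  "Hs \<Omega> s = {u \<in> L2 \<Omega>. summable (\<lambda>k. lap_eigval \<Omega> k powr s * (L2_inner \<Omega> u (lap_eigfun \<Omega> k))\<^sup>2)}"

definition Hs_norm :: "(real^'n::finite) set \<Rightarrow> real \<Rightarrow> (real^'n \<Rightarrow> real) \<Rightarrow> real" where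
  "Hs_norm \<Omega> s u = sqrt (\<Sum>k. lap_eigval \<Omega> k powr s * (L2_inner \<Omega> u (lap_eigfun \<Omega> k))\<^sup>2)"

definition Hminus :: "(real^'n::finite) set \<Rightarrow> real \<Rightarrow> ((real^'n \<Rightarrow> real) \<Rightarrow> real) set" where
  "Hminus \<Omega> s =
     {f. (\<forall>u\<in>Hs \<Omega> s. \<forall>v\<in>Hs \<Omega> s. \<forall>b c. f (\<lambda>x. b * u x + c * v x) = b * f u + c * f v) \<and>
         (\<exists>C. \<forall>u\<in>Hs \<Omega> s. \<bar>f u\<bar> \<le> C * Hs_norm \<Omega> s u)}"

definition Hminus_norm :: "(real^'n::finite) set \<Rightarrow> real \<Rightarrow> ((real^'n \<Rightarrow> real) \<Rightarrow> real) \<Rightarrow> real" where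
  "Hminus_norm \<Omega> s f = sqrt (\<Sum>k. lap_eigval \<Omega> k powr (- s) * (f (lap_eigfun \<Omega> k))\<^sup>2)"

text \<open>Closure in \<open>Hminus \<Omega> s\<close> of the test functions on \<open>W\<close>, which act through the
  \<open>L2 \<Omega>\<close> pairing.\<close>

definition Hminus_tilde ::
  "(real^'n::finite) set \<Rightarrow> (real^'n) set \<Rightarrow> real \<Rightarrow> ((real^'n \<Rightarrow> real) \<Rightarrow> real) set" where
  "Hminus_tilde \<Omega> W s =
     {f \<in> Hminus \<Omega> s.
        \<forall>\<delta>>0. \<exists>\<phi>\<in>test_functions W. Hminus_norm \<Omega> s (\<lambda>v. f v - L2_inner \<Omega> \<phi> v) < \<delta>}"

text \<open>Quotient norm on the restrictions to \<open>W\<close> of elements of \<open>Hs \<Omega> s\<close>; it is infinite for a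
  function that is not such a restriction.\<close>

definition Hs_quot_norm ::
  "(real^'n::finite) set \<Rightarrow> (real^'n) set \<Rightarrow> real \<Rightarrow> (real^'n \<Rightarrow> real) \<Rightarrow> ennreal" where
  "Hs_quot_norm \<Omega> W s w =
     (INF U\<in>{U \<in> Hs \<Omega> s. AE x in lebesgue_on W. U x = w x}. ennreal (Hs_norm \<Omega> s U))"

definition op_norm ::
  "(real^'n::finite) set \<Rightarrow> (real^'n) set \<Rightarrow> real \<Rightarrow>
   (((real^'n \<Rightarrow> real) \<Rightarrow> real) \<Rightarrow> (real^'n \<Rightarrow> real)) \<Rightarrow> ennreal" where
  "op_norm \<Omega> W s T =
     (SUP f\<in>{f \<in> Hminus_tilde \<Omega> W s. Hminus_norm \<Omega> s f \<le> 1}. Hs_quot_norm \<Omega> W s (T f))"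

text \<open>The power \<open>L\<^sub>a\<^sup>s u\<close> as an element of \<open>Hminus \<Omega> s\<close>, for \<open>u\<close> in \<open>Hs \<Omega> s\<close>.\<close>

definition frac_power ::
  "(real^'n::finite) set \<Rightarrow> (real^'n \<Rightarrow> real^'n^'n) \<Rightarrow> real \<Rightarrow>
   (real^'n \<Rightarrow> real) \<Rightarrow> (real^'n \<Rightarrow> real) \<Rightarrow> real" where
  "frac_power \<Omega> a s u =
     (\<lambda>v. \<Sum>k. eigval \<Omega> a k powr s * L2_inner \<Omega> u (eigfun \<Omega> a k) * L2_inner \<Omega> (eigfun \<Omega> a k) v)"

text \<open>For \<open>f\<close> in \<open>Hminus \<Omega> s\<close> the solution is unique up to a null set of \<open>\<Omega>\<close>.\<close>

definition solution ::
  "(real^'n::finite) set \<Rightarrow> (real^'n \<Rightarrow> real^'n^'n) \<Rightarrow> real \<Rightarrow>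
   ((real^'n \<Rightarrow> real) \<Rightarrow> real) \<Rightarrow> real^'n \<Rightarrow> real" where
  "solution \<Omega> a s f = (SOME u. u \<in> Hs \<Omega> s \<and> (\<forall>v\<in>Hs \<Omega> s. frac_power \<Omega> a s u v = f v))"

definition source_to_solution ::
  "(real^'n::finite) set \<Rightarrow> (real^'n) set \<Rightarrow> real \<Rightarrow> (real^'n \<Rightarrow> real^'n^'n) \<Rightarrow>
   ((real^'n \<Rightarrow> real) \<Rightarrow> real) \<Rightarrow> real^'n \<Rightarrow> real" where
  "source_to_solution \<Omega> W s a f = restrict (solution \<Omega> a s f) W"

definition sts_dist ::
  "(real^'n::finite) set \<Rightarrow> (real^'n) set \<Rightarrow> real \<Rightarrow>
   (real^'n \<Rightarrow> real^'n^'n) \<Rightarrow> (real^'n \<Rightarrow> real^'n^'n) \<Rightarrow> ennreal" where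
  "sts_dist \<Omega> W s a1 a2 =
     op_norm \<Omega> W s (\<lambda>f x. source_to_solution \<Omega> W s a1 f x - source_to_solution \<Omega> W s a2 f x)"

text \<open>Matrices carry the norm of \<^typ>\<open>real^'n^'n\<close>, that is, the Frobenius norm.\<close>

definition C1_norm ::
  "(real^'n::finite) set \<Rightarrow> (real^'n \<Rightarrow> 'b::real_normed_vector) \<Rightarrow> ennreal" where
  "C1_norm \<Omega> F =
     (SUP x\<in>\<Omega>. ennreal (norm (F x))) + (\<Sum>i\<in>UNIV. SUP x\<in>\<Omega>. ennreal (norm (pderiv_at i F x)))"

definition coeff_class ::
  "(real^'n::finite) set \<Rightarrow> (real^'n) set \<Rightarrow> real \<Rightarrow> real \<Rightarrow> (real^'n \<Rightarrow> real^'n^'n) set" where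
  "coeff_class \<Omega> A r0 \<theta> =
     {a. Ck_on 1 \<Omega> a \<and> (\<forall>x\<in>\<Omega>. transpose (a x) = a x) \<and>
         C1_norm \<Omega> (\<lambda>x. a x - mat 1) \<le> ennreal r0 \<and>
         (\<forall>x\<in>\<Omega>. \<forall>\<xi>. \<theta> * (norm \<xi>)\<^sup>2 \<le> \<xi> \<bullet> (a x *v \<xi>) \<and>
                     \<xi> \<bullet> (a x *v \<xi>) \<le> inverse \<theta> * (norm \<xi>)\<^sup>2) \<and>
         (\<forall>x\<in>\<Omega> - A. a x = mat 1)}"

text \<open>Only the values on \<open>[0,\<infinity>)\<close> matter; \<open>\<omega> 0 = 0\<close> follows from monotonicity and the limit.\<close>

definition modulus_of_continuity :: "(real \<Rightarrow> real) \<Rightarrow> bool" where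
  "modulus_of_continuity \<omega> \<longleftrightarrow>
     (\<forall>t\<ge>0. 0 \<le> \<omega> t) \<and> mono_on {0..} \<omega> \<and> (\<omega> \<longlongrightarrow> 0) (at_right 0)"

end

theory Submission
  imports Defs "HOL-Real_Asymp.Real_Asymp"
begin

text \<open>The coefficient class contains anisotropic matrix fields, and this makes the source-to-solution
  operator exactly non-unique. If \<open>\<Phi>\<close> is a volume preserving diffeomorphism that is the identity
  outside a ball contained in \<open>A\<close>, then composition with \<open>\<Phi>\<close> is unitary on \<open>L2\<close> and
  maps the Dirichlet eigensystems of the push-forward \<open>a\<close> of the identity matrix under \<open>\<Phi>\<close>
  to those of the identity. Since \<open>\<Phi>\<close> fixes \<open>W\<close> pointwise, \<open>a\<close> and the identity
  have the same source-to-solution operator on \<open>W\<close>, although \<open>a\<close> differs from the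
  identity; a fixed pair of coefficients therefore serves all small \<open>\<epsilon>\<close>. Such a \<open>\<Phi>\<close> is a
  rotation by a radially varying angle in a coordinate plane. Two coordinate directions are available because
  in dimension one \<open>\<Omega> - closure A\<close> is disconnected.\<close>

section \<open>The space of square integrable functions\<close>

text \<open>Composition with \<open>\<Phi>\<close> is an isometry of \<open>L2\<close> and respects
  \<open>H10\<close>, but \<open>Hs\<close> and its dual are defined through the eigenfunctions of
  the Laplacian, which \<open>\<Phi>\<close> does not preserve. The main obstacle is to show that
  composition maps \<open>Hs\<close> to itself. For \<open>0 < s < 1\<close> this is real
  interpolation between \<open>L2\<close> and the energy space: the energy forms are comparable by
  ellipticity, and the K-functional is explicit in an eigenbasis. A second obstacle is that
  eigensystems are selected by \<open>SOME\<close>. The system selected for the new coefficient need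
  not be the transported one, so the fractional form has to be shown independent of the choice.
  Sources on \<open>W\<close> are unaffected by \<open>\<Phi>\<close> because they are limits of
  test functions on \<open>W\<close>. Volume is preserved because the maps \<open>\<Phi> t\<close>
  form the flow of a divergence free field; this replaces a change of variables with Jacobian
  determinants. The time \<open>t\<close> of the flow also serves to bring the coefficient as close
  to the identity as \<open>r0\<close> and \<open>\<theta>\<close> demand.\<close>

lemma L2_measurable [measurable_dest]: "u \<in> L2 \<Omega> \<Longrightarrow> u \<in> borel_measurable (lebesgue_on \<Omega>)"
  by (simp add: L2_def)

lemma L2I:
  "u \<in> borel_measurable (lebesgue_on \<Omega>) \<Longrightarrow> integrable (lebesgue_on \<Omega>) (\<lambda>x. (u x)\<^sup>2) \<Longrightarrow> u \<in> L2 \<Omega>"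
  by (simp add: L2_def)

lemma L2_integrable_square: "u \<in> L2 \<Omega> \<Longrightarrow> integrable (lebesgue_on \<Omega>) (\<lambda>x. (u x)\<^sup>2)"
  by (simp add: L2_def)

lemma L2_integrable_mult:
  assumes "u \<in> L2 \<Omega>" "v \<in> L2 \<Omega>"
  shows "integrable (lebesgue_on \<Omega>) (\<lambda>x. u x * v x)"
proof (rule Bochner_Integration.integrable_bound)
  show "integrable (lebesgue_on \<Omega>) (\<lambda>x. (u x)\<^sup>2 + (v x)\<^sup>2)"
    using assms by (simp add: L2_def)
  show "(\<lambda>x. u x * v x) \<in> borel_measurable (lebesgue_on \<Omega>)"
    using assms by measurable
  have "\<bar>a * b\<bar> \<le> a\<^sup>2 + b\<^sup>2" for a b :: real
  proof -
    have "2 * (\<bar>a\<bar> * \<bar>b\<bar>) \<le> a\<^sup>2 + b\<^sup>2"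
      using sum_squares_bound[of "\<bar>a\<bar>" "\<bar>b\<bar>"] by simp
    moreover have "0 \<le> \<bar>a\<bar> * \<bar>b\<bar>" by simp
    ultimately show ?thesis unfolding abs_mult by linarith
  qed
  then show "AE x in lebesgue_on \<Omega>. norm (u x * v x) \<le> norm ((u x)\<^sup>2 + (v x)\<^sup>2)"
    by auto
qed

lemma L2_scale: "u \<in> L2 \<Omega> \<Longrightarrow> (\<lambda>x. c * u x) \<in> L2 \<Omega>"
proof (intro L2I)
  assume u: "u \<in> L2 \<Omega>"
  then show "(\<lambda>x. c * u x) \<in> borel_measurable (lebesgue_on \<Omega>)" by measurable
  show "integrable (lebesgue_on \<Omega>) (\<lambda>x. (c * u x)\<^sup>2)"
    using L2_integrable_square[OF u] by (simp add: power_mult_distrib)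
qed

lemma L2_add:
  assumes "u \<in> L2 \<Omega>" "v \<in> L2 \<Omega>" shows "(\<lambda>x. u x + v x) \<in> L2 \<Omega>"
proof -
  have "integrable (lebesgue_on \<Omega>) (\<lambda>x. (u x)\<^sup>2 + (v x)\<^sup>2 + 2 * (u x * v x))"
    using assms by (intro Bochner_Integration.integrable_add integrable_mult_right L2_integrable_mult) (auto simp: L2_def)
  then have "integrable (lebesgue_on \<Omega>) (\<lambda>x. (u x + v x)\<^sup>2)"
    by (simp add: power2_sum mult.assoc)
  moreover have "(\<lambda>x. u x + v x) \<in> borel_measurable (lebesgue_on \<Omega>)"
    using assms by measurable
  ultimately show ?thesis by (intro L2I)
qed

lemma L2_diff:
  assumes "u \<in> L2 \<Omega>" "v \<in> L2 \<Omega>" shows "(\<lambda>x. u x - v x) \<in> L2 \<Omega>"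
  using L2_add[OF assms(1) L2_scale[OF assms(2), of "-1"]] by simp

lemma L2_lincomb:
  "u \<in> L2 \<Omega> \<Longrightarrow> v \<in> L2 \<Omega> \<Longrightarrow> (\<lambda>x. b * u x + c * v x) \<in> L2 \<Omega>"
  by (intro L2_add L2_scale)

lemma L2_zero: "(\<lambda>x. 0) \<in> L2 \<Omega>"
  by (simp add: L2_def)

lemma L2_sum: "(\<And>i. i \<in> I \<Longrightarrow> u i \<in> L2 \<Omega>) \<Longrightarrow> (\<lambda>x. \<Sum>i\<in>I. u i x) \<in> L2 \<Omega>"
  by (induction I rule: infinite_finite_induct) (auto intro: L2_zero L2_add)

lemma L2_abs: "u \<in> L2 \<Omega> \<Longrightarrow> (\<lambda>x. \<bar>u x\<bar>) \<in> L2 \<Omega>"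
proof (intro L2I)
  assume u: "u \<in> L2 \<Omega>"
  then show "(\<lambda>x. \<bar>u x\<bar>) \<in> borel_measurable (lebesgue_on \<Omega>)" by measurable
  show "integrable (lebesgue_on \<Omega>) (\<lambda>x. \<bar>u x\<bar>\<^sup>2)"
    using L2_integrable_square[OF u] by simp
qed

lemma L2_inner_commute: "L2_inner \<Omega> u v = L2_inner \<Omega> v u"
  by (simp add: L2_inner_def mult.commute)

lemma L2_inner_scale_left [simp]: "L2_inner \<Omega> (\<lambda>x. c * u x) v = c * L2_inner \<Omega> u v"
  by (simp add: L2_inner_def mult.assoc)

lemma L2_inner_scale_right [simp]: "L2_inner \<Omega> u (\<lambda>x. c * v x) = c * L2_inner \<Omega> u v"
  by (subst (1 2) L2_inner_commute) simp

lemma L2_inner_zero_left [simp]: "L2_inner \<Omega> (\<lambda>x. 0) v = 0"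
  by (simp add: L2_inner_def)

lemma L2_inner_zero_right [simp]: "L2_inner \<Omega> v (\<lambda>x. 0) = 0"
  by (simp add: L2_inner_def)

lemma L2_inner_add_left:
  "u \<in> L2 \<Omega> \<Longrightarrow> v \<in> L2 \<Omega> \<Longrightarrow> w \<in> L2 \<Omega> \<Longrightarrow>
   L2_inner \<Omega> (\<lambda>x. u x + v x) w = L2_inner \<Omega> u w + L2_inner \<Omega> v w"
  by (simp add: L2_inner_def ring_distribs L2_integrable_mult)

lemma L2_inner_diff_left:
  "u \<in> L2 \<Omega> \<Longrightarrow> v \<in> L2 \<Omega> \<Longrightarrow> w \<in> L2 \<Omega> \<Longrightarrow>
   L2_inner \<Omega> (\<lambda>x. u x - v x) w = L2_inner \<Omega> u w - L2_inner \<Omega> v w"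
  by (simp add: L2_inner_def ring_distribs L2_integrable_mult)

lemma L2_inner_diff_right:
  "u \<in> L2 \<Omega> \<Longrightarrow> v \<in> L2 \<Omega> \<Longrightarrow> w \<in> L2 \<Omega> \<Longrightarrow>
   L2_inner \<Omega> w (\<lambda>x. u x - v x) = L2_inner \<Omega> w u - L2_inner \<Omega> w v"
  by (subst (1 2 3) L2_inner_commute) (rule L2_inner_diff_left)

lemma L2_inner_lincomb_left:
  "u \<in> L2 \<Omega> \<Longrightarrow> v \<in> L2 \<Omega> \<Longrightarrow> w \<in> L2 \<Omega> \<Longrightarrow>
   L2_inner \<Omega> (\<lambda>x. b * u x + c * v x) w = b * L2_inner \<Omega> u w + c * L2_inner \<Omega> v w"
  by (simp add: L2_inner_add_left L2_scale)

lemma L2_inner_lincomb_right: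
  "u \<in> L2 \<Omega> \<Longrightarrow> v \<in> L2 \<Omega> \<Longrightarrow> w \<in> L2 \<Omega> \<Longrightarrow>
   L2_inner \<Omega> w (\<lambda>x. b * u x + c * v x) = b * L2_inner \<Omega> w u + c * L2_inner \<Omega> w v"
  by (subst (1 2 3) L2_inner_commute) (rule L2_inner_lincomb_left)

lemma L2_inner_sum_left:
  assumes "\<And>i. i \<in> I \<Longrightarrow> u i \<in> L2 \<Omega>" "w \<in> L2 \<Omega>"
  shows "L2_inner \<Omega> (\<lambda>x. \<Sum>i\<in>I. u i x) w = (\<Sum>i\<in>I. L2_inner \<Omega> (u i) w)"
  using assms
  by (induction I rule: infinite_finite_induct) (auto simp: L2_inner_add_left L2_sum)

lemma L2_inner_self_nonneg: "0 \<le> L2_inner \<Omega> u u"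
  by (simp add: L2_inner_def)

lemma L2_inner_cong:
  assumes "u \<in> L2 \<Omega>" "v \<in> L2 \<Omega>" "u' \<in> L2 \<Omega>" "v' \<in> L2 \<Omega>"
    "AE x in lebesgue_on \<Omega>. u x = u' x" "AE x in lebesgue_on \<Omega>. v x = v' x"
  shows "L2_inner \<Omega> u v = L2_inner \<Omega> u' v'"
  unfolding L2_inner_def
proof (rule integral_cong_AE)
  show "AE x in lebesgue_on \<Omega>. u x * v x = u' x * v' x"
    using assms(5,6) by eventually_elim simp
qed (use assms in \<open>auto simp: L2_def\<close>)

lemma L2_inner_self_eq_0:
  assumes "u \<in> L2 \<Omega>" "L2_inner \<Omega> u u = 0"
  shows "AE x in lebesgue_on \<Omega>. u x = 0"
proof -
  have "AE x in lebesgue_on \<Omega>. (u x)\<^sup>2 = 0"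
    using assms by (subst integral_nonneg_eq_0_iff_AE[symmetric])
      (auto simp: L2_def L2_inner_def power2_eq_square)
  then show ?thesis by simp
qed

lemma L2_Cauchy_Schwarz:
  assumes u: "u \<in> L2 \<Omega>" and v: "v \<in> L2 \<Omega>"
  shows "(L2_inner \<Omega> u v)\<^sup>2 \<le> L2_inner \<Omega> u u * L2_inner \<Omega> v v"
proof -
  define a b c where "a = L2_inner \<Omega> v v" and "b = L2_inner \<Omega> u v" and "c = L2_inner \<Omega> u u"
  have nonneg: "0 \<le> c - 2 * t * b + t\<^sup>2 * a" for t
  proof -
    let ?w = "\<lambda>x. 1 * u x + (-t) * v x"
    have "L2_inner \<Omega> ?w ?w = 1 * L2_inner \<Omega> u ?w + (-t) * L2_inner \<Omega> v ?w"
      by (rule L2_inner_lincomb_left[OF u v L2_lincomb[OF u v]])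
    also have "L2_inner \<Omega> u ?w = c - t * b"
      using L2_inner_lincomb_right[OF u v u, of 1 "-t"] by (simp add: b_def c_def)
    also have "L2_inner \<Omega> v ?w = b - t * a"
      using L2_inner_lincomb_right[OF u v v, of 1 "-t"] by (simp add: a_def b_def L2_inner_commute)
    finally have "L2_inner \<Omega> ?w ?w = c - 2 * t * b + t\<^sup>2 * a"
      by (simp add: algebra_simps power2_eq_square)
    then show ?thesis using L2_inner_self_nonneg[of \<Omega> ?w] by simp
  qed
  show ?thesis
  proof (cases "a = 0")
    case False
    then have "a > 0" using L2_inner_self_nonneg[of \<Omega> v] a_def by simp
    \<comment> \<open>The quadratic polynomial is smallest at \<open>b / a\<close>.\<close>
    have "0 \<le> c - b\<^sup>2 / a"
      using nonneg[of "b / a"] \<open>a > 0\<close> by (simp add: power2_eq_square field_simps)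
    then have "b\<^sup>2 \<le> c * a" using \<open>a > 0\<close> by (simp add: field_simps)
    then show ?thesis by (simp add: a_def b_def c_def)
  next
    case True
    have "AE x in lebesgue_on \<Omega>. v x = 0"
      using True by (intro L2_inner_self_eq_0[OF v]) (simp add: a_def)
    then have "b = L2_inner \<Omega> u (\<lambda>x. 0)"
      unfolding b_def by (intro L2_inner_cong) (use u v L2_zero in auto)
    then show ?thesis by (simp add: b_def L2_inner_self_nonneg)
  qed
qed

section \<open>The L2 norm and its completeness\<close>

definition L2_norm :: "(real^'n::finite) set \<Rightarrow> (real^'n \<Rightarrow> real) \<Rightarrow> real" where
  "L2_norm \<Omega> u = sqrt (L2_inner \<Omega> u u)"

lemma L2_norm_nonneg [simp]: "0 \<le> L2_norm \<Omega> u"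
  by (simp add: L2_norm_def L2_inner_self_nonneg)

lemma L2_norm_square: "(L2_norm \<Omega> u)\<^sup>2 = L2_inner \<Omega> u u"
  by (simp add: L2_norm_def L2_inner_self_nonneg)

lemma L2_inner_le_norm:
  "u \<in> L2 \<Omega> \<Longrightarrow> v \<in> L2 \<Omega> \<Longrightarrow> \<bar>L2_inner \<Omega> u v\<bar> \<le> L2_norm \<Omega> u * L2_norm \<Omega> v"
  using L2_Cauchy_Schwarz[of u \<Omega> v]
  by (simp add: L2_norm_def real_le_rsqrt flip: real_sqrt_mult)

lemma L2_norm_triangle:
  assumes "u \<in> L2 \<Omega>" "v \<in> L2 \<Omega>"
  shows "L2_norm \<Omega> (\<lambda>x. u x + v x) \<le> L2_norm \<Omega> u + L2_norm \<Omega> v"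
proof (rule power2_le_imp_le)
  have "(L2_norm \<Omega> (\<lambda>x. u x + v x))\<^sup>2 = L2_inner \<Omega> u u + 2 * L2_inner \<Omega> u v + L2_inner \<Omega> v v"
    unfolding L2_norm_square
    using L2_inner_lincomb_left[of u \<Omega> v _ 1 1] L2_inner_lincomb_right[of u \<Omega> v _ 1 1] assms
      L2_add[OF assms] L2_inner_commute[of \<Omega> v u]
    by simp
  also have "\<dots> \<le> (L2_norm \<Omega> u + L2_norm \<Omega> v)\<^sup>2"
    using L2_inner_le_norm[OF assms] by (simp add: power2_sum L2_norm_square)
  finally show "(L2_norm \<Omega> (\<lambda>x. u x + v x))\<^sup>2 \<le> (L2_norm \<Omega> u + L2_norm \<Omega> v)\<^sup>2" .
qed simp

lemma L2_norm_scale: "L2_norm \<Omega> (\<lambda>x. c * u x) = \<bar>c\<bar> * L2_norm \<Omega> u"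
  by (simp add: L2_norm_def real_sqrt_mult)

lemma L2_norm_abs: "L2_norm \<Omega> (\<lambda>x. \<bar>u x\<bar>) = L2_norm \<Omega> u"
  by (simp add: L2_norm_def L2_inner_def)

lemma L2_norm_minus_commute: "L2_norm \<Omega> (\<lambda>x. u x - v x) = L2_norm \<Omega> (\<lambda>x. v x - u x)"
  using L2_norm_scale[of \<Omega> "-1" "\<lambda>x. u x - v x"] by simp

lemma L2_norm_triangle_diff:
  assumes "u \<in> L2 \<Omega>" "v \<in> L2 \<Omega>" "w \<in> L2 \<Omega>"
  shows "L2_norm \<Omega> (\<lambda>x. u x - w x) \<le> L2_norm \<Omega> (\<lambda>x. u x - v x) + L2_norm \<Omega> (\<lambda>x. v x - w x)"
  using L2_norm_triangle[OF L2_diff[OF assms(1,2)] L2_diff[OF assms(2,3)]] by simp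

lemma L2_norm_sum:
  assumes "\<And>i. i \<in> I \<Longrightarrow> u i \<in> L2 \<Omega>" "finite I"
  shows "L2_norm \<Omega> (\<lambda>x. \<Sum>i\<in>I. u i x) \<le> (\<Sum>i\<in>I. L2_norm \<Omega> (u i))"
  using assms(2,1)
proof (induction I rule: finite_induct)
  case empty
  then show ?case by (simp add: L2_norm_def)
next
  case (insert i I)
  then have "L2_norm \<Omega> (\<lambda>x. u i x + (\<Sum>i\<in>I. u i x)) \<le> L2_norm \<Omega> (u i) + L2_norm \<Omega> (\<lambda>x. \<Sum>i\<in>I. u i x)"
    by (intro L2_norm_triangle L2_sum) auto
  also have "\<dots> \<le> L2_norm \<Omega> (u i) + (\<Sum>i\<in>I. L2_norm \<Omega> (u i))"
    using insert by simp
  finally show ?case using insert by simp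
qed

lemma L2_tendsto_inner:
  assumes "\<And>n. u n \<in> L2 \<Omega>" "w \<in> L2 \<Omega>" "v \<in> L2 \<Omega>"
    and lim: "(\<lambda>n. L2_norm \<Omega> (\<lambda>x. w x - u n x)) \<longlonglongrightarrow> 0"
  shows "(\<lambda>n. L2_inner \<Omega> (u n) v) \<longlonglongrightarrow> L2_inner \<Omega> w v"
proof (rule LIM_zero_cancel, rule Lim_null_comparison)
  show "\<forall>\<^sub>F n in sequentially. norm (L2_inner \<Omega> (u n) v - L2_inner \<Omega> w v) \<le>
      L2_norm \<Omega> (\<lambda>x. w x - u n x) * L2_norm \<Omega> v"
  proof (intro always_eventually allI)
    fix n
    have "L2_inner \<Omega> (u n) v - L2_inner \<Omega> w v = - L2_inner \<Omega> (\<lambda>x. w x - u n x) v"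
      by (simp add: L2_inner_diff_left assms)
    then show "norm (L2_inner \<Omega> (u n) v - L2_inner \<Omega> w v) \<le> L2_norm \<Omega> (\<lambda>x. w x - u n x) * L2_norm \<Omega> v"
      using L2_inner_le_norm[OF L2_diff[OF assms(2) assms(1)[of n]] assms(3)] by simp
  qed
  show "(\<lambda>n. L2_norm \<Omega> (\<lambda>x. w x - u n x) * L2_norm \<Omega> v) \<longlonglongrightarrow> 0"
    using tendsto_mult_left_zero[OF lim] .
qed

text \<open>Fischer's argument: the increments of a fast Cauchy sequence are dominated by a square
  integrable function, so the sequence converges almost everywhere and dominated convergence gives
  convergence in norm.\<close>

lemma L2_complete_fast:
  assumes u: "\<And>n. u n \<in> L2 \<Omega>"
    and fast: "\<And>n. L2_norm \<Omega> (\<lambda>x. u (Suc n) x - u n x) \<le> (1/2)^n"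
  shows "\<exists>w\<in>L2 \<Omega>. (\<lambda>n. L2_norm \<Omega> (\<lambda>x. w x - u n x)) \<longlonglongrightarrow> 0"
proof -
  let ?M = "lebesgue_on \<Omega>"
  define d where "d n x = u (Suc n) x - u n x" for n x
  define S where "S N x = (\<Sum>n<N. \<bar>d n x\<bar>)" for N x
  have d: "d n \<in> L2 \<Omega>" for n unfolding d_def using u by (intro L2_diff)
  have [measurable]: "d n \<in> borel_measurable ?M" "u n \<in> borel_measurable ?M" for n
    using d u by (auto simp: L2_def)
  have S: "S N \<in> L2 \<Omega>" for N unfolding S_def by (intro L2_sum L2_abs d)
  have SN: "L2_norm \<Omega> (S N) \<le> 2" for N
  proof -
    have "L2_norm \<Omega> (S N) \<le> (\<Sum>n<N. L2_norm \<Omega> (\<lambda>x. \<bar>d n x\<bar>))"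
      unfolding S_def by (intro L2_norm_sum L2_abs d) auto
    also have "\<dots> \<le> (\<Sum>n<N. (1/2)^n)"
      using fast by (intro sum_mono) (auto simp: L2_norm_abs d_def)
    also have "\<dots> \<le> (\<Sum>n. (1/2::real)^n)" by (intro sum_le_suminf) auto
    also have "\<dots> = 2" by (simp add: suminf_geometric)
    finally show ?thesis .
  qed
  have [measurable]: "S N \<in> borel_measurable ?M" for N using S by (rule L2_measurable)
  have S_mono: "S N x \<le> S (Suc N) x" for N x unfolding S_def by simp
  have S_nonneg: "0 \<le> S N x" for N x unfolding S_def by (simp add: sum_nonneg)
  have nn_le: "(\<integral>\<^sup>+x. ennreal ((S N x)\<^sup>2) \<partial>?M) \<le> 4" for N
  proof -
    have "(\<integral>\<^sup>+x. ennreal ((S N x)\<^sup>2) \<partial>?M) = ennreal ((L2_norm \<Omega> (S N))\<^sup>2)"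
      unfolding L2_norm_square L2_inner_def using S[of N]
      by (subst nn_integral_eq_integral) (auto simp: L2_def power2_eq_square)
    also have "\<dots> \<le> ennreal 4"
      using power_mono[OF SN[of N], of 2] by (intro ennreal_leI) simp
    finally show ?thesis by simp
  qed
  \<comment> \<open>The supremum is taken in \<open>ennreal\<close>, so that monotone convergence
    applies before it is known to be finite; \<open>enn2real (T x)\<close> becomes the dominating
    function.\<close>
  define T where "T x = (SUP N. ennreal ((S N x)\<^sup>2))" for x
  have [measurable]: "(\<lambda>x. ennreal ((S N x)\<^sup>2)) \<in> borel_measurable ?M" for N by measurable
  have "(\<integral>\<^sup>+x. T x \<partial>?M) = (SUP N. \<integral>\<^sup>+x. ennreal ((S N x)\<^sup>2) \<partial>?M)"
    unfolding T_def
    by (rule nn_integral_monotone_convergence_SUP)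
      (auto simp: incseq_Suc_iff le_fun_def intro!: power_mono S_mono S_nonneg ennreal_leI)
  also have "\<dots> \<le> 4" by (rule SUP_least) (rule nn_le)
  finally have T_le: "(\<integral>\<^sup>+x. T x \<partial>?M) \<le> 4" .
  have T_meas [measurable]: "T \<in> borel_measurable ?M" unfolding T_def by simp
  have "AE x in ?M. T x \<noteq> \<infinity>"
    using T_le by (intro nn_integral_PInf_AE) (auto simp: top_unique)
  then have fin: "AE x in ?M. (\<forall>N. (S N x)\<^sup>2 \<le> enn2real (T x)) \<and> T x = ennreal (enn2real (T x))"
  proof eventually_elim
    case (elim x)
    have "ennreal ((S N x)\<^sup>2) \<le> T x" for N unfolding T_def by (rule SUP_upper) simp
    then have "(S N x)\<^sup>2 \<le> enn2real (T x)" for N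
      using elim by (metis enn2real_ennreal enn2real_mono zero_le_power2 infinity_ennreal_def top.not_eq_extremum)
    then show ?case using elim by (auto simp: ennreal_enn2real_if)
  qed
  have T_int: "integrable ?M (\<lambda>x. enn2real (T x))"
  proof (rule integrableI_nonneg)
    have "(\<integral>\<^sup>+x. ennreal (enn2real (T x)) \<partial>?M) = (\<integral>\<^sup>+x. T x \<partial>?M)"
    proof (rule nn_integral_cong_AE)
      show "AE x in ?M. ennreal (enn2real (T x)) = T x" using fin by eventually_elim simp
    qed
    then show "(\<integral>\<^sup>+x. ennreal (enn2real (T x)) \<partial>?M) < \<infinity>"
      using T_le by (metis ennreal_numeral infinity_ennreal_def ennreal_less_top order_le_less_trans)
  qed auto
  define w where "w x = u 0 x + (\<Sum>n. d n x)" for x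
  have [measurable]: "w \<in> borel_measurable ?M" unfolding w_def by measurable
  have tele: "u N x = u 0 x + (\<Sum>n<N. d n x)" for N x
    by (induction N) (auto simp: d_def)
  have conv: "AE x in ?M. (\<lambda>N. u N x) \<longlonglongrightarrow> w x \<and> (\<forall>N. (w x - u N x)\<^sup>2 \<le> enn2real (T x))"
    using fin
  proof eventually_elim
    case (elim x)
    have bd: "S N x \<le> sqrt (enn2real (T x))" for N
      using elim S_nonneg by (intro real_le_rsqrt) auto
    have sm: "summable (\<lambda>n. \<bar>d n x\<bar>)"
      by (rule summableI_nonneg_bounded[where x="sqrt (enn2real (T x))"]) (use bd in \<open>auto simp: S_def\<close>)
    then have sm': "summable (\<lambda>n. d n x)" by (rule summable_rabs_cancel)
    have lim: "(\<lambda>N. u N x) \<longlonglongrightarrow> w x"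
    proof -
      have "(\<lambda>N. u 0 x + (\<Sum>n<N. d n x)) \<longlonglongrightarrow> w x"
        unfolding w_def by (intro tendsto_intros summable_LIMSEQ sm')
      then show ?thesis by (simp only: tele[symmetric])
    qed
    moreover have "(w x - u N x)\<^sup>2 \<le> enn2real (T x)" for N
    proof -
      have "\<bar>u M x - u N x\<bar> \<le> sqrt (enn2real (T x))" if "M \<ge> N" for M
      proof -
        have "u M x - u N x = (\<Sum>n\<in>{N..<M}. d n x)"
          unfolding tele[of M] tele[of N] using that by (simp add: lessThan_atLeast0 sum_diff_nat_ivl)
        also have "\<bar>\<dots>\<bar> \<le> (\<Sum>n\<in>{N..<M}. \<bar>d n x\<bar>)" by (rule sum_abs)
        also have "\<dots> \<le> S M x" unfolding S_def by (intro sum_mono2) auto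
        finally show ?thesis using bd[of M] by simp
      qed
      then have "\<bar>w x - u N x\<bar> \<le> sqrt (enn2real (T x))"
        by (intro LIMSEQ_le_const2[OF tendsto_rabs[OF tendsto_diff[OF lim tendsto_const]]]) auto
      then have "\<bar>w x - u N x\<bar>\<^sup>2 \<le> (sqrt (enn2real (T x)))\<^sup>2" by (intro power_mono) auto
      then show ?thesis by simp
    qed
    ultimately show ?case by simp
  qed
  have wu: "(\<lambda>x. w x - u 0 x) \<in> L2 \<Omega>"
    unfolding L2_def mem_Collect_eq
  proof
    show "integrable ?M (\<lambda>x. (w x - u 0 x)\<^sup>2)"
    proof (rule Bochner_Integration.integrable_bound[OF T_int])
      show "AE x in ?M. norm ((w x - u 0 x)\<^sup>2) \<le> norm (enn2real (T x))"
        using conv by eventually_elim simp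
    qed simp
  qed simp
  have w: "w \<in> L2 \<Omega>" using L2_add[OF wu u[of 0]] by simp
  have "(\<lambda>N. L2_inner \<Omega> (\<lambda>x. w x - u N x) (\<lambda>x. w x - u N x)) \<longlonglongrightarrow> (LINT x|?M. 0)"
    unfolding L2_inner_def power2_eq_square[symmetric]
  proof (rule integral_dominated_convergence[OF _ _ T_int])
    show "AE x in ?M. (\<lambda>N. (w x - u N x)\<^sup>2) \<longlonglongrightarrow> 0"
      using conv
    proof eventually_elim
      case (elim x)
      then have "(\<lambda>N. (w x - u N x)\<^sup>2) \<longlonglongrightarrow> (w x - w x)\<^sup>2" by (intro tendsto_intros) auto
      then show ?case by simp
    qed
    show "AE x in ?M. norm ((w x - u N x)\<^sup>2) \<le> enn2real (T x)" for N
      using conv by eventually_elim auto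
  qed auto
  then have "(\<lambda>N. L2_norm \<Omega> (\<lambda>x. w x - u N x)) \<longlonglongrightarrow> sqrt 0"
    unfolding L2_norm_def by (intro tendsto_real_sqrt) simp
  then show ?thesis using w by auto
qed

text \<open>A subsequence has geometrically small increments and converges by
  \<open>L2_complete_fast\<close>; the Cauchy property pulls the whole sequence to the same
  limit.\<close>

lemma L2_complete:
  assumes u: "\<And>n. u n \<in> L2 \<Omega>"
    and cauchy: "\<And>e. 0 < e \<Longrightarrow> \<exists>N. \<forall>m\<ge>N. \<forall>n\<ge>N. L2_norm \<Omega> (\<lambda>x. u m x - u n x) < e"
  shows "\<exists>w\<in>L2 \<Omega>. (\<lambda>n. L2_norm \<Omega> (\<lambda>x. w x - u n x)) \<longlonglongrightarrow> 0"
proof -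
  have "\<forall>k. \<exists>N. \<forall>m\<ge>N. \<forall>n\<ge>N. L2_norm \<Omega> (\<lambda>x. u m x - u n x) < (1/2)^k"
    using cauchy by simp
  then obtain R where R: "\<And>k m n. m \<ge> R k \<Longrightarrow> n \<ge> R k \<Longrightarrow> L2_norm \<Omega> (\<lambda>x. u m x - u n x) < (1/2)^k"
    by metis
  \<comment> \<open>Partial sums make the indices nondecreasing while keeping them at least
    \<open>R k\<close>.\<close>
  define r where "r k = (\<Sum>i\<le>k. R i)" for k
  have rR: "r k \<ge> R k" for k unfolding r_def by (intro member_le_sum) auto
  have r_mono: "r k \<le> r (Suc k)" for k unfolding r_def by simp
  obtain w where w: "w \<in> L2 \<Omega>" and lim: "(\<lambda>k. L2_norm \<Omega> (\<lambda>x. w x - u (r k) x)) \<longlonglongrightarrow> 0"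
  proof -
    have "L2_norm \<Omega> (\<lambda>x. u (r (Suc k)) x - u (r k) x) \<le> (1/2)^k" for k
      by (intro less_imp_le[OF R] rR order_trans[OF rR r_mono])
    then show ?thesis using L2_complete_fast[of "\<lambda>k. u (r k)" \<Omega>] u that by auto
  qed
  have "(\<lambda>n. L2_norm \<Omega> (\<lambda>x. w x - u n x)) \<longlonglongrightarrow> 0"
  proof (rule LIMSEQ_I)
    fix e :: real assume "0 < e"
    obtain K1 where K1: "\<And>k. k \<ge> K1 \<Longrightarrow> L2_norm \<Omega> (\<lambda>x. w x - u (r k) x) < e / 2"
      using LIMSEQ_D[OF lim, of "e/2"] \<open>0 < e\<close> by auto
    obtain K2 where K2: "(1/2::real)^K2 < e / 2" using \<open>0 < e\<close> real_arch_pow_inv[of "e/2" "1/2"] by auto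
    define k where "k = max K1 K2"
    have "(1/2::real)^k \<le> (1/2)^K2" unfolding k_def by (intro power_decreasing) auto
    then have "L2_norm \<Omega> (\<lambda>x. w x - u n x) < e" if "n \<ge> R k" for n
      using L2_norm_triangle_diff[OF w u[of "r k"] u[of n]] K1[of k] K2 R[OF rR[of k] that]
      unfolding k_def by linarith
    then show "\<exists>no. \<forall>n\<ge>no. norm (L2_norm \<Omega> (\<lambda>x. w x - u n x) - 0) < e" by auto
  qed
  then show ?thesis using w by auto
qed

section \<open>Complete orthonormal systems\<close>

text \<open>Completeness is assumed in the form supplied by \<open>is_dirichlet_eigensystem\<close>;
  norm convergence of expansions and the Parseval identity are derived from it.\<close>

locale orthonormal_basis =
  fixes \<Omega> :: "(real^'n::finite) set" and \<phi> :: "nat \<Rightarrow> real^'n \<Rightarrow> real"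
  assumes in_L2: "\<phi> k \<in> L2 \<Omega>"
    and orthonormal: "L2_inner \<Omega> (\<phi> j) (\<phi> k) = (if j = k then 1 else 0)"
    and complete: "u \<in> L2 \<Omega> \<Longrightarrow> (\<And>k. L2_inner \<Omega> u (\<phi> k) = 0) \<Longrightarrow> AE x in lebesgue_on \<Omega>. u x = 0"
begin

lemma partial_in_L2: "(\<lambda>x. \<Sum>k\<in>I. c k * \<phi> k x) \<in> L2 \<Omega>"
  by (intro L2_sum L2_scale in_L2)

lemma inner_partial:
  "u \<in> L2 \<Omega> \<Longrightarrow> L2_inner \<Omega> (\<lambda>x. \<Sum>k\<in>I. c k * \<phi> k x) u = (\<Sum>k\<in>I. c k * L2_inner \<Omega> u (\<phi> k))"
  by (subst L2_inner_sum_left) (auto intro: L2_scale in_L2 simp: L2_inner_commute)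

lemma inner_partial_basis:
  "finite I \<Longrightarrow> L2_inner \<Omega> (\<lambda>x. \<Sum>k\<in>I. c k * \<phi> k x) (\<phi> j) = (if j \<in> I then c j else 0)"
  by (simp add: inner_partial in_L2 orthonormal if_distrib cong: if_cong)

lemma inner_partial_partial:
  "finite I \<Longrightarrow> L2_inner \<Omega> (\<lambda>x. \<Sum>k\<in>I. c k * \<phi> k x) (\<lambda>x. \<Sum>k\<in>I. c k * \<phi> k x) = (\<Sum>k\<in>I. (c k)\<^sup>2)"
  by (subst inner_partial[OF partial_in_L2])
    (auto simp: inner_partial_basis power2_eq_square intro!: sum.cong)

lemma inner_remainder:
  assumes "u \<in> L2 \<Omega>" "finite I"
  defines "r \<equiv> (\<lambda>x. u x - (\<Sum>k\<in>I. L2_inner \<Omega> u (\<phi> k) * \<phi> k x))"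
  shows "L2_inner \<Omega> r r = L2_inner \<Omega> u u - (\<Sum>k\<in>I. (L2_inner \<Omega> u (\<phi> k))\<^sup>2)"
proof -
  let ?P = "\<lambda>x. (\<Sum>k\<in>I. L2_inner \<Omega> u (\<phi> k) * \<phi> k x)"
  have P: "?P \<in> L2 \<Omega>" by (rule partial_in_L2)
  have uP: "L2_inner \<Omega> ?P u = (\<Sum>k\<in>I. (L2_inner \<Omega> u (\<phi> k))\<^sup>2)"
    using assms by (simp add: inner_partial power2_eq_square)
  have "L2_inner \<Omega> r r = L2_inner \<Omega> u u - 2 * L2_inner \<Omega> ?P u + L2_inner \<Omega> ?P ?P"
    unfolding r_def using L2_diff[OF assms(1) P] assms(1) P
    by (simp add: L2_inner_diff_left L2_inner_diff_right L2_inner_commute[of \<Omega> u ?P])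
  then show ?thesis using uP inner_partial_partial[OF assms(2)] by simp
qed

lemma Bessel:
  assumes "u \<in> L2 \<Omega>" "finite I"
  shows "(\<Sum>k\<in>I. (L2_inner \<Omega> u (\<phi> k))\<^sup>2) \<le> L2_inner \<Omega> u u"
  using inner_remainder[OF assms]
    L2_inner_self_nonneg[of \<Omega> "\<lambda>x. u x - (\<Sum>k\<in>I. L2_inner \<Omega> u (\<phi> k) * \<phi> k x)"] by linarith

lemma summable_coeff: "u \<in> L2 \<Omega> \<Longrightarrow> summable (\<lambda>k. (L2_inner \<Omega> u (\<phi> k))\<^sup>2)"
  by (rule summableI_nonneg_bounded[where x="L2_inner \<Omega> u u"]) (auto intro: Bessel)

text \<open>Orthonormality turns the distance of two partial sums into a block of the series of
  squares, so the partial sums are Cauchy.\<close>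

lemma Riesz_Fischer_strong:
  assumes "summable (\<lambda>k. (c k)\<^sup>2)"
  shows "\<exists>w\<in>L2 \<Omega>. (\<lambda>N. L2_norm \<Omega> (\<lambda>x. w x - (\<Sum>k<N. c k * \<phi> k x))) \<longlonglongrightarrow> 0"
proof (rule L2_complete)
  fix e :: real assume "0 < e"
  then have "0 < e\<^sup>2" by simp
  then obtain N where N: "\<And>m n. m \<ge> N \<Longrightarrow> norm (\<Sum>k\<in>{m..<n}. (c k)\<^sup>2) < e\<^sup>2"
    using assms unfolding summable_Cauchy by blast
  have *: "L2_norm \<Omega> (\<lambda>x. (\<Sum>k<n. c k * \<phi> k x) - (\<Sum>k<m. c k * \<phi> k x)) < e" if "m \<ge> N" "m \<le> n" for m n
  proof -
    have "(\<lambda>x. (\<Sum>k<n. c k * \<phi> k x) - (\<Sum>k<m. c k * \<phi> k x)) = (\<lambda>x. \<Sum>k\<in>{m..<n}. c k * \<phi> k x)"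
      using that by (simp add: lessThan_atLeast0 sum_diff_nat_ivl)
    then have "L2_norm \<Omega> (\<lambda>x. (\<Sum>k<n. c k * \<phi> k x) - (\<Sum>k<m. c k * \<phi> k x)) = sqrt (\<Sum>k\<in>{m..<n}. (c k)\<^sup>2)"
      by (simp add: L2_norm_def inner_partial_partial)
    also have "\<dots> < e" using N[of m n] that \<open>0 < e\<close> by (intro real_less_lsqrt) (auto simp: sum_nonneg)
    finally show ?thesis .
  qed
  have "L2_norm \<Omega> (\<lambda>x. (\<Sum>k<n. c k * \<phi> k x) - (\<Sum>k<m. c k * \<phi> k x)) < e" if "m \<ge> N" "n \<ge> N" for m n
    using *[of m n] *[of n m] that by (cases "m \<le> n") (auto simp: L2_norm_minus_commute[of \<Omega> "\<lambda>x. \<Sum>k<n. c k * \<phi> k x"])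
  then show "\<exists>N. \<forall>m\<ge>N. \<forall>n\<ge>N. L2_norm \<Omega> (\<lambda>x. (\<Sum>k<m. c k * \<phi> k x) - (\<Sum>k<n. c k * \<phi> k x)) < e"
    by blast
qed (rule partial_in_L2)

lemma Riesz_Fischer:
  assumes "summable (\<lambda>k. (c k)\<^sup>2)"
  obtains w where "w \<in> L2 \<Omega>" "\<And>k. L2_inner \<Omega> w (\<phi> k) = c k"
    "(\<lambda>N. L2_norm \<Omega> (\<lambda>x. w x - (\<Sum>k<N. c k * \<phi> k x))) \<longlonglongrightarrow> 0"
proof -
  obtain w where w: "w \<in> L2 \<Omega>" and lim: "(\<lambda>N. L2_norm \<Omega> (\<lambda>x. w x - (\<Sum>k<N. c k * \<phi> k x))) \<longlonglongrightarrow> 0"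
    using Riesz_Fischer_strong[OF assms] by auto
  have "L2_inner \<Omega> w (\<phi> j) = c j" for j
  proof (rule LIMSEQ_unique)
    show "(\<lambda>N. L2_inner \<Omega> (\<lambda>x. \<Sum>k<N. c k * \<phi> k x) (\<phi> j)) \<longlonglongrightarrow> L2_inner \<Omega> w (\<phi> j)"
      by (rule L2_tendsto_inner[OF partial_in_L2 w in_L2 lim])
    show "(\<lambda>N. L2_inner \<Omega> (\<lambda>x. \<Sum>k<N. c k * \<phi> k x) (\<phi> j)) \<longlonglongrightarrow> c j"
      by (rule tendsto_eventually) (auto simp: inner_partial_basis eventually_sequentially intro!: exI[of _ "Suc j"])
  qed
  then show ?thesis using that w lim by blast
qed

text \<open>The Riesz-Fischer limit \<open>w\<close> has the same coefficients as \<open>u\<close>,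
  and completeness identifies the two almost everywhere.\<close>

lemma expansion:
  assumes u: "u \<in> L2 \<Omega>"
  shows "(\<lambda>N. L2_norm \<Omega> (\<lambda>x. u x - (\<Sum>k<N. L2_inner \<Omega> u (\<phi> k) * \<phi> k x))) \<longlonglongrightarrow> 0"
proof -
  let ?P = "\<lambda>N x. \<Sum>k<N. L2_inner \<Omega> u (\<phi> k) * \<phi> k x"
  obtain w where w: "w \<in> L2 \<Omega>" "\<And>k. L2_inner \<Omega> w (\<phi> k) = L2_inner \<Omega> u (\<phi> k)"
    and lim: "(\<lambda>N. L2_norm \<Omega> (\<lambda>x. w x - ?P N x)) \<longlonglongrightarrow> 0"
    by (rule Riesz_Fischer[OF summable_coeff[OF u]]) (rule that)
  have "AE x in lebesgue_on \<Omega>. w x - u x = 0"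
    using w u by (intro complete L2_diff) (auto simp: L2_inner_diff_left in_L2)
  then have ae: "AE x in lebesgue_on \<Omega>. w x - ?P N x = u x - ?P N x" for N
    by eventually_elim simp
  have "L2_norm \<Omega> (\<lambda>x. w x - ?P N x) = L2_norm \<Omega> (\<lambda>x. u x - ?P N x)" for N
    unfolding L2_norm_def
    using L2_inner_cong[OF _ _ _ _ ae ae] L2_diff[OF w(1) partial_in_L2] L2_diff[OF u partial_in_L2]
    by simp
  then show ?thesis using lim by simp
qed

lemma Parseval:
  assumes "u \<in> L2 \<Omega>" "v \<in> L2 \<Omega>"
  shows "(\<lambda>k. L2_inner \<Omega> u (\<phi> k) * L2_inner \<Omega> v (\<phi> k)) sums L2_inner \<Omega> u v"
  unfolding sums_def
  using L2_tendsto_inner[OF partial_in_L2 assms expansion[OF assms(1)]]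
  by (simp add: inner_partial assms)

end

section \<open>Smooth functions\<close>

definition grad :: "(real^'n::finite \<Rightarrow> real) \<Rightarrow> real^'n \<Rightarrow> real^'n" where
  "grad f x = (\<chi> i. pderiv_at i f x)"

lemma pderiv_at_eq: "(f has_derivative D) (at x) \<Longrightarrow> pderiv_at i f x = D (axis i 1)"
  unfolding pderiv_at_def by (metis frechet_derivative_at)

lemma linear_axis_expansion:
  fixes D :: "real^'n::finite \<Rightarrow> 'b::real_vector"
  assumes "linear D"
  shows "D h = (\<Sum>i\<in>UNIV. h $ i *\<^sub>R D (axis i 1))"
proof -
  have "h = (\<Sum>i\<in>UNIV. h $ i *\<^sub>R axis i 1)"
    using basis_expansion[of h] by (simp add: scalar_mult_eq_scaleR)
  then have "D h = D (\<Sum>i\<in>UNIV. h $ i *\<^sub>R axis i 1)" by simp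
  also have "\<dots> = (\<Sum>i\<in>UNIV. h $ i *\<^sub>R D (axis i 1))"
    by (simp add: linear_sum[OF assms] linear_cmul[OF assms])
  finally show ?thesis .
qed

lemma has_derivative_grad:
  assumes "f differentiable (at x)"
  shows "(f has_derivative (\<lambda>h. grad f x \<bullet> h)) (at x)"
proof -
  obtain D where D: "(f has_derivative D) (at x)" using assms by (auto simp: differentiable_def)
  have "D h = grad f x \<bullet> h" for h
    using linear_axis_expansion[OF has_derivative_linear[OF D], of h]
    by (simp add: inner_vec_def grad_def pderiv_at_eq[OF D] mult.commute)
  then have "D = (\<lambda>h. grad f x \<bullet> h)" by auto
  with D show ?thesis by simp
qed

lemma gradI:
  assumes "(f has_derivative (\<lambda>h. v \<bullet> h)) (at x)"
  shows "grad f x = v"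
  by (simp add: vec_eq_iff grad_def pderiv_at_eq[OF assms] inner_axis)

lemma Ck_on_Suc_imp: "Ck_on (Suc k) U f \<Longrightarrow> Ck_on k U f"
proof (induction k arbitrary: f)
  case 0
  then show ?case
    by (auto intro!: continuous_at_imp_continuous_on differentiable_imp_continuous_within)
qed auto

lemma Ck_differentiable: "Ck_on (Suc k) UNIV f \<Longrightarrow> f differentiable (at x)"
  by simp

text \<open>Replaces the chosen derivative inside \<open>pderiv_at\<close> by any explicit one,
  which is what the inductions over the order below can handle.\<close>

lemma Ck_SucI:
  assumes D: "\<And>x. (f has_derivative D x) (at x)" and "\<And>i. Ck_on k UNIV (\<lambda>x. D x (axis i 1))"
  shows "Ck_on (Suc k) UNIV f"
proof -
  have "pderiv_at i f = (\<lambda>x. D x (axis i 1))" for i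
    by (intro ext pderiv_at_eq D)
  then show ?thesis using assms by (auto simp: differentiable_def)
qed

lemma Ck_const: "Ck_on k (UNIV :: (real^'n::finite) set) (\<lambda>x. c :: real)"
proof (induction k arbitrary: c)
  case (Suc k)
  show ?case by (rule Ck_SucI[OF has_derivative_const Suc])
qed simp

lemma Ck_component: "Ck_on k UNIV (\<lambda>x :: real^'n::finite. x $ j)"
proof (cases k)
  case (Suc l)
  show ?thesis unfolding Suc
    by (rule Ck_SucI[OF bounded_linear.has_derivative[OF bounded_linear_vec_nth has_derivative_ident] Ck_const])
qed (simp add: continuous_on_component)

lemma Ck_add:
  fixes f g :: "real^'n::finite \<Rightarrow> real"
  shows "Ck_on k UNIV f \<Longrightarrow> Ck_on k UNIV g \<Longrightarrow> Ck_on k UNIV (\<lambda>x. f x + g x)"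
proof (induction k arbitrary: f g)
  case 0
  then show ?case by (simp add: continuous_on_add)
next
  case (Suc k)
  show ?case
  proof (rule Ck_SucI)
    show "((\<lambda>x. f x + g x) has_derivative (\<lambda>h. grad f x \<bullet> h + grad g x \<bullet> h)) (at x)" for x
      by (intro has_derivative_add has_derivative_grad Ck_differentiable[OF Suc.prems(1)] Ck_differentiable[OF Suc.prems(2)])
    show "Ck_on k UNIV (\<lambda>x. grad f x \<bullet> axis i 1 + grad g x \<bullet> axis i 1)" for i
      using Suc by (simp add: grad_def inner_axis)
  qed
qed

lemma Ck_mult:
  fixes f g :: "real^'n::finite \<Rightarrow> real"
  shows "Ck_on k UNIV f \<Longrightarrow> Ck_on k UNIV g \<Longrightarrow> Ck_on k UNIV (\<lambda>x. f x * g x)"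
proof (induction k arbitrary: f g)
  case 0
  then show ?case by (simp add: continuous_on_mult)
next
  case (Suc k)
  show ?case
  proof (rule Ck_SucI)
    show "((\<lambda>x. f x * g x) has_derivative (\<lambda>h. f x * (grad g x \<bullet> h) + (grad f x \<bullet> h) * g x)) (at x)" for x
      by (intro has_derivative_mult has_derivative_grad Ck_differentiable[OF Suc.prems(1)] Ck_differentiable[OF Suc.prems(2)])
    show "Ck_on k UNIV (\<lambda>x. f x * (grad g x \<bullet> axis i 1) + (grad f x \<bullet> axis i 1) * g x)" for i
      using Suc.prems Ck_on_Suc_imp[OF Suc.prems(1)] Ck_on_Suc_imp[OF Suc.prems(2)]
      by (auto intro!: Ck_add Suc.IH simp: grad_def inner_axis)
  qed
qed

lemma Ck_sum:
  fixes f :: "'i \<Rightarrow> real^'n::finite \<Rightarrow> real"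
  shows "(\<And>i. i \<in> I \<Longrightarrow> Ck_on k UNIV (f i)) \<Longrightarrow> Ck_on k UNIV (\<lambda>x. \<Sum>i\<in>I. f i x)"
  by (induction I rule: infinite_finite_induct) (auto intro: Ck_const Ck_add)

lemma Ck_prod:
  fixes f :: "'i \<Rightarrow> real^'n::finite \<Rightarrow> real"
  shows "(\<And>i. i \<in> I \<Longrightarrow> Ck_on k UNIV (f i)) \<Longrightarrow> Ck_on k UNIV (\<lambda>x. \<Prod>i\<in>I. f i x)"
  by (induction I rule: infinite_finite_induct) (auto intro: Ck_const Ck_mult)

lemma Ck_diff:
  fixes f g :: "real^'n::finite \<Rightarrow> real"
  shows "Ck_on k UNIV f \<Longrightarrow> Ck_on k UNIV g \<Longrightarrow> Ck_on k UNIV (\<lambda>x. f x - g x)"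
  using Ck_add[of k f "\<lambda>x. (-1) * g x", OF _ Ck_mult[OF Ck_const]] by simp

text \<open>A smooth function of one variable is given together with the sequence of its derivatives.\<close>

lemma Ck_compose_real:
  fixes q :: "real^'n::finite \<Rightarrow> real"
  assumes h: "\<And>m t. (h m has_real_derivative h (Suc m) t) (at t)"
  shows "Ck_on k UNIV q \<Longrightarrow> Ck_on k UNIV (\<lambda>x. h m (q x))"
proof (induction k arbitrary: m)
  case 0
  have "continuous_on UNIV (h m)"
    by (meson h DERIV_continuous continuous_at_imp_continuous_on)
  then show ?case using 0 continuous_on_compose2[of UNIV "h m" UNIV q] by auto
next
  case (Suc k)
  show ?case
  proof (rule Ck_SucI)
    show "((\<lambda>x. h m (q x)) has_derivative (\<lambda>d. h (Suc m) (q x) * (grad q x \<bullet> d))) (at x)" for x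
      using has_derivative_compose[OF has_derivative_grad[OF Ck_differentiable[OF Suc.prems]]
          h[unfolded has_field_derivative_def]] by simp
    show "Ck_on k UNIV (\<lambda>x. h (Suc m) (q x) * (grad q x \<bullet> axis i 1))" for i
      using Suc.prems by (auto intro!: Ck_mult Suc.IH Ck_on_Suc_imp[OF Suc.prems] simp: grad_def inner_axis)
  qed
qed

text \<open>By the chain rule a partial derivative of the composition is a sum of products of a
  composition of the same shape and a partial derivative of a component of \<open>\<Phi>\<close>.
  Hence the induction is over the order with \<open>f\<close> generalised.\<close>

lemma Ck_compose:
  fixes \<Phi> :: "real^'m::finite \<Rightarrow> real^'n::finite" and f :: "real^'n \<Rightarrow> real"
  assumes D\<Phi>: "\<And>x. (\<Phi> has_derivative D\<Phi> x) (at x)"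
  shows "Ck_on k UNIV f \<Longrightarrow> (\<And>j. Ck_on k UNIV (\<lambda>x. \<Phi> x $ j)) \<Longrightarrow> Ck_on k UNIV (\<lambda>x. f (\<Phi> x))"
proof (induction k arbitrary: f)
  case 0
  have "continuous_on UNIV \<Phi>"
    by (meson D\<Phi> has_derivative_continuous continuous_at_imp_continuous_on)
  then show ?case using 0 continuous_on_compose2[of UNIV f UNIV \<Phi>] by auto
next
  case (Suc k)
  have Dj: "((\<lambda>x. \<Phi> x $ j) has_derivative (\<lambda>h. D\<Phi> x h $ j)) (at x)" for x j
    by (rule bounded_linear.has_derivative[OF bounded_linear_vec_nth D\<Phi>])
  show ?case
  proof (rule Ck_SucI)
    show "((\<lambda>x. f (\<Phi> x)) has_derivative (\<lambda>d. grad f (\<Phi> x) \<bullet> D\<Phi> x d)) (at x)" for x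
      using has_derivative_compose[OF D\<Phi> has_derivative_grad[OF Ck_differentiable[OF Suc.prems(1)]]] .
    have eq: "grad f (\<Phi> x) \<bullet> D\<Phi> x (axis i 1) =
        (\<Sum>j\<in>UNIV. pderiv_at j f (\<Phi> x) * pderiv_at i (\<lambda>x. \<Phi> x $ j) x)" for i x
      by (simp add: pderiv_at_eq[OF Dj] inner_vec_def grad_def)
    show "Ck_on k UNIV (\<lambda>x. grad f (\<Phi> x) \<bullet> D\<Phi> x (axis i 1))" for i
      unfolding eq
    proof (rule Ck_sum, rule Ck_mult)
      fix j
      show "Ck_on k UNIV (\<lambda>x. pderiv_at j f (\<Phi> x))"
        by (rule Suc.IH) (use Suc.prems(1) in simp, rule Ck_on_Suc_imp[OF Suc.prems(2)])
      show "Ck_on k UNIV (pderiv_at i (\<lambda>x. \<Phi> x $ j))"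
        using Suc.prems(2)[of j] by simp
    qed
  qed
qed

text \<open>The functions \<open>t \<mapsto> P(1/t) exp(-1/t)\<close>, extended by zero, are closed under differentiation.\<close>

definition flat :: "real poly \<Rightarrow> real \<Rightarrow> real" where
  "flat p t = (if 0 < t then poly p (1/t) * exp (- (1/t)) else 0)"

text \<open>With \<open>y = 1/t\<close> one has \<open>dy/dt = - y^2\<close>, so the derivative of
  \<open>p(y) exp(-y)\<close> is \<open>y^2 (p(y) - p'(y)) exp(-y)\<close>.\<close>

definition flat_deriv :: "real poly \<Rightarrow> real poly" where
  "flat_deriv p = monom 1 2 * (p - pderiv p)"

lemma poly_exp_tendsto_0: "((\<lambda>y. poly p y * exp (- y)) \<longlongrightarrow> 0) at_top" for p :: "real poly"
proof -
  have "((\<lambda>y. \<Sum>i\<le>degree p. coeff p i * (y ^ i / exp y)) \<longlongrightarrow> (\<Sum>i\<le>degree p. coeff p i * 0)) at_top"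
    by (intro tendsto_intros tendsto_power_div_exp_0)
  then show ?thesis by (simp add: poly_altdef exp_minus divide_inverse sum_distrib_right mult.assoc)
qed

lemma flat_has_derivative: "(flat p has_real_derivative flat (flat_deriv p) t) (at t)"
proof -
  consider "t < 0" | "t > 0" | "t = 0" by linarith
  then show ?thesis
  proof cases
    case 1
    have "((\<lambda>t. 0) has_real_derivative flat (flat_deriv p) t) (at t)"
      using 1 by (simp add: flat_def)
    then show ?thesis
      by (rule DERIV_cong_ev[THEN iffD1, rotated -1])
        (use 1 in \<open>auto simp: flat_def eventually_nhds intro!: exI[of _ "{..<0}"]\<close>)
  next
    case 2
    have d: "((\<lambda>t. 1/t) has_real_derivative - (1/t\<^sup>2)) (at t)"
      using 2 by (auto intro!: derivative_eq_intros simp: power2_eq_square)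
    have "poly (pderiv p) (1/t) * - (1/t\<^sup>2) * exp (- (1/t)) + exp (- (1/t)) * - (- (1/t\<^sup>2)) * poly p (1/t)
        = flat (flat_deriv p) t"
      using 2 by (simp add: flat_def flat_deriv_def poly_monom algebra_simps power_one_over)
    then have "((\<lambda>t. poly p (1/t) * exp (- (1/t))) has_real_derivative flat (flat_deriv p) t) (at t)"
      using DERIV_mult[OF DERIV_chain2[OF poly_DERIV d] DERIV_fun_exp[OF DERIV_minus[OF d]], of p] by simp
    then show ?thesis
      by (rule DERIV_cong_ev[THEN iffD1, rotated -1])
        (use 2 in \<open>auto simp: flat_def eventually_nhds intro!: exI[of _ "{0<..}"]\<close>)
  next
    case 3
    \<comment> \<open>The difference quotient at 0 is \<open>p(y) exp(-y)\<close> divided by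
      \<open>h = 1/y\<close>, hence the same expression for the polynomial
      \<open>pCons 0 p\<close>.\<close>
    have "((\<lambda>h. poly (pCons 0 p) (1/h) * exp (- (1/h))) \<longlongrightarrow> 0) (at_right (0::real))"
      using filterlim_compose[OF poly_exp_tendsto_0[of "pCons 0 p"] filterlim_inverse_at_top_right]
      by (simp add: divide_inverse)
    then have R: "((\<lambda>h. flat p h / h) \<longlongrightarrow> 0) (at_right 0)"
      by (rule Lim_transform_eventually)
        (auto simp: eventually_at_filter flat_def field_simps)
    have L: "((\<lambda>h. flat p h / h) \<longlongrightarrow> 0) (at_left 0)"
      by (rule tendsto_eventually) (auto simp: eventually_at_filter flat_def)
    show ?thesis unfolding 3 DERIV_def
      using filterlim_split_at[OF L R] by (simp add: flat_def)
  qed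
qed

lemma Ck_flat:
  "Ck_on k UNIV q \<Longrightarrow> Ck_on k UNIV (\<lambda>x. flat p (q x))" for q :: "real^'n::finite \<Rightarrow> real"
  using Ck_compose_real[of "\<lambda>m. flat ((flat_deriv ^^ m) p)" k q 0] flat_has_derivative by simp

lemma Ck_sin: "Ck_on k UNIV q \<Longrightarrow> Ck_on k UNIV (\<lambda>x. sin (q x))" for q :: "real^'n::finite \<Rightarrow> real"
proof -
  \<comment> \<open>Each differentiation of the sine is a shift by a quarter period, which gives the
    whole sequence of derivatives in closed form.\<close>
  have "((\<lambda>t. sin (t + m * (pi / 2))) has_real_derivative sin (t + Suc m * (pi / 2))) (at t)" for m t
  proof -
    have "t + Suc m * (pi / 2) = (t + m * (pi / 2)) + pi / 2" by (simp add: field_simps)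
    then have "sin (t + Suc m * (pi / 2)) = cos (t + m * (pi / 2))" by (simp only: sin_add) simp
    then show ?thesis by (auto intro!: derivative_eq_intros)
  qed
  from Ck_compose_real[of "\<lambda>m t. sin (t + real m * (pi / 2))" k q 0, OF this]
  show "Ck_on k UNIV q \<Longrightarrow> Ck_on k UNIV (\<lambda>x. sin (q x))" by simp
qed

lemma Ck_cos: "Ck_on k UNIV q \<Longrightarrow> Ck_on k UNIV (\<lambda>x. cos (q x))" for q :: "real^'n::finite \<Rightarrow> real"
  using Ck_sin[OF Ck_diff[OF Ck_const, of k q "pi/2"]] by (simp add: cos_sin_eq)

section \<open>Test functions\<close>

text \<open>Any compact set outside which the function vanishes may stand in for its support, so
  closure properties need not compute supports.\<close>

lemma test_functions_iff:
  "\<phi> \<in> test_functions S \<longleftrightarrow> smooth_on UNIV \<phi> \<and> (\<exists>K. compact K \<and> K \<subseteq> S \<and> (\<forall>x. x \<notin> K \<longrightarrow> \<phi> x = 0))"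
proof
  assume "\<phi> \<in> test_functions S"
  then show "smooth_on UNIV \<phi> \<and> (\<exists>K. compact K \<and> K \<subseteq> S \<and> (\<forall>x. x \<notin> K \<longrightarrow> \<phi> x = 0))"
    unfolding test_functions_def using closure_subset[of "{x. \<phi> x \<noteq> 0}"]
    by (intro conjI exI[of _ "closure {x. \<phi> x \<noteq> 0}"]) auto
next
  assume *: "smooth_on UNIV \<phi> \<and> (\<exists>K. compact K \<and> K \<subseteq> S \<and> (\<forall>x. x \<notin> K \<longrightarrow> \<phi> x = 0))"
  then obtain K where K: "compact K" "K \<subseteq> S" "\<And>x. x \<notin> K \<Longrightarrow> \<phi> x = 0" by auto
  have "closure {x. \<phi> x \<noteq> 0} \<subseteq> K"
    using K(1,3) by (intro closure_minimal compact_imp_closed) auto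
  then show "\<phi> \<in> test_functions S"
    using * K bounded_subset[OF compact_imp_bounded[OF K(1)]]
    by (auto simp: test_functions_def compact_eq_bounded_closed)
qed

lemma test_mono: "\<phi> \<in> test_functions S \<Longrightarrow> S \<subseteq> T \<Longrightarrow> \<phi> \<in> test_functions T"
  by (auto simp: test_functions_def)

lemma test_zero_outside: "\<phi> \<in> test_functions S \<Longrightarrow> x \<notin> S \<Longrightarrow> \<phi> x = 0"
  unfolding test_functions_iff by blast

lemma test_Ck: "\<phi> \<in> test_functions S \<Longrightarrow> Ck_on k UNIV \<phi>"
  by (simp add: test_functions_def smooth_on_def)

lemma test_differentiable: "\<phi> \<in> test_functions S \<Longrightarrow> \<phi> differentiable (at x)"
  using test_Ck[of \<phi> S "Suc 0"] by simp

lemma test_has_derivative: "\<phi> \<in> test_functions S \<Longrightarrow> (\<phi> has_derivative (\<lambda>h. grad \<phi> x \<bullet> h)) (at x)"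
  by (intro has_derivative_grad test_differentiable)

lemma test_continuous: "\<phi> \<in> test_functions S \<Longrightarrow> continuous_on T \<phi>"
  using test_Ck[of \<phi> S 0] by (auto intro: continuous_on_subset)

lemma test_add:
  assumes "\<phi> \<in> test_functions S" "\<psi> \<in> test_functions S"
  shows "(\<lambda>x. b * \<phi> x + c * \<psi> x) \<in> test_functions S"
proof -
  obtain K L where "compact K" "K \<subseteq> S" "\<forall>x. x \<notin> K \<longrightarrow> \<phi> x = 0" "compact L" "L \<subseteq> S" "\<forall>x. x \<notin> L \<longrightarrow> \<psi> x = 0"
    using assms unfolding test_functions_iff by blast
  then have "compact (K \<union> L) \<and> K \<union> L \<subseteq> S \<and> (\<forall>x. x \<notin> K \<union> L \<longrightarrow> b * \<phi> x + c * \<psi> x = 0)" by auto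
  then show ?thesis
    unfolding test_functions_iff smooth_on_def using assms test_Ck
    by (intro conjI exI[of _ "K \<union> L"]) (auto intro!: Ck_add Ck_mult Ck_const)
qed

lemma test_mult:
  assumes "\<phi> \<in> test_functions S" "\<And>k. Ck_on k UNIV f"
  shows "(\<lambda>x. f x * \<phi> x) \<in> test_functions S"
  using assms unfolding test_functions_iff smooth_on_def by (auto intro!: Ck_mult)

lemma test_pderiv:
  assumes "\<phi> \<in> test_functions S"
  shows "pderiv_at i \<phi> \<in> test_functions S"
proof -
  obtain K where K: "compact K" "K \<subseteq> S" "\<And>x. x \<notin> K \<Longrightarrow> \<phi> x = 0"
    using assms unfolding test_functions_iff by blast
  have "pderiv_at i \<phi> x = 0" if "x \<notin> K" for x
  proof -
    have "(\<phi> has_derivative (\<lambda>h. 0)) (at x)"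
    proof (rule has_derivative_transform_within_open[where s="- K"])
      show "((\<lambda>x. 0) has_derivative (\<lambda>h. 0)) (at x)" by simp
    qed (use K that in \<open>auto intro: compact_imp_closed\<close>)
    then show ?thesis by (rule pderiv_at_eq)
  qed
  moreover have "Ck_on k UNIV (pderiv_at i \<phi>)" for k
    using test_Ck[OF assms, of "Suc k"] by simp
  ultimately show ?thesis unfolding test_functions_iff smooth_on_def using K by blast
qed

lemma grad_lincomb:
  assumes "f differentiable (at x)" "g differentiable (at x)"
  shows "grad (\<lambda>x. b * f x + c * g x) x = b *\<^sub>R grad f x + c *\<^sub>R grad g x"
proof (rule gradI)
  show "((\<lambda>x. b * f x + c * g x) has_derivative (\<lambda>h. (b *\<^sub>R grad f x + c *\<^sub>R grad g x) \<bullet> h)) (at x)"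
    by (rule has_derivative_eq_rhs[OF has_derivative_add[OF has_derivative_mult_right has_derivative_mult_right]])
      (auto intro: has_derivative_grad assms simp: inner_add_left)
qed

lemma integrable_compact_support:
  fixes f :: "real^'n::finite \<Rightarrow> real"
  assumes "continuous_on UNIV f" "compact K" "\<And>x. x \<notin> K \<Longrightarrow> f x = 0"
  shows "integrable lborel f"
proof -
  have "bounded (f ` K)"
    by (intro compact_imp_bounded compact_continuous_image continuous_on_subset[OF assms(1)] assms) auto
  then obtain B where B: "\<And>x. x \<in> K \<Longrightarrow> \<bar>f x\<bar> \<le> B" by (auto simp: bounded_iff)
  show ?thesis
  proof (rule Bochner_Integration.integrable_bound)
    show "integrable lborel (\<lambda>x. B * indicator K x :: real)"
      using emeasure_bounded_finite[OF compact_imp_bounded[OF assms(2)]] assms(2)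
      by (intro integrable_mult_right integrable_real_indicator) (auto simp: borel_compact)
    show "f \<in> borel_measurable lborel"
      using assms(1) by (simp add: borel_measurable_continuous_onI)
    have "\<bar>f x\<bar> \<le> \<bar>B * indicator K x\<bar>" for x
      using B[of x] assms(3)[of x] by (cases "x \<in> K") auto
    then show "AE x in lborel. norm (f x) \<le> norm (B * indicator K x)" by simp
  qed
qed

lemma test_integrable: "\<phi> \<in> test_functions S \<Longrightarrow> integrable lborel \<phi>"
  using test_functions_iff[of \<phi> S] test_continuous integrable_compact_support by metis

lemma test_bounded: "\<phi> \<in> test_functions S \<Longrightarrow> \<exists>B\<ge>0. \<forall>x. \<bar>\<phi> x\<bar> \<le> B"
proof -
  assume \<phi>: "\<phi> \<in> test_functions S"
  then obtain K where K: "compact K" "\<And>x. x \<notin> K \<Longrightarrow> \<phi> x = 0" unfolding test_functions_iff by blast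
  have "bounded (\<phi> ` K)" by (intro compact_imp_bounded compact_continuous_image test_continuous[OF \<phi>] K)
  then obtain B where B: "\<And>x. x \<in> K \<Longrightarrow> \<bar>\<phi> x\<bar> \<le> B" by (auto simp: bounded_iff)
  have "\<bar>\<phi> x\<bar> \<le> max B 0" for x using B K by (cases "x \<in> K") (auto simp: le_max_iff_disj)
  then show ?thesis by (intro exI[of _ "max B 0"]) auto
qed

text \<open>The function spaces integrate over \<open>lebesgue_on \<Omega>\<close>, whereas
  translation invariance is used over \<open>lborel\<close>; for Borel functions vanishing off
  \<Omega> the two agree.\<close>

lemma lebesgue_on_supported:
  fixes f :: "real^'n::finite \<Rightarrow> real"
  assumes \<Omega>: "open \<Omega>" and f: "f \<in> borel_measurable borel" "\<And>x. x \<notin> \<Omega> \<Longrightarrow> f x = 0"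
  shows "integrable (lebesgue_on \<Omega>) f \<longleftrightarrow> integrable lborel f"
    and "(LINT x|lebesgue_on \<Omega>. f x) = (LINT x|lborel. f x)"
proof -
  have S: "\<Omega> \<inter> space lebesgue \<in> sets lebesgue" using \<Omega> by simp
  have eq: "(\<lambda>x. indicator \<Omega> x *\<^sub>R f x) = f"
    using f(2) by (fastforce simp: indicator_def)
  show "integrable (lebesgue_on \<Omega>) f \<longleftrightarrow> integrable lborel f"
    unfolding integrable_restrict_space[OF S] eq using f by (intro integrable_completion) simp
  show "(LINT x|lebesgue_on \<Omega>. f x) = (LINT x|lborel. f x)"
    unfolding integral_restrict_space[OF S] eq using f by (intro integral_completion) simp
qed

lemma test_L2:
  assumes "\<phi> \<in> test_functions \<Omega>" "open \<Omega>"
  shows "\<phi> \<in> L2 \<Omega>"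
proof (rule L2I)
  have "\<phi> \<in> borel_measurable borel"
    by (intro borel_measurable_continuous_onI test_continuous[OF assms(1)])
  then show "\<phi> \<in> borel_measurable (lebesgue_on \<Omega>)"
    by (intro measurable_restrict_space1 measurable_completion) simp
  have "(\<lambda>x. \<phi> x * \<phi> x) \<in> test_functions \<Omega>"
    by (intro test_mult assms test_Ck[OF assms(1)])
  then have "integrable lborel (\<lambda>x. (\<phi> x)\<^sup>2)"
    unfolding power2_eq_square by (rule test_integrable)
  then show "integrable (lebesgue_on \<Omega>) (\<lambda>x. (\<phi> x)\<^sup>2)"
    using \<open>\<phi> \<in> borel_measurable borel\<close> test_zero_outside[OF assms(1)]
    by (subst lebesgue_on_supported[OF assms(2)]) auto
qed

section \<open>Integration by parts\<close>

text \<open>The mean value theorem bounds the difference quotients by \<open>w\<close>, so dominated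
  convergence applies along every sequence of increments tending to 0.\<close>

lemma has_derivative_integral_parameter:
  fixes h h' :: "real \<Rightarrow> 'a \<Rightarrow> real"
  assumes int: "\<And>t. integrable M (h t)"
    and deriv: "\<And>t x. x \<in> space M \<Longrightarrow> ((\<lambda>t. h t x) has_real_derivative h' t x) (at t)"
    and meas: "\<And>t. h' t \<in> borel_measurable M"
    and bound: "\<And>t x. x \<in> space M \<Longrightarrow> \<bar>t - t0\<bar> < 1 \<Longrightarrow> \<bar>h' t x\<bar> \<le> w x" and w: "integrable M w"
  shows "((\<lambda>t. LINT x|M. h t x) has_real_derivative (LINT x|M. h' t0 x)) (at t0)"
  unfolding DERIV_def tendsto_at_iff_sequentially
proof (intro allI impI)
  fix X :: "nat \<Rightarrow> real" assume X: "\<forall>i. X i \<in> UNIV - {0}" "X \<longlonglongrightarrow> 0"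
  have [measurable]: "h t \<in> borel_measurable M" for t using int by auto
  let ?q = "\<lambda>i x. (h (t0 + X i) x - h t0 x) / X i"
  have "\<forall>\<^sub>F i in sequentially. \<bar>X i\<bar> < 1"
    using order_tendstoD(2)[OF tendsto_rabs[OF X(2)], of 1] by simp
  \<comment> \<open>Only increments below 1 keep the intermediate points in the range where
    \<open>w\<close> is a bound.\<close>
  then obtain N where N: "\<And>i. i \<ge> N \<Longrightarrow> \<bar>X i\<bar> < 1" by (auto simp: eventually_sequentially)
  have "(\<lambda>i. LINT x|M. ?q (i + N) x) \<longlonglongrightarrow> (LINT x|M. h' t0 x)"
  proof (rule integral_dominated_convergence[OF _ _ w])
    show "AE x in M. (\<lambda>i. ?q (i + N) x) \<longlonglongrightarrow> h' t0 x"
    proof (rule AE_I2)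
      fix x assume "x \<in> space M"
      from deriv[OF this, of t0]
      have "(\<lambda>i. ?q i x) \<longlonglongrightarrow> h' t0 x"
        unfolding DERIV_def tendsto_at_iff_sequentially using X by (auto simp: comp_def)
      then show "(\<lambda>i. ?q (i + N) x) \<longlonglongrightarrow> h' t0 x" by (rule LIMSEQ_ignore_initial_segment)
    qed
    show "AE x in M. norm (?q (i + N) x) \<le> w x" for i
    proof (rule AE_I2)
      fix x assume x: "x \<in> space M"
      let ?s = "X (i + N)"
      have s: "?s \<noteq> 0" "\<bar>?s\<bar> < 1" using X N by auto
      obtain u where u: "\<bar>u - t0\<bar> < 1" "h (t0 + ?s) x - h t0 x = ?s * h' u x"
      proof (cases "?s > 0")
        case True
        then obtain z where "t0 < z" "z < t0 + ?s" "h (t0 + ?s) x - h t0 x = (t0 + ?s - t0) * h' z x"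
          using MVT2[of t0 "t0 + ?s" "\<lambda>t. h t x" "\<lambda>t. h' t x"] deriv[OF x] by auto
        then show ?thesis using s that[of z] by auto
      next
        case False
        then have "?s < 0" using s by auto
        then obtain z where "t0 + ?s < z" "z < t0" "h t0 x - h (t0 + ?s) x = (t0 - (t0 + ?s)) * h' z x"
          using MVT2[of "t0 + ?s" t0 "\<lambda>t. h t x" "\<lambda>t. h' t x"] deriv[OF x] by auto
        then show ?thesis using s that[of z] by (auto simp: algebra_simps)
      qed
      then show "norm (?q (i + N) x) \<le> w x" using bound[OF x u(1)] s by simp
    qed
  qed (auto simp: meas)
  then have lim: "(\<lambda>i. LINT x|M. ?q i x) \<longlonglongrightarrow> (LINT x|M. h' t0 x)" by (rule LIMSEQ_offset)
  have eq: "(LINT x|M. ?q i x) = ((LINT x|M. h (t0 + X i) x) - (LINT x|M. h t0 x)) / X i" for i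
    using int by simp
  show "((\<lambda>d. ((LINT x|M. h (t0 + d) x) - (LINT x|M. h t0 x)) / d) \<circ> X) \<longlonglongrightarrow> (LINT x|M. h' t0 x)"
    using lim unfolding eq comp_def .
qed

text \<open>The integral of the translates of \<open>\<phi>\<close> is constant by translation
  invariance, and its derivative in the translation parameter is the integral of the partial
  derivative.\<close>

lemma integral_pderiv_test:
  assumes \<phi>: "\<phi> \<in> test_functions (S :: (real^'n::finite) set)"
  shows "(LINT x|lborel. pderiv_at i \<phi> x) = 0"
proof -
  let ?e = "axis i 1 :: real^'n"
  obtain K where K: "compact K" "\<And>x. x \<notin> K \<Longrightarrow> \<phi> x = 0" using \<phi> unfolding test_functions_iff by blast
  obtain K' where K': "compact K'" "\<And>x. x \<notin> K' \<Longrightarrow> pderiv_at i \<phi> x = 0"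
    using test_pderiv[OF \<phi>, of i] unfolding test_functions_iff by blast
  obtain B where B: "B \<ge> 0" "\<And>x. \<bar>pderiv_at i \<phi> x\<bar> \<le> B" using test_bounded[OF test_pderiv[OF \<phi>, of i]] by auto
  obtain R where R: "\<And>x. x \<in> K' \<Longrightarrow> norm x \<le> R" using compact_imp_bounded[OF K'(1)] by (auto simp: bounded_iff)
  have shift: "(LINT x|lborel. f (x + t *\<^sub>R ?e)) = (LINT x|lborel. f x)"
    "integrable lborel f \<Longrightarrow> integrable lborel (\<lambda>x. f (x + t *\<^sub>R ?e))"
    if [measurable]: "f \<in> borel_measurable borel" for f :: "real^'n \<Rightarrow> real" and t
    using integral_distr[of "(+) (t *\<^sub>R ?e)" lborel borel f]
      integrable_distr[of "(+) (t *\<^sub>R ?e)" lborel borel f]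
    by (simp_all add: lborel_distr_plus add.commute)
  have [measurable]: "\<phi> \<in> borel_measurable borel" "pderiv_at i \<phi> \<in> borel_measurable borel"
    by (auto intro!: borel_measurable_continuous_onI test_continuous \<phi> test_pderiv)
  have "((\<lambda>t. LINT x|lborel. \<phi> (x + t *\<^sub>R ?e)) has_real_derivative (LINT x|lborel. pderiv_at i \<phi> (x + 0 *\<^sub>R ?e))) (at 0)"
  \<comment> \<open>A point that a shift of length less than 1 moves into \<open>K'\<close> has norm
    at most \<open>R + 1\<close>.\<close>
  proof (rule has_derivative_integral_parameter[where w="\<lambda>x. B * indicator (cball 0 (R + 1)) x"])
    show "integrable lborel (\<lambda>x. \<phi> (x + t *\<^sub>R ?e))" for t
      by (intro shift test_integrable[OF \<phi>]) simp
    show "((\<lambda>t. \<phi> (x + t *\<^sub>R ?e)) has_real_derivative pderiv_at i \<phi> (x + t *\<^sub>R ?e)) (at t)" for t x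
    proof -
      have "((\<lambda>t. x + t *\<^sub>R ?e) has_derivative (\<lambda>s. s *\<^sub>R ?e)) (at t)"
        by (auto intro!: derivative_eq_intros)
      from has_derivative_compose[OF this test_has_derivative[OF \<phi>]]
      show ?thesis unfolding has_field_derivative_def
        by (rule has_derivative_eq_rhs) (auto simp: grad_def inner_axis)
    qed
    show "\<bar>pderiv_at i \<phi> (x + t *\<^sub>R ?e)\<bar> \<le> B * indicator (cball 0 (R + 1)) x" if "\<bar>t - 0\<bar> < 1" for t x
    proof (cases "x + t *\<^sub>R ?e \<in> K'")
      case True
      have "norm x \<le> norm (x + t *\<^sub>R ?e) + norm (t *\<^sub>R ?e)"
        using norm_triangle_ineq4[of "x + t *\<^sub>R ?e" "t *\<^sub>R ?e"] by simp
      also have "\<dots> \<le> R + 1" using R[OF True] that by (simp add: norm_axis_1)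
      finally show ?thesis using B by simp
    next
      case False
      then show ?thesis using K' B by simp
    qed
    show "integrable lborel (\<lambda>x::real^'n. B * indicator (cball 0 (R + 1)) x :: real)"
      using emeasure_bounded_finite[of "cball (0::real^'n) (R + 1)"]
      by (intro integrable_mult_right integrable_real_indicator) auto
  qed auto
  moreover have "((\<lambda>t. LINT x|lborel. \<phi> (x + t *\<^sub>R ?e)) has_real_derivative 0) (at 0)"
    by (subst shift) auto
  ultimately show ?thesis using DERIV_unique by fastforce
qed

lemma pderiv_mult:
  fixes f g :: "real^'n::finite \<Rightarrow> real"
  assumes "f differentiable (at x)" "g differentiable (at x)"
  shows "pderiv_at i (\<lambda>x. f x * g x) x = f x * pderiv_at i g x + pderiv_at i f x * g x"
  using pderiv_at_eq[OF has_derivative_mult[OF has_derivative_grad[OF assms(1)] has_derivative_grad[OF assms(2)]], of i]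
  by (simp add: grad_def inner_axis)

lemma integration_by_parts_test:
  assumes \<Omega>: "open \<Omega>" and \<phi>: "\<phi> \<in> test_functions \<Omega>" and \<psi>: "\<psi> \<in> test_functions \<Omega>"
  shows "L2_inner \<Omega> \<phi> (pderiv_at i \<psi>) = - L2_inner \<Omega> (pderiv_at i \<phi>) \<psi>"
proof -
  have p: "(\<lambda>x. \<phi> x * \<psi> x) \<in> test_functions \<Omega>" by (intro test_mult \<psi> test_Ck[OF \<phi>])
  have "(LINT x|lebesgue_on \<Omega>. pderiv_at i (\<lambda>x. \<phi> x * \<psi> x) x) = (LINT x|lborel. pderiv_at i (\<lambda>x. \<phi> x * \<psi> x) x)"
    using test_zero_outside[OF test_pderiv[OF p]]
    by (intro lebesgue_on_supported \<Omega> borel_measurable_continuous_onI test_continuous[OF test_pderiv[OF p]])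
  then have "(LINT x|lebesgue_on \<Omega>. \<phi> x * pderiv_at i \<psi> x + pderiv_at i \<phi> x * \<psi> x) = 0"
    using integral_pderiv_test[OF p, of i]
    by (simp add: pderiv_mult[OF test_differentiable[OF \<phi>] test_differentiable[OF \<psi>]])
  then show ?thesis
    by (simp add: L2_inner_def L2_integrable_mult test_L2 test_pderiv \<phi> \<psi> \<Omega>)
qed

section \<open>Density of test functions\<close>

text \<open>The \<open>- 1\<close> makes the function vanish up to distance \<open>1/m\<close> from
  each face, so for \<open>m > 0\<close> its support is compact in the open box; as \<open>m\<close>
  grows it tends to the indicator of the box.\<close>

definition box_bump :: "real^'n::finite \<Rightarrow> real^'n \<Rightarrow> nat \<Rightarrow> real^'n \<Rightarrow> real" where
  "box_bump a b m x = (\<Prod>i\<in>UNIV. flat 1 (m * (x $ i - a $ i) - 1) * flat 1 (m * (b $ i - x $ i) - 1))"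

lemma flat_1_bounds: "0 \<le> flat 1 t" "flat 1 t \<le> 1" by (auto simp: flat_def)

lemma flat_1_tendsto:
  assumes "c > 0" shows "(\<lambda>m. flat 1 (real m * c - 1)) \<longlonglongrightarrow> 1"
proof -
  have top: "filterlim (\<lambda>m. real m * c - 1) at_top sequentially"
    using assms by real_asymp
  have "((\<lambda>t::real. exp (- (1/t))) \<longlongrightarrow> 1) at_top" by real_asymp
  then have "((\<lambda>t. flat 1 t) \<longlongrightarrow> 1) at_top"
    by (rule Lim_transform_eventually)
      (auto simp: flat_def intro: eventually_mono[OF eventually_gt_at_top[of 0]])
  then show ?thesis using top by (rule filterlim_compose)
qed

lemma box_bump_bounds: "0 \<le> box_bump a b m x" "box_bump a b m x \<le> 1"
  unfolding box_bump_def
  by (auto intro!: prod_nonneg prod_le_1 mult_nonneg_nonneg mult_le_one flat_1_bounds)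

lemma box_bump_eq_0: "x \<notin> box a b \<Longrightarrow> box_bump a b m x = 0"
proof -
  assume "x \<notin> box a b"
  then obtain i where i: "x $ i \<le> a $ i \<or> b $ i \<le> x $ i" by (auto simp: mem_box_cart not_less)
  then have "m * (x $ i - a $ i) \<le> 0 \<or> m * (b $ i - x $ i) \<le> 0" by (auto simp: mult_nonneg_nonpos)
  then have "flat 1 (m * (x $ i - a $ i) - 1) * flat 1 (m * (b $ i - x $ i) - 1) = 0"
    by (auto simp: flat_def)
  then show ?thesis unfolding box_bump_def by (meson UNIV_I finite prod_zero)
qed

lemma box_bump_tendsto:
  fixes x :: "real^'n::finite"
  shows "(\<lambda>m. box_bump a b m x) \<longlonglongrightarrow> indicator (box a b) x"
proof (cases "x \<in> box a b")
  case True
  have "(\<lambda>m. box_bump a b m x) \<longlonglongrightarrow> (\<Prod>i\<in>(UNIV :: 'n set). 1 * 1)"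
    unfolding box_bump_def
  proof (rule tendsto_prod)
    fix i
    show "(\<lambda>m. flat 1 (m * (x $ i - a $ i) - 1) * flat 1 (m * (b $ i - x $ i) - 1)) \<longlonglongrightarrow> 1 * 1"
      using True by (intro tendsto_mult flat_1_tendsto) (auto simp: mem_box_cart)
  qed
  then show ?thesis using True by simp
qed (simp add: box_bump_eq_0)

lemma box_bump_test: "m > 0 \<Longrightarrow> box_bump a b m \<in> test_functions (box a b)"
proof -
  assume m: "m > 0"
  let ?K = "cbox (\<chi> i. a $ i + 1 / m) (\<chi> i. b $ i - 1 / m)"
  have K: "?K \<subseteq> box a b"
  proof
    fix x assume x: "x \<in> ?K"
    have "a $ i < x $ i \<and> x $ i < b $ i" for i
    proof -
      have "a $ i + 1 / m \<le> x $ i" "x $ i \<le> b $ i - 1 / m" using x by (auto simp: mem_box_cart)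
      moreover have "0 < 1 / real m" using m by simp
      ultimately show ?thesis by linarith
    qed
    then show "x \<in> box a b" by (simp add: mem_box_cart)
  qed
  have "box_bump a b m x = 0" if x: "x \<notin> ?K" for x
  proof -
    obtain i where "\<not> (a $ i + 1 / m \<le> x $ i \<and> x $ i \<le> b $ i - 1 / m)"
      using x unfolding mem_box_cart vec_lambda_beta by blast
    then have i: "x $ i < a $ i + 1 / m \<or> b $ i - 1 / m < x $ i" by linarith
    then have "m * (x $ i - a $ i) - 1 < 0 \<or> m * (b $ i - x $ i) - 1 < 0"
      using m by (auto simp: field_simps)
    then have "flat 1 (m * (x $ i - a $ i) - 1) * flat 1 (m * (b $ i - x $ i) - 1) = 0"
      by (auto simp: flat_def)
    then show ?thesis unfolding box_bump_def by (meson UNIV_I finite prod_zero)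
  qed
  moreover have "Ck_on k UNIV (box_bump a b m)" for k
    unfolding box_bump_def[abs_def]
    by (intro Ck_prod Ck_mult Ck_flat Ck_diff Ck_const Ck_component)
  ultimately show ?thesis
    unfolding test_functions_iff smooth_on_def using K by (intro conjI exI[of _ ?K]) auto
qed

lemma box_bump_measurable [measurable]: "box_bump a b m \<in> borel_measurable borel"
proof (cases "m = 0")
  case True
  then have "box_bump a b m = (\<lambda>x. 0)"
    by (auto simp: box_bump_def flat_def)
  then show ?thesis by simp
qed (auto intro!: borel_measurable_continuous_onI test_continuous box_bump_test)

text \<open>Boxes form an intersection stable generator of the Borel sets, so a Dynkin argument
  extends the vanishing integrals to all Borel sets, and these determine \<open>u\<close> almost
  everywhere.\<close>

lemma AE_zero_of_box_integrals:
  fixes u :: "real^'n::finite \<Rightarrow> real"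
  assumes u: "integrable lborel u" and box: "\<And>a b. (LINT x|lborel. indicator (box a b) x * u x) = 0"
  shows "AE x in lborel. u x = 0"
proof (rule density_unique_real[OF u integrable_zero])
  let ?G = "range (\<lambda>(a, b). box a b :: (real^'n) set)"
  have [measurable]: "u \<in> borel_measurable borel" using u by auto
  have int: "integrable lborel (\<lambda>x. indicator A x * u x)" if "A \<in> sets borel" for A
    using integrable_mult_indicator[OF _ u, of A] that by simp
  fix A :: "(real^'n) set" assume "A \<in> sets lborel"
  have stable: "Int_stable ?G" by (auto simp: Int_stable_def box_Int_box)
  have sets: "sets borel = sigma_sets UNIV ?G" unfolding borel_eq_box by (simp add: sets_measure_of)
  have G: "?G \<subseteq> Pow UNIV" by simp
  have A: "A \<in> sigma_sets UNIV ?G" using \<open>A \<in> sets lborel\<close> sets by auto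
  have "(LINT x|lborel. indicator A x * u x) = 0"
    using stable G A
  proof (induction rule: sigma_sets_induct_disjoint)
    case (basic A)
    then show ?case using box by auto
  next
    case empty
    then show ?case by simp
  next
    case (compl A)
    \<comment> \<open>Complements require the integral over the whole space, which is reached by
      exhausting it with centred cubes.\<close>
    have "(\<lambda>m. LINT x|lborel. indicator (box (\<chi> i. - real m) (\<chi> i. real m)) x * u x) \<longlonglongrightarrow> (LINT x|lborel. u x)"
    proof (rule integral_dominated_convergence[OF _ _ integrable_abs[OF u]])
      show "AE x in lborel. (\<lambda>m. indicator (box (\<chi> i. - real m) (\<chi> i. real m)) x * u x) \<longlonglongrightarrow> u x"
      proof (rule AE_I2)
        fix x :: "real^'n"
        obtain N :: nat where N: "norm x < N" using reals_Archimedean2 by blast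
        have "x \<in> box (\<chi> i. - real m) (\<chi> i. real m)" if "m \<ge> N" for m
        proof -
          have "\<bar>x $ i\<bar> < m" for i using component_le_norm_cart[of x i] N that by linarith
          then show ?thesis by (simp add: mem_box_cart abs_less_iff minus_less_iff)
        qed
        then show "(\<lambda>m. indicator (box (\<chi> i. - real m) (\<chi> i. real m)) x * u x) \<longlonglongrightarrow> u x"
          by (intro tendsto_eventually) (auto simp: eventually_sequentially intro!: exI[of _ N])
      qed
    qed (auto simp: indicator_def)
    then have total: "(LINT x|lborel. u x) = 0" unfolding box by (rule LIMSEQ_const_iff[THEN iffD1, symmetric])
    have A: "A \<in> sets borel" using compl sets by simp
    have "(\<lambda>x. indicator (UNIV - A) x * u x) = (\<lambda>x. u x - indicator A x * u x)"
      by (auto simp: indicator_def)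
    then show ?case using compl total int[OF A] u by simp
  next
    case (union F)
    have F: "F i \<in> sets borel" for i using union sets by auto
    have dis: "(\<lambda>i. indicator (F i) x * u x) sums (indicator (\<Union>i. F i) x * u x)" for x
      using sums_mult2[OF indicator_sums[of F x], of "u x"] union.hyps(1)
      by (simp add: disjoint_family_on_def)
    have "(\<lambda>N. LINT x|lborel. (\<Sum>i<N. indicator (F i) x * u x)) \<longlonglongrightarrow> (LINT x|lborel. indicator (\<Union>i. F i) x * u x)"
    proof (rule integral_dominated_convergence[OF _ _ integrable_abs[OF u]])
      show "AE x in lborel. (\<lambda>N. \<Sum>i<N. indicator (F i) x * u x) \<longlonglongrightarrow> indicator (\<Union>i. F i) x * u x"
        using dis by (auto simp: sums_def)
      show "AE x in lborel. norm (\<Sum>i<N. indicator (F i) x * u x) \<le> \<bar>u x\<bar>" for N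
      proof (rule AE_I2)
        fix x
        have "(\<Sum>i<N. indicator (F i) x) = (indicator (\<Union>i<N. F i) x :: real)"
          using union.hyps(1) by (intro indicator_UN_disjoint[symmetric]) (auto simp: disjoint_family_on_def)
        then have eq: "(\<Sum>i<N. indicator (F i) x * u x) = indicator (\<Union>i<N. F i) x * u x"
          unfolding sum_distrib_right[symmetric] by (rule arg_cong)
        show "norm (\<Sum>i<N. indicator (F i) x * u x) \<le> \<bar>u x\<bar>" unfolding eq by (simp add: indicator_def)
      qed
    qed (use F in auto)
    moreover have "(LINT x|lborel. (\<Sum>i<N. indicator (F i) x * u x)) = 0" for N
      by (subst Bochner_Integration.integral_sum) (auto intro: int F simp: union.IH)
    ultimately show ?case by (simp add: LIMSEQ_const_iff)
  qed
  then show "(LINT x:A|lborel. u x) = (LINT x:A|lborel. 0)"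
    by (simp add: set_lebesgue_integral_def)
qed

lemma L2_integrable_bounded:
  assumes u: "u \<in> L2 \<Omega>" and \<Omega>: "open \<Omega>" and S: "S \<in> sets borel" "S \<subseteq> \<Omega>" "bounded S"
  shows "integrable (lebesgue_on \<Omega>) (\<lambda>x. indicator S x * u x)"
proof (rule L2_integrable_mult[OF L2I u])
  have "integrable lborel (indicator S :: _ \<Rightarrow> real)"
    using S emeasure_bounded_finite[OF S(3)] by (intro integrable_real_indicator) auto
  then have "integrable (lebesgue_on \<Omega>) (indicator S :: _ \<Rightarrow> real)"
    using S by (subst lebesgue_on_supported[OF \<Omega>]) (auto simp: indicator_def)
  moreover have "(\<lambda>x. (indicator S x :: real)\<^sup>2) = indicator S" by (auto simp: indicator_def)
  ultimately show "integrable (lebesgue_on \<Omega>) (\<lambda>x. (indicator S x :: real)\<^sup>2)" by simp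
  show "(indicator S :: _ \<Rightarrow> real) \<in> borel_measurable (lebesgue_on \<Omega>)"
    using S by (intro measurable_restrict_space1 measurable_completion) simp
qed

text \<open>The fundamental lemma of the calculus of variations: \<open>box_bump\<close>
  approximates the indicator of every box inside \<Omega>, and countably many such boxes cover
  \<Omega>.\<close>

lemma test_functions_total:
  fixes u :: "real^'n::finite \<Rightarrow> real"
  assumes \<Omega>: "open \<Omega>" and u: "u \<in> L2 \<Omega>"
    and orth: "\<And>\<psi>. \<psi> \<in> test_functions \<Omega> \<Longrightarrow> L2_inner \<Omega> u \<psi> = 0"
  shows "AE x in lebesgue_on \<Omega>. u x = 0"
proof -
  have S: "\<Omega> \<inter> space lebesgue \<in> sets lebesgue" using \<Omega> by simp
  have [measurable]: "u \<in> borel_measurable (lebesgue_on \<Omega>)" using u by measurable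
  have box0: "(LINT x|lebesgue_on \<Omega>. indicator (box a b) x * u x) = 0" if ab: "box a b \<subseteq> \<Omega>" for a b
  proof (rule LIMSEQ_unique)
    have [measurable]: "(\<lambda>x. f x) \<in> borel_measurable (lebesgue_on \<Omega>)" if "f \<in> borel_measurable borel" for f :: "real^'n \<Rightarrow> real"
      using that by (intro measurable_restrict_space1 measurable_completion) simp
    show "(\<lambda>m. LINT x|lebesgue_on \<Omega>. box_bump a b (Suc m) x * u x) \<longlonglongrightarrow> (LINT x|lebesgue_on \<Omega>. indicator (box a b) x * u x)"
    proof (rule integral_dominated_convergence)
      show "integrable (lebesgue_on \<Omega>) (\<lambda>x. \<bar>indicator (box a b) x * u x\<bar>)"
        using L2_integrable_bounded[OF u \<Omega> _ ab] by (intro integrable_abs) auto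
      show "AE x in lebesgue_on \<Omega>. (\<lambda>m. box_bump a b (Suc m) x * u x) \<longlonglongrightarrow> indicator (box a b) x * u x"
        by (intro AE_I2 tendsto_mult tendsto_const LIMSEQ_Suc[OF box_bump_tendsto])
      show "AE x in lebesgue_on \<Omega>. norm (box_bump a b (Suc m) x * u x) \<le> \<bar>indicator (box a b) x * u x\<bar>" for m
      proof (rule AE_I2)
        fix x
        have "\<bar>box_bump a b (Suc m) x\<bar> \<le> indicator (box a b) x"
          using box_bump_bounds[of a b "Suc m" x] box_bump_eq_0[of x a b "Suc m"] by (auto simp: indicator_def)
        then show "norm (box_bump a b (Suc m) x * u x) \<le> \<bar>indicator (box a b) x * u x\<bar>"
          by (simp add: abs_mult mult_right_mono)
      qed
    qed measurable
    have "(LINT x|lebesgue_on \<Omega>. box_bump a b (Suc m) x * u x) = 0" for m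
      using orth[OF test_mono[OF box_bump_test ab], of "Suc m"] by (simp add: L2_inner_def mult.commute)
    then show "(\<lambda>m. LINT x|lebesgue_on \<Omega>. box_bump a b (Suc m) x * u x) \<longlonglongrightarrow> 0" by simp
  qed
  have ae_box: "AE x in lebesgue. x \<in> box a b \<longrightarrow> u x = 0" if ab: "box a b \<subseteq> \<Omega>" for a b
  proof -
    have eq: "(\<lambda>x. indicator \<Omega> x *\<^sub>R (indicator (box a b) x * u x)) = (\<lambda>x. indicator (box a b) x * u x)"
      by (rule ext) (use ab in \<open>auto simp: indicator_def\<close>)
    have int: "integrable lebesgue (\<lambda>x. indicator (box a b) x * u x)"
      using L2_integrable_bounded[OF u \<Omega> _ ab] unfolding integrable_restrict_space[OF S] eq by simp
    then have "(\<lambda>x. indicator (box a b) x * u x) \<in> borel_measurable (completion lborel)" by auto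
    \<comment> \<open>The cut off function is only Lebesgue measurable; a Borel version
      \<open>v\<close> is needed for the box criterion, which lives on
      \<open>lborel\<close>.\<close>
    from completion_ex_borel_measurable_real[OF this]
    obtain v where v [measurable]: "v \<in> borel_measurable lborel"
      and uv: "AE x in lborel. indicator (box a b) x * u x = v x" by auto
    have uv': "AE x in lebesgue. indicator (box a b) x * u x = v x" using AE_completion[OF uv] .
    have vl: "v \<in> borel_measurable lebesgue" using measurable_completion[OF v] .
    have "(\<lambda>x. indicator (box a b) x * u x) \<in> borel_measurable lebesgue" using int by (rule borel_measurable_integrable)
    then have "integrable lebesgue v"
      using int integrable_cong_AE[OF _ vl uv'] by blast
    then have vint: "integrable lborel v" using integrable_completion[OF v] by blast
    have "AE x in lborel. v x = 0"
    proof (rule AE_zero_of_box_integrals[OF vint])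
      fix c d
      \<comment> \<open>An arbitrary box meets the fixed one in a box that again lies in \<Omega>,
        where the integral is known to vanish.\<close>
      obtain e f where ef: "box c d \<inter> box a b = box e f" unfolding box_Int_box by blast
      have "(LINT x|lborel. indicator (box c d) x * v x) = (LINT x|lebesgue. indicator (box c d) x * v x)"
        by (rule integral_completion[symmetric]) simp
      also have "\<dots> = (LINT x|lebesgue. indicator (box c d) x * (indicator (box a b) x * u x))"
      proof (rule integral_cong_AE)
        have b: "indicator (box c d) \<in> borel_measurable lebesgue" by (intro borel_measurable_indicator) simp
        show "(\<lambda>x. indicator (box c d) x * v x) \<in> borel_measurable lebesgue"
          "(\<lambda>x. indicator (box c d) x * (indicator (box a b) x * u x)) \<in> borel_measurable lebesgue"
          by (rule borel_measurable_times[OF b vl],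
              rule borel_measurable_times[OF b borel_measurable_integrable[OF int]])
        show "AE x in lebesgue. indicator (box c d) x * v x = indicator (box c d) x * (indicator (box a b) x * u x)"
          using uv' by eventually_elim simp
      qed
      also have "\<dots> = (LINT x|lebesgue. indicator \<Omega> x *\<^sub>R (indicator (box e f) x * u x))"
        unfolding ef[symmetric] using ab by (intro Bochner_Integration.integral_cong) (auto simp: indicator_def)
      also have "\<dots> = 0"
        unfolding integral_restrict_space[OF S, symmetric] using ef ab by (intro box0) auto
      finally show "(LINT x|lborel. indicator (box c d) x * v x) = 0" .
    qed
    then have "AE x in lebesgue. v x = 0" by (rule AE_completion)
    with uv' show ?thesis by eventually_elim auto
  qed
  obtain \<D> :: "(real^'n) set set" where \<D>: "countable \<D>" "\<And>X. X \<in> \<D> \<Longrightarrow> \<exists>a b. X = box a b" "\<Union>\<D> = \<Omega>"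
    using open_countable_Union_open_box[OF \<Omega>] by metis
  have "AE x in lebesgue. \<forall>X\<in>\<D>. x \<in> X \<longrightarrow> u x = 0"
    unfolding AE_ball_countable[OF \<D>(1)] using \<D> ae_box by (metis Union_upper)
  then have "AE x in lebesgue. x \<in> \<Omega> \<longrightarrow> u x = 0" using \<D>(3) by (auto elim!: eventually_mono)
  then show ?thesis unfolding AE_restrict_space_iff[OF S] .
qed

section \<open>Weak gradients\<close>

lemma L2_norm_cong_AE:
  assumes "u \<in> L2 \<Omega>" "u' \<in> L2 \<Omega>" "AE x in lebesgue_on \<Omega>. u x = u' x"
  shows "L2_norm \<Omega> u = L2_norm \<Omega> u'"
  unfolding L2_norm_def using assms L2_inner_cong by metis

lemma L2_norm_cong: "(\<And>x. x \<in> \<Omega> \<Longrightarrow> u x = v x) \<Longrightarrow> L2_norm \<Omega> u = L2_norm \<Omega> v"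
  unfolding L2_norm_def L2_inner_def
  by (intro arg_cong[of _ _ sqrt] Bochner_Integration.integral_cong) (auto simp: space_restrict_space)

lemma L2_bounded_mult:
  assumes f: "f \<in> borel_measurable (lebesgue_on \<Omega>)" "\<And>x. x \<in> \<Omega> \<Longrightarrow> \<bar>f x\<bar> \<le> C" and C: "0 \<le> C" and u: "u \<in> L2 \<Omega>"
  shows "(\<lambda>x. f x * u x) \<in> L2 \<Omega>" and "L2_norm \<Omega> (\<lambda>x. f x * u x) \<le> C * L2_norm \<Omega> u"
proof -
  have sq: "(f x * u x)\<^sup>2 \<le> C\<^sup>2 * (u x)\<^sup>2" if "x \<in> \<Omega>" for x
    using power_mono[OF f(2)[OF that], of 2] by (simp add: power_mult_distrib mult_right_mono)
  have meas: "(\<lambda>x. f x * u x) \<in> borel_measurable (lebesgue_on \<Omega>)"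
    using f(1) u by measurable
  have meas2: "(\<lambda>x. (f x * u x)\<^sup>2) \<in> borel_measurable (lebesgue_on \<Omega>)"
    using meas by (rule borel_measurable_power)
  have int: "integrable (lebesgue_on \<Omega>) (\<lambda>x. C\<^sup>2 * (u x)\<^sup>2)"
    using L2_integrable_square[OF u] by (rule integrable_mult_right)
  have int2: "integrable (lebesgue_on \<Omega>) (\<lambda>x. (f x * u x)\<^sup>2)"
  proof (rule Bochner_Integration.integrable_bound[OF int meas2 AE_I2])
    fix x assume "x \<in> space (lebesgue_on \<Omega>)"
    then have "x \<in> \<Omega>" by (simp add: space_restrict_space)
    from sq[OF this] show "norm ((f x * u x)\<^sup>2) \<le> norm (C\<^sup>2 * (u x)\<^sup>2)" by simp
  qed
  show L2: "(\<lambda>x. f x * u x) \<in> L2 \<Omega>" using meas int2 by (rule L2I)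
  have "(LINT x|lebesgue_on \<Omega>. (f x * u x)\<^sup>2) \<le> (LINT x|lebesgue_on \<Omega>. C\<^sup>2 * (u x)\<^sup>2)"
    using int int2 sq by (intro integral_mono) (auto simp: space_restrict_space)
  then have "(L2_norm \<Omega> (\<lambda>x. f x * u x))\<^sup>2 \<le> C\<^sup>2 * (L2_norm \<Omega> u)\<^sup>2"
    unfolding L2_norm_square L2_inner_def power2_eq_square[symmetric] by simp
  then have "(L2_norm \<Omega> (\<lambda>x. f x * u x))\<^sup>2 \<le> (C * L2_norm \<Omega> u)\<^sup>2"
    by (simp add: power_mult_distrib)
  then show "L2_norm \<Omega> (\<lambda>x. f x * u x) \<le> C * L2_norm \<Omega> u"
    using C by (auto intro: power2_le_imp_le)
qed

lemma is_weak_grad_L2: "is_weak_grad \<Omega> u G \<Longrightarrow> (\<lambda>x. G x $ i) \<in> L2 \<Omega>"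
  by (simp add: is_weak_grad_def)

text \<open>Componentwise, the difference is orthogonal to all test functions.\<close>

lemma weak_grad_unique:
  assumes \<Omega>: "open \<Omega>" and G: "is_weak_grad \<Omega> u G" and G': "is_weak_grad \<Omega> u G'"
  shows "AE x in lebesgue_on \<Omega>. G x = G' x"
proof -
  have "AE x in lebesgue_on \<Omega>. G x $ i - G' x $ i = 0" for i
  proof (rule test_functions_total[OF \<Omega> L2_diff])
    fix \<psi> assume \<psi>: "\<psi> \<in> test_functions \<Omega>"
    then show "L2_inner \<Omega> (\<lambda>x. G x $ i - G' x $ i) \<psi> = 0"
      using G G' test_L2[OF \<psi> \<Omega>] by (simp add: L2_inner_diff_left is_weak_grad_def)
  qed (use G G' in \<open>auto simp: is_weak_grad_def\<close>)
  then have "AE x in lebesgue_on \<Omega>. \<forall>i\<in>UNIV. G x $ i - G' x $ i = 0"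
    by (intro AE_finite_allI) auto
  then show ?thesis by eventually_elim (simp add: vec_eq_iff)
qed

lemma is_weak_grad_weak_grad: "is_weak_grad \<Omega> u G \<Longrightarrow> is_weak_grad \<Omega> u (weak_grad \<Omega> u)"
  unfolding weak_grad_def by (rule someI[of "is_weak_grad \<Omega> u"])

lemma weak_grad_AE:
  "open \<Omega> \<Longrightarrow> is_weak_grad \<Omega> u G \<Longrightarrow> AE x in lebesgue_on \<Omega>. weak_grad \<Omega> u x = G x"
  using weak_grad_unique is_weak_grad_weak_grad by blast

lemma is_weak_grad_lincomb:
  assumes \<Omega>: "open \<Omega>" and "u \<in> L2 \<Omega>" "v \<in> L2 \<Omega>" "is_weak_grad \<Omega> u G" "is_weak_grad \<Omega> v H"
  shows "is_weak_grad \<Omega> (\<lambda>x. b * u x + c * v x) (\<lambda>x. b *\<^sub>R G x + c *\<^sub>R H x)"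
  unfolding is_weak_grad_def
proof (intro allI conjI ballI)
  fix i
  have GH: "(\<lambda>x. G x $ i) \<in> L2 \<Omega>" "(\<lambda>x. H x $ i) \<in> L2 \<Omega>"
    using assms by (auto simp: is_weak_grad_def)
  then show "(\<lambda>x. (b *\<^sub>R G x + c *\<^sub>R H x) $ i) \<in> L2 \<Omega>"
    by (simp add: L2_lincomb)
  fix \<phi> assume \<phi>: "\<phi> \<in> test_functions \<Omega>"
  show "L2_inner \<Omega> (\<lambda>x. b * u x + c * v x) (pderiv_at i \<phi>) = - L2_inner \<Omega> (\<lambda>x. (b *\<^sub>R G x + c *\<^sub>R H x) $ i) \<phi>"
    using assms \<phi> test_L2[OF test_pderiv[OF \<phi>] \<Omega>] test_L2[OF \<phi> \<Omega>] GH
    by (simp add: L2_inner_lincomb_left is_weak_grad_def algebra_simps)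
qed

lemma is_weak_grad_test:
  "open \<Omega> \<Longrightarrow> \<phi> \<in> test_functions \<Omega> \<Longrightarrow> is_weak_grad \<Omega> \<phi> (grad \<phi>)"
  unfolding is_weak_grad_def by (simp add: grad_def test_L2 test_pderiv integration_by_parts_test)

text \<open>The functions of \<open>H10 \<Omega>\<close> are handled through sequences of test functions that converge to
  them together with their gradients.\<close>

definition H10_seq ::
  "(real^'n::finite) set \<Rightarrow> (real^'n \<Rightarrow> real) \<Rightarrow> (real^'n \<Rightarrow> real^'n) \<Rightarrow> (nat \<Rightarrow> real^'n \<Rightarrow> real) \<Rightarrow> bool" where
  "H10_seq \<Omega> u G \<phi> \<longleftrightarrow> u \<in> L2 \<Omega> \<and> (\<forall>i. (\<lambda>x. G x $ i) \<in> L2 \<Omega>) \<and> (\<forall>n. \<phi> n \<in> test_functions \<Omega>) \<and>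
     (\<lambda>n. L2_norm \<Omega> (\<lambda>x. u x - \<phi> n x)) \<longlonglongrightarrow> 0 \<and>
     (\<forall>i. (\<lambda>n. L2_norm \<Omega> (\<lambda>x. G x $ i - grad (\<phi> n) x $ i)) \<longlonglongrightarrow> 0)"

text \<open>Integration by parts holds for the approximating test functions, and both sides pass to
  the limit in \<open>L2\<close>.\<close>

lemma H10_seq_weak_grad:
  assumes \<Omega>: "open \<Omega>" and seq: "H10_seq \<Omega> u G \<phi>"
  shows "is_weak_grad \<Omega> u G"
  unfolding is_weak_grad_def
proof (intro allI conjI ballI)
  have u: "u \<in> L2 \<Omega>" and G: "\<And>i. (\<lambda>x. G x $ i) \<in> L2 \<Omega>" and \<phi>: "\<And>n. \<phi> n \<in> test_functions \<Omega>"
    and lim: "(\<lambda>n. L2_norm \<Omega> (\<lambda>x. u x - \<phi> n x)) \<longlonglongrightarrow> 0"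
    and limG: "\<And>i. (\<lambda>n. L2_norm \<Omega> (\<lambda>x. G x $ i - grad (\<phi> n) x $ i)) \<longlonglongrightarrow> 0"
    using seq by (auto simp: H10_seq_def)
  fix i show "(\<lambda>x. G x $ i) \<in> L2 \<Omega>" by (rule G)
  fix \<psi> assume \<psi>: "\<psi> \<in> test_functions \<Omega>"
  have gi: "(\<lambda>x. grad (\<phi> n) x $ i) = pderiv_at i (\<phi> n)" for n by (simp add: grad_def)
  have "(\<lambda>n. L2_inner \<Omega> (\<phi> n) (pderiv_at i \<psi>)) \<longlonglongrightarrow> L2_inner \<Omega> u (pderiv_at i \<psi>)"
    by (rule L2_tendsto_inner[OF test_L2[OF \<phi> \<Omega>] u test_L2[OF test_pderiv[OF \<psi>] \<Omega>] lim])
  moreover have "(\<lambda>n. L2_inner \<Omega> (pderiv_at i (\<phi> n)) \<psi>) \<longlonglongrightarrow> L2_inner \<Omega> (\<lambda>x. G x $ i) \<psi>"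
    using limG[of i] by (intro L2_tendsto_inner test_L2 test_pderiv \<phi> \<psi> \<Omega> G) (simp add: grad_def)
  then have "(\<lambda>n. L2_inner \<Omega> (\<phi> n) (pderiv_at i \<psi>)) \<longlonglongrightarrow> - L2_inner \<Omega> (\<lambda>x. G x $ i) \<psi>"
    unfolding integration_by_parts_test[OF \<Omega> \<phi> \<psi>] by (rule tendsto_minus)
  ultimately show "L2_inner \<Omega> u (pderiv_at i \<psi>) = - L2_inner \<Omega> (\<lambda>x. G x $ i) \<psi>"
    by (rule LIMSEQ_unique)
qed

text \<open>\<open>H1_norm\<close> refers to the chosen \<open>weak_grad\<close>; this permits any
  weak gradient in its computation.\<close>

lemma H1_norm_eq:
  assumes \<Omega>: "open \<Omega>" and u: "u \<in> L2 \<Omega>" and G: "is_weak_grad \<Omega> u G"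
  shows "H1_norm \<Omega> u = sqrt ((L2_norm \<Omega> u)\<^sup>2 + (\<Sum>i\<in>UNIV. (L2_norm \<Omega> (\<lambda>x. G x $ i))\<^sup>2))"
proof -
  let ?W = "weak_grad \<Omega> u"
  have W: "(\<lambda>x. ?W x $ i) \<in> L2 \<Omega>" for i by (rule is_weak_grad_L2[OF is_weak_grad_weak_grad[OF G]])
  have "(norm (?W x))\<^sup>2 = (\<Sum>i\<in>UNIV. (?W x $ i)\<^sup>2)" for x
    by (simp add: norm_vec_def L2_set_def sum_nonneg)
  then have "(LINT x|lebesgue_on \<Omega>. (norm (?W x))\<^sup>2) = (\<Sum>i\<in>UNIV. LINT x|lebesgue_on \<Omega>. (?W x $ i)\<^sup>2)"
    using L2_integrable_square[OF W] by simp
  also have "\<dots> = (\<Sum>i\<in>UNIV. (L2_norm \<Omega> (\<lambda>x. ?W x $ i))\<^sup>2)"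
    unfolding L2_norm_square L2_inner_def unfolding power2_eq_square ..
  also have "\<dots> = (\<Sum>i\<in>UNIV. (L2_norm \<Omega> (\<lambda>x. G x $ i))\<^sup>2)"
  proof (intro sum.cong refl arg_cong[of _ _ "\<lambda>t. t\<^sup>2"] L2_norm_cong_AE W is_weak_grad_L2[OF G])
    fix i show "AE x in lebesgue_on \<Omega>. ?W x $ i = G x $ i"
      using weak_grad_AE[OF \<Omega> G] by eventually_elim simp
  qed
  finally show ?thesis unfolding H1_norm_def L2_norm_square[of \<Omega> u] L2_inner_def power2_eq_square[symmetric] by simp
qed

lemma H10_L2: "u \<in> H10 \<Omega> \<Longrightarrow> u \<in> L2 \<Omega>"
  by (simp add: H10_def H1_def)

lemma H10_is_weak_grad: "u \<in> H10 \<Omega> \<Longrightarrow> is_weak_grad \<Omega> u (weak_grad \<Omega> u)"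
  unfolding H10_def H1_def using is_weak_grad_weak_grad by blast

lemma weak_grad_L2: "u \<in> H10 \<Omega> \<Longrightarrow> (\<lambda>x. weak_grad \<Omega> u x $ i) \<in> L2 \<Omega>"
  by (rule is_weak_grad_L2[OF H10_is_weak_grad])

lemma H1_norm_diff_test:
  assumes \<Omega>: "open \<Omega>" and u: "u \<in> L2 \<Omega>" and G: "is_weak_grad \<Omega> u G" and \<phi>: "\<phi> \<in> test_functions \<Omega>"
  shows "H1_norm \<Omega> (\<lambda>x. u x - \<phi> x) =
    sqrt ((L2_norm \<Omega> (\<lambda>x. u x - \<phi> x))\<^sup>2 + (\<Sum>i\<in>UNIV. (L2_norm \<Omega> (\<lambda>x. G x $ i - grad \<phi> x $ i))\<^sup>2))"
  using H1_norm_eq[OF \<Omega> L2_diff[OF u test_L2[OF \<phi> \<Omega>]], of "\<lambda>x. G x - grad \<phi> x"]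
    is_weak_grad_lincomb[OF \<Omega> u test_L2[OF \<phi> \<Omega>] G is_weak_grad_test[OF \<Omega> \<phi>], of 1 "-1"]
  by simp

lemma H10_seqI:
  assumes \<Omega>: "open \<Omega>" and u: "u \<in> H10 \<Omega>"
  shows "\<exists>\<phi>. H10_seq \<Omega> u (weak_grad \<Omega> u) \<phi>"
proof -
  let ?G = "weak_grad \<Omega> u"
  have L: "u \<in> L2 \<Omega>" and G: "is_weak_grad \<Omega> u ?G" using u H10_L2 H10_is_weak_grad by auto
  have "\<exists>\<phi>\<in>test_functions \<Omega>. H1_norm \<Omega> (\<lambda>x. u x - \<phi> x) < (1/2)^n" for n
    using u unfolding H10_def by auto
  then obtain \<phi> where \<phi>: "\<And>n. \<phi> n \<in> test_functions \<Omega>" and less: "\<And>n. H1_norm \<Omega> (\<lambda>x. u x - \<phi> n x) < (1/2)^n"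
    by metis
  have pow: "(\<lambda>n. (1/2::real)^n) \<longlonglongrightarrow> 0" by (rule LIMSEQ_power_zero) simp
  note eq = H1_norm_diff_test[OF \<Omega> L G \<phi>]
  have "L2_norm \<Omega> (\<lambda>x. u x - \<phi> n x) \<le> H1_norm \<Omega> (\<lambda>x. u x - \<phi> n x)" for n
    unfolding eq by (intro real_le_rsqrt) (simp add: sum_nonneg)
  then have b1: "L2_norm \<Omega> (\<lambda>x. u x - \<phi> n x) \<le> (1/2)^n" for n
    using less[of n] by (meson less_imp_le order_trans)
  have "L2_norm \<Omega> (\<lambda>x. ?G x $ i - grad (\<phi> n) x $ i) \<le> H1_norm \<Omega> (\<lambda>x. u x - \<phi> n x)" for n i
    unfolding eq
  proof (intro real_le_rsqrt)
    have "(L2_norm \<Omega> (\<lambda>x. ?G x $ i - grad (\<phi> n) x $ i))\<^sup>2 \<le>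
        (\<Sum>i\<in>UNIV. (L2_norm \<Omega> (\<lambda>x. ?G x $ i - grad (\<phi> n) x $ i))\<^sup>2)"
      by (rule member_le_sum) auto
    then show "(L2_norm \<Omega> (\<lambda>x. ?G x $ i - grad (\<phi> n) x $ i))\<^sup>2 \<le> (L2_norm \<Omega> (\<lambda>x. u x - \<phi> n x))\<^sup>2 +
        (\<Sum>i\<in>UNIV. (L2_norm \<Omega> (\<lambda>x. ?G x $ i - grad (\<phi> n) x $ i))\<^sup>2)"
      by (simp add: add_increasing)
  qed
  then have b2: "L2_norm \<Omega> (\<lambda>x. ?G x $ i - grad (\<phi> n) x $ i) \<le> (1/2)^n" for n i
    using less[of n] by (meson less_imp_le order_trans)
  have "H10_seq \<Omega> u ?G \<phi>"
    unfolding H10_seq_def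
    using L is_weak_grad_L2[OF G] \<phi> b1 b2
    by (intro conjI allI) (auto intro!: tendsto_sandwich[OF _ _ tendsto_const pow] always_eventually)
  then show ?thesis by blast
qed

lemma H10_seqD:
  assumes \<Omega>: "open \<Omega>" and seq: "H10_seq \<Omega> u G \<phi>"
  shows "u \<in> H10 \<Omega>"
proof -
  have G: "is_weak_grad \<Omega> u G" by (rule H10_seq_weak_grad[OF assms])
  have u: "u \<in> L2 \<Omega>" and \<phi>: "\<And>n. \<phi> n \<in> test_functions \<Omega>"
    and lim: "(\<lambda>n. L2_norm \<Omega> (\<lambda>x. u x - \<phi> n x)) \<longlonglongrightarrow> 0"
    and limG: "\<And>i. (\<lambda>n. L2_norm \<Omega> (\<lambda>x. G x $ i - grad (\<phi> n) x $ i)) \<longlonglongrightarrow> 0"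
    using seq by (auto simp: H10_seq_def)
  have "(\<lambda>n. H1_norm \<Omega> (\<lambda>x. u x - \<phi> n x)) \<longlonglongrightarrow> sqrt (0\<^sup>2 + (\<Sum>i\<in>(UNIV :: 'a set). 0\<^sup>2))"
    unfolding H1_norm_diff_test[OF \<Omega> u G \<phi>] by (intro tendsto_intros lim limG)
  then have "(\<lambda>n. H1_norm \<Omega> (\<lambda>x. u x - \<phi> n x)) \<longlonglongrightarrow> 0" by simp
  then have "\<exists>\<psi>\<in>test_functions \<Omega>. H1_norm \<Omega> (\<lambda>x. u x - \<psi> x) < \<delta>" if "\<delta> > 0" for \<delta>
    using order_tendstoD(2)[OF _ that] \<phi> eventually_happens'[OF sequentially_bot] by fastforce
  then show ?thesis using u G by (auto simp: H10_def H1_def)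
qed

lemma H10_lincomb:
  assumes \<Omega>: "open \<Omega>" and u: "u \<in> H10 \<Omega>" and v: "v \<in> H10 \<Omega>"
  shows "(\<lambda>x. b * u x + c * v x) \<in> H10 \<Omega>"
    and "AE x in lebesgue_on \<Omega>. weak_grad \<Omega> (\<lambda>x. b * u x + c * v x) x = b *\<^sub>R weak_grad \<Omega> u x + c *\<^sub>R weak_grad \<Omega> v x"
proof -
  obtain \<phi> \<psi> where \<phi>: "H10_seq \<Omega> u (weak_grad \<Omega> u) \<phi>" and \<psi>: "H10_seq \<Omega> v (weak_grad \<Omega> v) \<psi>"
    using H10_seqI[OF \<Omega> u] H10_seqI[OF \<Omega> v] by auto
  have t: "\<phi> n \<in> test_functions \<Omega>" "\<psi> n \<in> test_functions \<Omega>" for n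
    using \<phi> \<psi> by (auto simp: H10_seq_def)
  have lim: "(\<lambda>n. L2_norm \<Omega> (\<lambda>x. (b * f x + c * g x) - (b * F n x + c * H n x))) \<longlonglongrightarrow> 0"
    if "(\<lambda>n. L2_norm \<Omega> (\<lambda>x. f x - F n x)) \<longlonglongrightarrow> 0" "(\<lambda>n. L2_norm \<Omega> (\<lambda>x. g x - H n x)) \<longlonglongrightarrow> 0"
      "f \<in> L2 \<Omega>" "g \<in> L2 \<Omega>" "\<And>n. F n \<in> L2 \<Omega>" "\<And>n. H n \<in> L2 \<Omega>" for f g F H
  proof (rule tendsto_sandwich[OF _ _ tendsto_const])
    show "(\<lambda>n. \<bar>b\<bar> * L2_norm \<Omega> (\<lambda>x. f x - F n x) + \<bar>c\<bar> * L2_norm \<Omega> (\<lambda>x. g x - H n x)) \<longlonglongrightarrow> 0"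
      using tendsto_add[OF tendsto_mult_right_zero[OF that(1), of "\<bar>b\<bar>"] tendsto_mult_right_zero[OF that(2), of "\<bar>c\<bar>"]] by simp
    have "(\<lambda>x. (b * f x + c * g x) - (b * F n x + c * H n x)) = (\<lambda>x. b * (f x - F n x) + c * (g x - H n x))" for n
      by (simp add: algebra_simps)
    then have "L2_norm \<Omega> (\<lambda>x. (b * f x + c * g x) - (b * F n x + c * H n x)) \<le>
        \<bar>b\<bar> * L2_norm \<Omega> (\<lambda>x. f x - F n x) + \<bar>c\<bar> * L2_norm \<Omega> (\<lambda>x. g x - H n x)" for n
      using L2_norm_triangle[OF L2_scale[OF L2_diff[OF that(3,5)]] L2_scale[OF L2_diff[OF that(4,6)]]]
      by (simp add: L2_norm_scale)
    then show "\<forall>\<^sub>F n in sequentially. L2_norm \<Omega> (\<lambda>x. (b * f x + c * g x) - (b * F n x + c * H n x)) \<le>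
        \<bar>b\<bar> * L2_norm \<Omega> (\<lambda>x. f x - F n x) + \<bar>c\<bar> * L2_norm \<Omega> (\<lambda>x. g x - H n x)" by simp
  qed simp
  have seq: "H10_seq \<Omega> (\<lambda>x. b * u x + c * v x) (\<lambda>x. b *\<^sub>R weak_grad \<Omega> u x + c *\<^sub>R weak_grad \<Omega> v x) (\<lambda>n x. b * \<phi> n x + c * \<psi> n x)"
    unfolding H10_seq_def
  proof (intro conjI allI)
    show "(\<lambda>x. b * u x + c * v x) \<in> L2 \<Omega>" by (intro L2_lincomb H10_L2 u v)
    show "(\<lambda>x. (b *\<^sub>R weak_grad \<Omega> u x + c *\<^sub>R weak_grad \<Omega> v x) $ i) \<in> L2 \<Omega>" for i
      by (simp add: L2_lincomb weak_grad_L2 u v)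
    show "(\<lambda>x. b * \<phi> n x + c * \<psi> n x) \<in> test_functions \<Omega>" for n by (intro test_add t)
    show "(\<lambda>n. L2_norm \<Omega> (\<lambda>x. b * u x + c * v x - (b * \<phi> n x + c * \<psi> n x))) \<longlonglongrightarrow> 0"
      using \<phi> \<psi> by (intro lim H10_L2 u v test_L2 t \<Omega>) (auto simp: H10_seq_def)
    have "(\<lambda>n. L2_norm \<Omega> (\<lambda>x. b * weak_grad \<Omega> u x $ i + c * weak_grad \<Omega> v x $ i -
         (b * pderiv_at i (\<phi> n) x + c * pderiv_at i (\<psi> n) x))) \<longlonglongrightarrow> 0" for i
      using \<phi> \<psi> by (intro lim weak_grad_L2 u v test_L2 test_pderiv t \<Omega>) (auto simp: H10_seq_def grad_def)
    then show "(\<lambda>n. L2_norm \<Omega> (\<lambda>x. (b *\<^sub>R weak_grad \<Omega> u x + c *\<^sub>R weak_grad \<Omega> v x) $ i -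
         grad (\<lambda>x. b * \<phi> n x + c * \<psi> n x) x $ i)) \<longlonglongrightarrow> 0" for i
      by (simp add: grad_lincomb test_differentiable[OF t(1)] test_differentiable[OF t(2)]) (simp add: grad_def)
  qed
  show "(\<lambda>x. b * u x + c * v x) \<in> H10 \<Omega>" by (rule H10_seqD[OF \<Omega> seq])
  show "AE x in lebesgue_on \<Omega>. weak_grad \<Omega> (\<lambda>x. b * u x + c * v x) x = b *\<^sub>R weak_grad \<Omega> u x + c *\<^sub>R weak_grad \<Omega> v x"
    by (rule weak_grad_AE[OF \<Omega> H10_seq_weak_grad[OF \<Omega> seq]])
qed

section \<open>The energy form\<close>

definition energy ::
  "(real^'n::finite) set \<Rightarrow> (real^'n \<Rightarrow> real^'n^'n) \<Rightarrow> (real^'n \<Rightarrow> real) \<Rightarrow> (real^'n \<Rightarrow> real) \<Rightarrow> real" where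
  "energy \<Omega> a v u = (LINT x|lebesgue_on \<Omega>. weak_grad \<Omega> v x \<bullet> (a x *v weak_grad \<Omega> u x))"

text \<open>Stated by entries because it serves both for coefficient fields and for transposed
  Jacobians.\<close>

definition bounded_coeff :: "(real^'n::finite) set \<Rightarrow> (real^'n \<Rightarrow> real^'n^'n) \<Rightarrow> bool" where
  "bounded_coeff \<Omega> a \<longleftrightarrow> (\<forall>i j. (\<lambda>x. a x $ i $ j) \<in> borel_measurable (lebesgue_on \<Omega>)) \<and>
     (\<exists>C. \<forall>x\<in>\<Omega>. \<forall>i j. \<bar>a x $ i $ j\<bar> \<le> C)"

lemma bounded_coeffE:
  assumes "bounded_coeff \<Omega> a"
  obtains C where "0 \<le> C" "\<And>x i j. x \<in> \<Omega> \<Longrightarrow> \<bar>a x $ i $ j\<bar> \<le> C"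
    "\<And>i j. (\<lambda>x. a x $ i $ j) \<in> borel_measurable (lebesgue_on \<Omega>)"
proof -
  obtain C where "\<forall>x\<in>\<Omega>. \<forall>i j. \<bar>a x $ i $ j\<bar> \<le> C" using assms unfolding bounded_coeff_def by blast
  then have "\<And>x i j. x \<in> \<Omega> \<Longrightarrow> \<bar>a x $ i $ j\<bar> \<le> max C 0" by (simp add: le_max_iff_disj)
  then show ?thesis using that[of "max C 0"] assms by (auto simp: bounded_coeff_def)
qed

lemma bounded_coeff_mult_L2:
  assumes a: "bounded_coeff \<Omega> a" and G: "\<And>j. (\<lambda>x. G x $ j) \<in> L2 \<Omega>"
  shows "(\<lambda>x. (a x *v G x) $ i) \<in> L2 \<Omega>"
proof -
  obtain C where C: "0 \<le> C" "\<And>x i j. x \<in> \<Omega> \<Longrightarrow> \<bar>a x $ i $ j\<bar> \<le> C"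
    "\<And>i j. (\<lambda>x. a x $ i $ j) \<in> borel_measurable (lebesgue_on \<Omega>)" using bounded_coeffE[OF a] by metis
  show ?thesis unfolding matrix_vector_mult_def vec_lambda_beta
    by (intro L2_sum L2_bounded_mult(1)[OF C(3) C(2) C(1)] G)
qed

lemma energy_integrable:
  assumes "bounded_coeff \<Omega> a" "\<And>j. (\<lambda>x. G x $ j) \<in> L2 \<Omega>" "\<And>j. (\<lambda>x. H x $ j) \<in> L2 \<Omega>"
  shows "integrable (lebesgue_on \<Omega>) (\<lambda>x. H x \<bullet> (a x *v G x))"
  unfolding inner_vec_def inner_real_def
  by (intro Bochner_Integration.integrable_sum L2_integrable_mult bounded_coeff_mult_L2 assms)

lemma energy_eq:
  assumes \<Omega>: "open \<Omega>" and a: "bounded_coeff \<Omega> a" and "u \<in> H10 \<Omega>" "v \<in> H10 \<Omega>"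
    and G: "\<And>j. (\<lambda>x. G x $ j) \<in> L2 \<Omega>" "AE x in lebesgue_on \<Omega>. weak_grad \<Omega> u x = G x"
    and H: "\<And>j. (\<lambda>x. H x $ j) \<in> L2 \<Omega>" "AE x in lebesgue_on \<Omega>. weak_grad \<Omega> v x = H x"
  shows "energy \<Omega> a v u = (LINT x|lebesgue_on \<Omega>. H x \<bullet> (a x *v G x))"
  unfolding energy_def
proof (rule integral_cong_AE)
  show "(\<lambda>x. weak_grad \<Omega> v x \<bullet> (a x *v weak_grad \<Omega> u x)) \<in> borel_measurable (lebesgue_on \<Omega>)"
    by (intro borel_measurable_integrable energy_integrable a weak_grad_L2 assms)
  show "(\<lambda>x. H x \<bullet> (a x *v G x)) \<in> borel_measurable (lebesgue_on \<Omega>)"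
    by (intro borel_measurable_integrable energy_integrable a G H)
  show "AE x in lebesgue_on \<Omega>. weak_grad \<Omega> v x \<bullet> (a x *v weak_grad \<Omega> u x) = H x \<bullet> (a x *v G x)"
    using G(2) H(2) by eventually_elim simp
qed

lemma energy_lincomb_left:
  assumes \<Omega>: "open \<Omega>" and a: "bounded_coeff \<Omega> a" and u: "u \<in> H10 \<Omega>" and v: "v \<in> H10 \<Omega>" and w: "w \<in> H10 \<Omega>"
  shows "energy \<Omega> a (\<lambda>x. b * u x + c * v x) w = b * energy \<Omega> a u w + c * energy \<Omega> a v w"
proof -
  have "energy \<Omega> a (\<lambda>x. b * u x + c * v x) w =
      (LINT x|lebesgue_on \<Omega>. (b *\<^sub>R weak_grad \<Omega> u x + c *\<^sub>R weak_grad \<Omega> v x) \<bullet> (a x *v weak_grad \<Omega> w x))"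
    by (rule energy_eq[OF \<Omega> a w H10_lincomb(1)[OF \<Omega> u v] _ _ _ H10_lincomb(2)[OF \<Omega> u v]])
      (simp_all add: weak_grad_L2 u v w L2_lincomb)
  also have "\<dots> = b * energy \<Omega> a u w + c * energy \<Omega> a v w"
    using energy_integrable[OF a weak_grad_L2[OF w] weak_grad_L2[OF u]]
      energy_integrable[OF a weak_grad_L2[OF w] weak_grad_L2[OF v]]
    by (simp add: inner_add_left energy_def)
  finally show ?thesis .
qed

lemma energy_commute:
  assumes "\<And>x. x \<in> \<Omega> \<Longrightarrow> transpose (a x) = a x"
  shows "energy \<Omega> a v u = energy \<Omega> a u v"
  unfolding energy_def
proof (rule Bochner_Integration.integral_cong[OF refl])
  fix x assume "x \<in> space (lebesgue_on \<Omega>)"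
  then have "transpose (a x) = a x" using assms by (simp add: space_restrict_space)
  then show "weak_grad \<Omega> v x \<bullet> (a x *v weak_grad \<Omega> u x) = weak_grad \<Omega> u x \<bullet> (a x *v weak_grad \<Omega> v x)"
    by (metis dot_lmul_matrix inner_commute vector_transpose_matrix)
qed

section \<open>Transport by measure preserving maps\<close>

text \<open>The matrix \<open>T x\<close> is the transpose of the Jacobian of \<open>\<Phi>\<close> at \<open>x\<close>.\<close>

locale transport =
  fixes \<Omega> :: "(real^'n::finite) set" and \<Phi> :: "real^'n \<Rightarrow> real^'n" and T :: "real^'n \<Rightarrow> real^'n^'n"
  assumes open_domain: "open \<Omega>"
    and measurable_map: "\<Phi> \<in> lebesgue_on \<Omega> \<rightarrow>\<^sub>M lebesgue_on \<Omega>"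
    and measure_preserving: "distr (lebesgue_on \<Omega>) (lebesgue_on \<Omega>) \<Phi> = lebesgue_on \<Omega>"
    and test_comp: "\<phi> \<in> test_functions \<Omega> \<Longrightarrow> (\<lambda>x. \<phi> (\<Phi> x)) \<in> test_functions \<Omega>"
    and grad_comp: "\<phi> \<in> test_functions \<Omega> \<Longrightarrow> x \<in> \<Omega> \<Longrightarrow> grad (\<lambda>x. \<phi> (\<Phi> x)) x = T x *v grad \<phi> (\<Phi> x)"
    and bounded_T: "bounded_coeff \<Omega> T"
begin

lemma AE_comp: "AE x in lebesgue_on \<Omega>. P x \<Longrightarrow> AE x in lebesgue_on \<Omega>. P (\<Phi> x)"
  using AE_distrD[OF measurable_map] measure_preserving by metis

lemma integral_comp:
  fixes f :: "real^'n \<Rightarrow> real"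
  assumes "f \<in> borel_measurable (lebesgue_on \<Omega>)"
  shows "(LINT x|lebesgue_on \<Omega>. f (\<Phi> x)) = (LINT x|lebesgue_on \<Omega>. f x)"
  using integral_distr[OF measurable_map assms] measure_preserving by metis

lemma L2_comp: "u \<in> L2 \<Omega> \<Longrightarrow> (\<lambda>x. u (\<Phi> x)) \<in> L2 \<Omega>"
proof (rule L2I)
  assume u: "u \<in> L2 \<Omega>"
  show "(\<lambda>x. u (\<Phi> x)) \<in> borel_measurable (lebesgue_on \<Omega>)"
    using measurable_compose[OF measurable_map L2_measurable[OF u]] .
  show "integrable (lebesgue_on \<Omega>) (\<lambda>x. (u (\<Phi> x))\<^sup>2)"
    using integrable_distr[OF measurable_map, of "\<lambda>x. (u x)\<^sup>2"] L2_integrable_square[OF u] measure_preserving by metis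
qed

lemma L2_inner_comp:
  assumes "u \<in> L2 \<Omega>" "v \<in> L2 \<Omega>"
  shows "L2_inner \<Omega> (\<lambda>x. u (\<Phi> x)) (\<lambda>x. v (\<Phi> x)) = L2_inner \<Omega> u v"
  unfolding L2_inner_def
  by (rule integral_comp[OF borel_measurable_integrable[OF L2_integrable_mult[OF assms]]])

lemma L2_norm_comp: "u \<in> L2 \<Omega> \<Longrightarrow> L2_norm \<Omega> (\<lambda>x. u (\<Phi> x)) = L2_norm \<Omega> u"
  by (simp add: L2_norm_def L2_inner_comp)

text \<open>Composition preserves test functions and \<open>L2\<close> norms, and \<open>T\<close>
  is bounded. So the chain rule is used for smooth functions only and reaches \<open>H10\<close> by
  approximation.\<close>

lemma H10_seq_comp:
  assumes seq: "H10_seq \<Omega> u G \<phi>"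
  shows "H10_seq \<Omega> (\<lambda>x. u (\<Phi> x)) (\<lambda>x. T x *v G (\<Phi> x)) (\<lambda>n x. \<phi> n (\<Phi> x))"
  unfolding H10_seq_def
proof (intro conjI allI)
  note \<Omega> = open_domain
  have u: "u \<in> L2 \<Omega>" and G: "\<And>i. (\<lambda>x. G x $ i) \<in> L2 \<Omega>" and \<phi>: "\<And>n. \<phi> n \<in> test_functions \<Omega>"
    and lim: "(\<lambda>n. L2_norm \<Omega> (\<lambda>x. u x - \<phi> n x)) \<longlonglongrightarrow> 0"
    and limG: "\<And>i. (\<lambda>n. L2_norm \<Omega> (\<lambda>x. G x $ i - grad (\<phi> n) x $ i)) \<longlonglongrightarrow> 0"
    using seq by (auto simp: H10_seq_def)
  show "(\<lambda>x. u (\<Phi> x)) \<in> L2 \<Omega>" by (rule L2_comp[OF u])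
  show "(\<lambda>x. \<phi> n (\<Phi> x)) \<in> test_functions \<Omega>" for n by (rule test_comp[OF \<phi>])
  show "(\<lambda>n. L2_norm \<Omega> (\<lambda>x. u (\<Phi> x) - \<phi> n (\<Phi> x))) \<longlonglongrightarrow> 0"
    using lim L2_norm_comp[OF L2_diff[OF u test_L2[OF \<phi> \<Omega>]]] by simp
  show "(\<lambda>x. (T x *v G (\<Phi> x)) $ i) \<in> L2 \<Omega>" for i
    by (rule bounded_coeff_mult_L2[OF bounded_T L2_comp[OF G]])
  obtain C where C: "0 \<le> C" "\<And>x i j. x \<in> \<Omega> \<Longrightarrow> \<bar>T x $ i $ j\<bar> \<le> C"
    "\<And>i j. (\<lambda>x. T x $ i $ j) \<in> borel_measurable (lebesgue_on \<Omega>)" using bounded_coeffE[OF bounded_T] by metis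
  fix i
  let ?d = "\<lambda>n j x. G x $ j - grad (\<phi> n) x $ j"
  have d: "?d n j \<in> L2 \<Omega>" for n j
    using L2_diff[OF G test_L2[OF test_pderiv[OF \<phi>] \<Omega>]] by (simp add: grad_def)
  note m = L2_bounded_mult[OF C(3) C(2) C(1) L2_comp[OF d]]
  show "(\<lambda>n. L2_norm \<Omega> (\<lambda>x. (T x *v G (\<Phi> x)) $ i - grad (\<lambda>x. \<phi> n (\<Phi> x)) x $ i)) \<longlonglongrightarrow> 0"
  proof (rule tendsto_sandwich[OF _ _ tendsto_const])
    have "(\<lambda>n. \<Sum>j\<in>UNIV. C * L2_norm \<Omega> (?d n j)) \<longlonglongrightarrow> (\<Sum>j\<in>(UNIV :: 'n set). C * 0)"
      by (intro tendsto_intros limG)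
    then show "(\<lambda>n. \<Sum>j\<in>UNIV. C * L2_norm \<Omega> (?d n j)) \<longlonglongrightarrow> 0" by simp
    have "L2_norm \<Omega> (\<lambda>x. (T x *v G (\<Phi> x)) $ i - grad (\<lambda>x. \<phi> n (\<Phi> x)) x $ i) \<le> (\<Sum>j\<in>UNIV. C * L2_norm \<Omega> (?d n j))" for n
    proof -
      have "L2_norm \<Omega> (\<lambda>x. (T x *v G (\<Phi> x)) $ i - grad (\<lambda>x. \<phi> n (\<Phi> x)) x $ i) =
          L2_norm \<Omega> (\<lambda>x. \<Sum>j\<in>UNIV. T x $ i $ j * ?d n j (\<Phi> x))"
        by (rule L2_norm_cong) (simp add: grad_comp[OF \<phi>] matrix_vector_mult_def sum_subtractf algebra_simps)
      also have "\<dots> \<le> (\<Sum>j\<in>UNIV. L2_norm \<Omega> (\<lambda>x. T x $ i $ j * ?d n j (\<Phi> x)))"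
        by (intro L2_norm_sum m(1)) auto
      also have "\<dots> \<le> (\<Sum>j\<in>UNIV. C * L2_norm \<Omega> (?d n j))"
        using m(2) by (intro sum_mono) (simp add: L2_norm_comp[OF d])
      finally show ?thesis .
    qed
    then show "\<forall>\<^sub>F n in sequentially. L2_norm \<Omega> (\<lambda>x. (T x *v G (\<Phi> x)) $ i - grad (\<lambda>x. \<phi> n (\<Phi> x)) x $ i)
        \<le> (\<Sum>j\<in>UNIV. C * L2_norm \<Omega> (?d n j))" by simp
  qed simp
qed

lemma H10_comp:
  assumes u: "u \<in> H10 \<Omega>"
  shows "(\<lambda>x. u (\<Phi> x)) \<in> H10 \<Omega>"
    and "AE x in lebesgue_on \<Omega>. weak_grad \<Omega> (\<lambda>x. u (\<Phi> x)) x = T x *v weak_grad \<Omega> u (\<Phi> x)"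
    and "(\<lambda>x. (T x *v weak_grad \<Omega> u (\<Phi> x)) $ i) \<in> L2 \<Omega>"
proof -
  obtain \<phi> where "H10_seq \<Omega> u (weak_grad \<Omega> u) \<phi>" using H10_seqI[OF open_domain u] by blast
  note seq = H10_seq_comp[OF this]
  show "(\<lambda>x. u (\<Phi> x)) \<in> H10 \<Omega>" by (rule H10_seqD[OF open_domain seq])
  show "AE x in lebesgue_on \<Omega>. weak_grad \<Omega> (\<lambda>x. u (\<Phi> x)) x = T x *v weak_grad \<Omega> u (\<Phi> x)"
    by (rule weak_grad_AE[OF open_domain H10_seq_weak_grad[OF open_domain seq]])
  show "(\<lambda>x. (T x *v weak_grad \<Omega> u (\<Phi> x)) $ i) \<in> L2 \<Omega>" using seq by (simp add: H10_seq_def)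
qed

text \<open>The hypothesis \<open>ab\<close> says that \<open>b\<close> is the push-forward of
  \<open>a\<close>; a Jacobian determinant is absent because the map preserves the measure.\<close>

lemma energy_comp:
  assumes a: "bounded_coeff \<Omega> a" and b: "bounded_coeff \<Omega> b"
    and ab: "\<And>x \<xi> \<zeta>. x \<in> \<Omega> \<Longrightarrow> (T x *v \<xi>) \<bullet> (a x *v (T x *v \<zeta>)) = \<xi> \<bullet> (b (\<Phi> x) *v \<zeta>)"
    and u: "u \<in> H10 \<Omega>" and v: "v \<in> H10 \<Omega>"
  shows "energy \<Omega> a (\<lambda>x. v (\<Phi> x)) (\<lambda>x. u (\<Phi> x)) = energy \<Omega> b v u"
proof -
  have "energy \<Omega> a (\<lambda>x. v (\<Phi> x)) (\<lambda>x. u (\<Phi> x)) =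
      (LINT x|lebesgue_on \<Omega>. (T x *v weak_grad \<Omega> v (\<Phi> x)) \<bullet> (a x *v (T x *v weak_grad \<Omega> u (\<Phi> x))))"
    by (rule energy_eq[OF open_domain a H10_comp(1)[OF u] H10_comp(1)[OF v] H10_comp(3)[OF u] H10_comp(2)[OF u]
          H10_comp(3)[OF v] H10_comp(2)[OF v]])
  also have "\<dots> = (LINT x|lebesgue_on \<Omega>. weak_grad \<Omega> v (\<Phi> x) \<bullet> (b (\<Phi> x) *v weak_grad \<Omega> u (\<Phi> x)))"
    by (intro Bochner_Integration.integral_cong refl ab) (simp add: space_restrict_space)
  also have "\<dots> = energy \<Omega> b v u"
    unfolding energy_def
    by (rule integral_comp[OF borel_measurable_integrable[OF energy_integrable[OF b weak_grad_L2[OF u] weak_grad_L2[OF v]]]])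
  finally show ?thesis .
qed

end

section \<open>Dirichlet eigensystems\<close>

definition elliptic_coeff :: "(real^'n::finite) set \<Rightarrow> real \<Rightarrow> (real^'n \<Rightarrow> real^'n^'n) \<Rightarrow> bool" where
  "elliptic_coeff \<Omega> \<theta> a \<longleftrightarrow> 0 < \<theta> \<and> bounded_coeff \<Omega> a \<and> (\<forall>x\<in>\<Omega>. transpose (a x) = a x) \<and>
     (\<forall>x\<in>\<Omega>. \<forall>\<xi>. \<theta> * (norm \<xi>)\<^sup>2 \<le> \<xi> \<bullet> (a x *v \<xi>) \<and> \<xi> \<bullet> (a x *v \<xi>) \<le> inverse \<theta> * (norm \<xi>)\<^sup>2)"

lemma energy_nonneg:
  assumes "elliptic_coeff \<Omega> \<theta> a"
  shows "0 \<le> energy \<Omega> a v v"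
  unfolding energy_def
proof (rule integral_nonneg_AE, rule AE_I2)
  fix x assume "x \<in> space (lebesgue_on \<Omega>)"
  then have x: "x \<in> \<Omega>" by (simp add: space_restrict_space)
  have "0 \<le> \<theta> * (norm (weak_grad \<Omega> v x))\<^sup>2" using assms by (simp add: elliptic_coeff_def)
  also have "\<dots> \<le> weak_grad \<Omega> v x \<bullet> (a x *v weak_grad \<Omega> v x)"
    using assms x by (simp add: elliptic_coeff_def)
  finally show "0 \<le> weak_grad \<Omega> v x \<bullet> (a x *v weak_grad \<Omega> v x)" .
qed

text \<open>Both quadratic forms lie pointwise between \<open>\<theta>\<close> and
  \<open>inverse \<theta>\<close> times the squared length of the gradient, whence the factor
  \<open>(inverse \<theta>)\<^sup>2\<close>.\<close>

lemma energy_comparison: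
  assumes a: "elliptic_coeff \<Omega> \<theta> a" and b: "elliptic_coeff \<Omega> \<theta> b" and v: "v \<in> H10 \<Omega>"
  shows "energy \<Omega> b v v \<le> (inverse \<theta>)\<^sup>2 * energy \<Omega> a v v"
proof -
  let ?G = "weak_grad \<Omega> v"
  have \<theta>: "0 < \<theta>" using a by (simp add: elliptic_coeff_def)
  have int: "integrable (lebesgue_on \<Omega>) (\<lambda>x. ?G x \<bullet> (c x *v ?G x))" if "bounded_coeff \<Omega> c" for c
    by (intro energy_integrable that weak_grad_L2 v)
  have "energy \<Omega> b v v \<le> (LINT x|lebesgue_on \<Omega>. (inverse \<theta>)\<^sup>2 * (?G x \<bullet> (a x *v ?G x)))"
    unfolding energy_def
  proof (rule integral_mono)
    show "integrable (lebesgue_on \<Omega>) (\<lambda>x. ?G x \<bullet> (b x *v ?G x))"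
      using b by (intro int) (simp add: elliptic_coeff_def)
    show "integrable (lebesgue_on \<Omega>) (\<lambda>x. (inverse \<theta>)\<^sup>2 * (?G x \<bullet> (a x *v ?G x)))"
      using a by (intro integrable_mult_right int) (simp add: elliptic_coeff_def)
    fix x assume "x \<in> space (lebesgue_on \<Omega>)"
    then have x: "x \<in> \<Omega>" by (simp add: space_restrict_space)
    have "?G x \<bullet> (b x *v ?G x) \<le> inverse \<theta> * (norm (?G x))\<^sup>2"
      using b x by (simp add: elliptic_coeff_def)
    also have "\<dots> = (inverse \<theta>)\<^sup>2 * (\<theta> * (norm (?G x))\<^sup>2)"
      using \<theta> by (simp add: power2_eq_square)
    also have "\<dots> \<le> (inverse \<theta>)\<^sup>2 * (?G x \<bullet> (a x *v ?G x))"
      using a x by (intro mult_left_mono) (auto simp: elliptic_coeff_def)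
    finally show "?G x \<bullet> (b x *v ?G x) \<le> (inverse \<theta>)\<^sup>2 * (?G x \<bullet> (a x *v ?G x))" .
  qed
  then show ?thesis by (simp add: energy_def)
qed

locale dirichlet_system =
  fixes \<Omega> :: "(real^'n::finite) set" and \<theta> :: real and a lam \<phi>
  assumes open_domain: "open \<Omega>" and elliptic: "elliptic_coeff \<Omega> \<theta> a"
    and system: "is_dirichlet_eigensystem \<Omega> a lam \<phi>"
begin

lemma basis_H10: "\<phi> k \<in> H10 \<Omega>"
  using system by (simp add: is_dirichlet_eigensystem_def)

lemma eigenvalue_pos: "0 < lam k"
proof -
  have "0 < lam 0" "lam 0 \<le> lam k" using system by (auto simp: is_dirichlet_eigensystem_def mono_def)
  then show ?thesis by linarith
qed

lemma eigenvalue_ge: "lam 0 \<le> lam k"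
  using system by (auto simp: is_dirichlet_eigensystem_def mono_def)

sublocale orthonormal_basis \<Omega> \<phi>
proof
  show "\<phi> k \<in> L2 \<Omega>" for k by (rule H10_L2[OF basis_H10])
  show "L2_inner \<Omega> (\<phi> j) (\<phi> k) = (if j = k then 1 else 0)" for j k
    using system by (simp add: is_dirichlet_eigensystem_def)
  show "AE x in lebesgue_on \<Omega>. u x = 0" if "u \<in> L2 \<Omega>" "\<And>k. L2_inner \<Omega> u (\<phi> k) = 0" for u
    using system that by (simp add: is_dirichlet_eigensystem_def)
qed

lemma bounded: "bounded_coeff \<Omega> a" using elliptic by (simp add: elliptic_coeff_def)

lemma energy_sym: "energy \<Omega> a v u = energy \<Omega> a u v"
  using elliptic by (intro energy_commute) (simp add: elliptic_coeff_def)

lemma energy_basis: "v \<in> H10 \<Omega> \<Longrightarrow> energy \<Omega> a (\<phi> k) v = lam k * L2_inner \<Omega> v (\<phi> k)"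
  using system by (subst energy_sym) (simp add: is_dirichlet_eigensystem_def energy_def L2_inner_commute)

lemma partial_H10: "finite I \<Longrightarrow> (\<lambda>x. \<Sum>k\<in>I. c k * \<phi> k x) \<in> H10 \<Omega>"
proof (induction I rule: finite_induct)
  case empty
  \<comment> \<open>The zero function enters as a combination of basis functions with coefficients
    0.\<close>
  show ?case using H10_lincomb(1)[OF open_domain basis_H10 basis_H10, of 0 _ 0] by simp
next
  case (insert k I)
  then show ?case using H10_lincomb(1)[OF open_domain basis_H10 insert.IH, of "c k" k 1] by simp
qed

lemma energy_partial_left:
  assumes "finite I" "v \<in> H10 \<Omega>"
  shows "energy \<Omega> a (\<lambda>x. \<Sum>k\<in>I. c k * \<phi> k x) v = (\<Sum>k\<in>I. c k * (lam k * L2_inner \<Omega> v (\<phi> k)))"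
  using assms(1)
proof (induction I rule: finite_induct)
  case empty
  show ?case
    using energy_lincomb_left[OF open_domain bounded basis_H10 basis_H10 assms(2), of 0 _ 0] by simp
next
  case (insert k I)
  then show ?case
    using energy_lincomb_left[OF open_domain bounded basis_H10 partial_H10[OF insert.hyps(1)] assms(2), of "c k" k 1 c]
    by (simp add: energy_basis assms(2))
qed

lemma energy_partial:
  assumes "finite I"
  shows "energy \<Omega> a (\<lambda>x. \<Sum>k\<in>I. c k * \<phi> k x) (\<lambda>x. \<Sum>k\<in>I. c k * \<phi> k x) = (\<Sum>k\<in>I. lam k * (c k)\<^sup>2)"
  by (subst energy_partial_left[OF assms partial_H10[OF assms]])
    (auto simp: inner_partial_basis[OF assms] power2_eq_square intro!: sum.cong)

text \<open>Expands the nonnegative energy of \<open>v\<close> minus its partial expansion.\<close>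

lemma energy_Bessel:
  assumes I: "finite I" and v: "v \<in> H10 \<Omega>"
  shows "(\<Sum>k\<in>I. lam k * (L2_inner \<Omega> v (\<phi> k))\<^sup>2) \<le> energy \<Omega> a v v"
proof -
  let ?P = "\<lambda>x. \<Sum>k\<in>I. L2_inner \<Omega> v (\<phi> k) * \<phi> k x"
  let ?S = "\<Sum>k\<in>I. lam k * (L2_inner \<Omega> v (\<phi> k))\<^sup>2"
  have P: "?P \<in> H10 \<Omega>" by (rule partial_H10[OF I])
  have d: "(\<lambda>x. 1 * v x + (-1) * ?P x) \<in> H10 \<Omega>" by (rule H10_lincomb(1)[OF open_domain v P])
  have Pv: "energy \<Omega> a ?P v = ?S"
    unfolding energy_partial_left[OF I v] by (intro sum.cong refl) (simp add: power2_eq_square)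
  have PP: "energy \<Omega> a ?P ?P = ?S" by (rule energy_partial[OF I])
  let ?d = "\<lambda>x. 1 * v x + (-1) * ?P x"
  have "energy \<Omega> a ?d ?d = energy \<Omega> a v ?d - energy \<Omega> a ?P ?d"
    using energy_lincomb_left[OF open_domain bounded v P d, of 1 "-1"] by simp
  also have "energy \<Omega> a v ?d = energy \<Omega> a v v - ?S"
    using energy_lincomb_left[OF open_domain bounded v P v, of 1 "-1"] Pv by (subst energy_sym) simp
  also have "energy \<Omega> a ?P ?d = energy \<Omega> a v ?P - ?S"
    using energy_lincomb_left[OF open_domain bounded v P P, of 1 "-1"] PP by (subst energy_sym) simp
  also have "energy \<Omega> a v ?P = ?S" using Pv by (subst energy_sym)
  finally show ?thesis using energy_nonneg[OF elliptic, of ?d] by simp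
qed

end

section \<open>Interpolation\<close>

text \<open>The left side is the minimum of the right side over all splittings of a fixed sum
  \<open>A + B\<close>; the gap is a multiple of \<open>(A - r * B)\<^sup>2\<close>.\<close>

lemma parallel_sum_bound:
  fixes A B r :: real assumes "0 < r"
  shows "r / (1 + r) * (A + B)\<^sup>2 \<le> A\<^sup>2 + r * B\<^sup>2"
proof -
  have "r * (A + B)\<^sup>2 \<le> (A\<^sup>2 + r * B\<^sup>2) * (1 + r)"
    using zero_le_power2[of "A - r * B"] by (simp add: power2_eq_square algebra_simps)
  then show ?thesis using assms by (simp add: pos_divide_le_eq)
qed

text \<open>The factor \<open>t * \<mu> / (1 + t * \<mu>)\<close> is the minimum of
  \<open>z\<^sup>2 + t * \<mu> * y\<^sup>2\<close> over \<open>z + y = 1\<close>. Integrated against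
  \<open>t powr (- 1 - s)\<close>, the weight of real interpolation, it yields a constant times
  \<open>\<mu> powr s\<close>.\<close>

definition mellin :: "real \<Rightarrow> real \<Rightarrow> ennreal" where
  "mellin s \<mu> = (\<integral>\<^sup>+t. ennreal (if 0 < t then t powr (- 1 - s) * (t * \<mu> / (1 + t * \<mu>)) else 0) \<partial>lborel)"

text \<open>Substitutes \<open>t / \<mu>\<close> for \<open>t\<close>; in \<open>ennreal\<close>
  this requires no convergence.\<close>

lemma mellin_scale:
  assumes "0 < \<mu>"
  shows "mellin s \<mu> = ennreal (\<mu> powr s) * mellin s 1"
proof -
  let ?f = "\<lambda>\<mu> t. ennreal (if 0 < t then t powr (- 1 - s) * (t * \<mu> / (1 + t * \<mu>)) else 0)"
  have "mellin s \<mu> = ennreal \<bar>1 / \<mu>\<bar> * (\<integral>\<^sup>+t. ?f \<mu> (0 + (1 / \<mu>) * t) \<partial>lborel)"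
    unfolding mellin_def using assms by (intro nn_integral_real_affine) auto
  also have "(\<integral>\<^sup>+t. ?f \<mu> (0 + (1 / \<mu>) * t) \<partial>lborel) = (\<integral>\<^sup>+t. ennreal (\<mu> powr (1 + s)) * ?f 1 t \<partial>lborel)"
  proof (rule nn_integral_cong)
    fix t :: real
    show "?f \<mu> (0 + (1 / \<mu>) * t) = ennreal (\<mu> powr (1 + s)) * ?f 1 t"
    proof (cases "0 < t")
      case True
      have "(t / \<mu>) powr (- 1 - s) = t powr (- 1 - s) * \<mu> powr (1 + s)"
        using assms True powr_minus[of \<mu> "1 + s"] by (simp add: powr_divide field_simps)
      then show ?thesis using True assms
        by (simp add: zero_less_divide_iff ennreal_mult[symmetric] mult_ac)
    qed (use assms in \<open>simp add: zero_less_divide_iff\<close>)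
  qed
  also have "\<dots> = ennreal (\<mu> powr (1 + s)) * mellin s 1"
    unfolding mellin_def by (intro nn_integral_cmult) measurable
  also have "ennreal \<bar>1 / \<mu>\<bar> * (ennreal (\<mu> powr (1 + s)) * mellin s 1) = ennreal (\<mu> powr s) * mellin s 1"
    using assms by (simp add: mult.assoc[symmetric] ennreal_mult[symmetric] powr_add)
  finally show ?thesis .
qed

text \<open>The integrand is positive on \<open>{1..2}\<close>, which is not a null set. Together
  with finiteness this allows the constant to be cancelled.\<close>

lemma mellin_pos: "mellin s 1 > 0"
proof -
  let ?f = "\<lambda>t::real. if 0 < t then t powr (- 1 - s) * (t * 1 / (1 + t * 1)) else 0"
  have "\<not> (AE t in lborel. ennreal (?f t) = 0)"
  proof
    assume "AE t in lborel. ennreal (?f t) = 0"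
    then have "AE t in lborel. \<not> (t \<in> {1..2::real})"
    proof eventually_elim
      case (elim t)
      show ?case
      proof
        assume "t \<in> {1..2}"
        then have "?f t > 0" by auto
        with elim show False by (simp add: ennreal_eq_0_iff)
      qed
    qed
    then have "{1..2::real} \<in> null_sets lborel" by (subst AE_iff_null_sets) auto
    then show False by (auto simp: null_sets_def)
  qed
  then have "mellin s 1 \<noteq> 0"
    unfolding mellin_def by (subst nn_integral_0_iff_AE) auto
  then show ?thesis by (simp add: zero_less_iff_neq_zero)
qed

text \<open>The integrand is at most \<open>t powr (- s)\<close> up to 1, integrable as
  \<open>s < 1\<close>, and at most \<open>t powr (- 1 - s)\<close> beyond, integrable as
  \<open>0 < s\<close>.\<close>

lemma mellin_finite:
  assumes "0 < s" "s < 1"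
  shows "mellin s 1 < \<infinity>"
proof -
  let ?A = "\<lambda>t::real. ennreal (t powr (- s) * indicator {0..1} t)"
  let ?B = "\<lambda>t::real. ennreal (t powr (- 1 - s) * indicator {1..} t)"
  have "mellin s 1 \<le> (\<integral>\<^sup>+t. ?A t + ?B t \<partial>lborel)"
    unfolding mellin_def
  proof (rule nn_integral_mono)
    fix t :: real
    show "ennreal (if 0 < t then t powr (- 1 - s) * (t * 1 / (1 + t * 1)) else 0) \<le> ?A t + ?B t"
    proof (cases "0 < t")
      case True
      show ?thesis
      proof (cases "t \<le> 1")
        case t: True
        have "t powr (- 1 - s) * (t / (1 + t)) \<le> t powr (- 1 - s) * t"
          using True by (intro mult_left_mono) (auto simp: divide_le_eq)
        also have "\<dots> = t powr (- s)"
          using True powr_add[of t "- 1 - s" 1] by simp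
        finally have "ennreal (t powr (- 1 - s) * (t / (1 + t))) \<le> ?A t"
          using True t by (intro ennreal_leI) simp
        then show ?thesis using True by (simp add: add_increasing2)
      next
        case False
        have "t powr (- 1 - s) * (t / (1 + t)) \<le> t powr (- 1 - s) * 1"
          using True by (intro mult_left_mono) (auto simp: divide_le_eq)
        then have "ennreal (t powr (- 1 - s) * (t / (1 + t))) \<le> ?B t"
          using True False by (intro ennreal_leI) simp
        then show ?thesis using True by (simp add: add_increasing)
      qed
    qed simp
  qed
  also have "\<dots> = (\<integral>\<^sup>+t. ?A t \<partial>lborel) + (\<integral>\<^sup>+t. ?B t \<partial>lborel)"
    by (rule nn_integral_add) auto
  also have "(\<integral>\<^sup>+t. ?A t \<partial>lborel) = ennreal (1 powr (- s + 1) / (- s + 1))"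
  proof (rule nn_integral_has_integral_lborel)
    show "((\<lambda>t. t powr (- s) * indicator {0..1} t) has_integral 1 powr (- s + 1) / (- s + 1)) UNIV"
      using has_integral_powr_from_0[of "- s" 1] assms
        has_integral_restrict_UNIV[of "{0..1}" "\<lambda>t. t powr (- s)" "1 powr (- s + 1) / (- s + 1)"]
      by (simp add: indicator_def of_bool_def if_distrib cong: if_cong)
  qed auto
  also have "(\<integral>\<^sup>+t. ?B t \<partial>lborel) = ennreal (- (1 powr (- 1 - s + 1)) / (- 1 - s + 1))"
  proof (rule nn_integral_has_integral_lborel)
    show "((\<lambda>t. t powr (- 1 - s) * indicator {1..} t) has_integral - (1 powr (- 1 - s + 1)) / (- 1 - s + 1)) UNIV"
      using has_integral_powr_to_inf[of "- 1 - s" 1] assms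
        has_integral_restrict_UNIV[of "{1..}" "\<lambda>t. t powr (- 1 - s)" "- (1 powr (- 1 - s + 1)) / (- 1 - s + 1)"]
      by (simp add: indicator_def of_bool_def if_distrib cong: if_cong)
  qed auto
  also have "ennreal (1 powr (- s + 1) / (- s + 1)) + ennreal (- (1 powr (- 1 - s + 1)) / (- 1 - s + 1)) < \<infinity>"
    by simp
  finally show ?thesis .
qed

text \<open>The splitting \<open>c = c/(1+t\<mu>) + t\<mu>c/(1+t\<mu>)\<close> of the coefficients minimises the
  \<open>K\<close>-functional of the pair (\<open>L2\<close>, energy space).\<close>

lemma K_functional_bound:
  fixes c :: "nat \<Rightarrow> real" and N M :: nat
  assumes a: "dirichlet_system \<Omega> \<theta> a \<mu> e" and b: "dirichlet_system \<Omega> \<theta> b lam \<phi>" and t: "0 < t"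
  defines "w \<equiv> (\<lambda>x. \<Sum>k<N. c k * e k x)"
  shows "(\<Sum>j<M. t * lam j / (1 + t * lam j) * (L2_inner \<Omega> w (\<phi> j))\<^sup>2)
    \<le> max 1 ((inverse \<theta>)\<^sup>2) * (\<Sum>k<N. t * \<mu> k / (1 + t * \<mu> k) * (c k)\<^sup>2)"
proof -
  interpret A: dirichlet_system \<Omega> \<theta> a \<mu> e by fact
  interpret B: dirichlet_system \<Omega> \<theta> b lam \<phi> by fact
  let ?C = "max 1 ((inverse \<theta>)\<^sup>2)"
  define y where "y = (\<lambda>x. \<Sum>k<N. c k / (1 + t * \<mu> k) * e k x)"
  define z where "z = (\<lambda>x. \<Sum>k<N. (t * \<mu> k * c k / (1 + t * \<mu> k)) * e k x)"
  have pos: "0 < 1 + t * \<mu> k" for k using t A.eigenvalue_pos[of k] by (simp add: add_pos_pos)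
  have w: "w = (\<lambda>x. z x + y x)"
  proof
    fix x
    have "t * \<mu> k * c k / (1 + t * \<mu> k) + c k / (1 + t * \<mu> k) = c k" for k
      using pos[of k] by (simp add: add_divide_distrib[symmetric] ring_distribs(2)[symmetric] field_simps)
    then show "w x = z x + y x"
      unfolding w_def z_def y_def sum.distrib[symmetric] distrib_right[symmetric] by simp
  qed
  have yH: "y \<in> H10 \<Omega>" unfolding y_def by (rule A.partial_H10) simp
  have z2: "z \<in> L2 \<Omega>" unfolding z_def by (rule A.partial_in_L2)
  have y2: "y \<in> L2 \<Omega>" by (rule H10_L2[OF yH])
  \<comment> \<open>For the second system the splitting \<open>w = z + y\<close> is merely
    admissible, which gives an inequality; for the first system it is optimal, so the final sums are
    equalities.\<close>
  have "(\<Sum>j<M. t * lam j / (1 + t * lam j) * (L2_inner \<Omega> w (\<phi> j))\<^sup>2)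
      \<le> (\<Sum>j<M. (L2_inner \<Omega> z (\<phi> j))\<^sup>2 + t * lam j * (L2_inner \<Omega> y (\<phi> j))\<^sup>2)"
    unfolding w L2_inner_add_left[OF z2 y2 B.in_L2]
    using t B.eigenvalue_pos by (intro sum_mono parallel_sum_bound) simp
  also have "\<dots> = (\<Sum>j<M. (L2_inner \<Omega> z (\<phi> j))\<^sup>2) + t * (\<Sum>j<M. lam j * (L2_inner \<Omega> y (\<phi> j))\<^sup>2)"
    by (simp add: sum.distrib sum_distrib_left mult.assoc)
  also have "\<dots> \<le> L2_inner \<Omega> z z + t * energy \<Omega> b y y"
    using t by (intro add_mono mult_left_mono B.Bessel z2 B.energy_Bessel yH) auto
  also have "\<dots> \<le> L2_inner \<Omega> z z + t * ((inverse \<theta>)\<^sup>2 * energy \<Omega> a y y)"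
    using t energy_comparison[OF A.elliptic B.elliptic yH] by simp
  \<comment> \<open>One constant must dominate the factor 1 of the \<open>L2\<close> part and the
    factor of the energy part; hence the maximum.\<close>
  also have "\<dots> \<le> ?C * L2_inner \<Omega> z z + t * (?C * energy \<Omega> a y y)"
    using t L2_inner_self_nonneg[of \<Omega> z] energy_nonneg[OF A.elliptic, of y]
    by (intro add_mono mult_left_mono mult_right_mono)
      (auto simp: mult_le_cancel_right1 intro: order_trans[OF _ mult_right_mono[of 1]])
  also have "L2_inner \<Omega> z z = (\<Sum>k<N. (t * \<mu> k * c k / (1 + t * \<mu> k))\<^sup>2)"
    unfolding z_def by (rule A.inner_partial_partial) simp
  also have "energy \<Omega> a y y = (\<Sum>k<N. \<mu> k * (c k / (1 + t * \<mu> k))\<^sup>2)"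
    unfolding y_def by (rule A.energy_partial) simp
  also have "?C * (\<Sum>k<N. (t * \<mu> k * c k / (1 + t * \<mu> k))\<^sup>2) + t * (?C * (\<Sum>k<N. \<mu> k * (c k / (1 + t * \<mu> k))\<^sup>2))
      = ?C * (\<Sum>k<N. (t * \<mu> k * c k / (1 + t * \<mu> k))\<^sup>2 + t * (\<mu> k * (c k / (1 + t * \<mu> k))\<^sup>2))"
    by (simp add: sum.distrib sum_distrib_left algebra_simps)
  also have "(\<Sum>k<N. (t * \<mu> k * c k / (1 + t * \<mu> k))\<^sup>2 + t * (\<mu> k * (c k / (1 + t * \<mu> k))\<^sup>2))
      = (\<Sum>k<N. t * \<mu> k / (1 + t * \<mu> k) * (c k)\<^sup>2)"
  proof (rule sum.cong[OF refl])
    fix k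
    define r where "r = t * \<mu> k"
    have r: "1 + r \<noteq> 0" using pos[of k] r_def by simp
    have "(r * c k / (1 + r))\<^sup>2 + r * (c k / (1 + r))\<^sup>2 = r * (c k)\<^sup>2 * (1 + r) / (1 + r)\<^sup>2"
      by (simp add: power_divide power_mult_distrib add_divide_distrib[symmetric]) (simp add: power2_eq_square algebra_simps)
    also have "\<dots> = r / (1 + r) * (c k)\<^sup>2" using r by (simp add: power2_eq_square)
    finally show "(t * \<mu> k * c k / (1 + t * \<mu> k))\<^sup>2 + t * (\<mu> k * (c k / (1 + t * \<mu> k))\<^sup>2) = t * \<mu> k / (1 + t * \<mu> k) * (c k)\<^sup>2"
      by (simp add: r_def mult.assoc)
  qed
  finally show ?thesis .
qed

text \<open>Converts an integrated K-functional back into a weighted sum of squares; the scaling of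
  \<open>mellin\<close> is applied to each summand.\<close>

lemma nn_integral_mellin_sum:
  fixes \<mu> d :: "nat \<Rightarrow> real"
  assumes "\<And>k. 0 < \<mu> k" "\<And>k. 0 \<le> d k"
  shows "(\<integral>\<^sup>+t. ennreal (if 0 < t then t powr (- 1 - s) * (\<Sum>k<N. t * \<mu> k / (1 + t * \<mu> k) * d k) else 0) \<partial>lborel)
    = ennreal (\<Sum>k<N. \<mu> k powr s * d k) * mellin s 1"
proof -
  have "(\<integral>\<^sup>+t. ennreal (if 0 < t then t powr (- 1 - s) * (\<Sum>k<N. t * \<mu> k / (1 + t * \<mu> k) * d k) else 0) \<partial>lborel)
      = (\<integral>\<^sup>+t. (\<Sum>k<N. ennreal (d k) * ennreal (if 0 < t then t powr (- 1 - s) * (t * \<mu> k / (1 + t * \<mu> k)) else 0)) \<partial>lborel)"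
  proof (rule nn_integral_cong)
    fix t :: real
    show "ennreal (if 0 < t then t powr (- 1 - s) * (\<Sum>k<N. t * \<mu> k / (1 + t * \<mu> k) * d k) else 0)
        = (\<Sum>k<N. ennreal (d k) * ennreal (if 0 < t then t powr (- 1 - s) * (t * \<mu> k / (1 + t * \<mu> k)) else 0))"
    proof (cases "0 < t")
      case True
      let ?X = "\<lambda>k. t powr (- 1 - s) * (t * \<mu> k / (1 + t * \<mu> k))"
      have X: "0 \<le> ?X k" for k using assms(1)[of k] True by simp
      have "t powr (- 1 - s) * (\<Sum>k<N. t * \<mu> k / (1 + t * \<mu> k) * d k) = (\<Sum>k<N. d k * ?X k)"
        unfolding sum_distrib_left by (intro sum.cong refl) simp
      moreover have "ennreal (\<Sum>k<N. d k * ?X k) = (\<Sum>k<N. ennreal (d k * ?X k))"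
        by (rule sum_ennreal[symmetric]) (intro mult_nonneg_nonneg assms X)
      moreover have "(\<Sum>k<N. ennreal (d k * ?X k)) = (\<Sum>k<N. ennreal (d k) * ennreal (?X k))"
        using assms X by (intro sum.cong refl ennreal_mult) auto
      ultimately show ?thesis using True by (simp only: if_True)
    qed simp
  qed
  also have "\<dots> = (\<Sum>k<N. ennreal (d k) * mellin s (\<mu> k))"
    unfolding mellin_def by (subst nn_integral_sum) (auto simp: nn_integral_cmult)
  also have "\<dots> = (\<Sum>k<N. ennreal (\<mu> k powr s * d k) * mellin s 1)"
  proof (rule sum.cong[OF refl])
    fix k
    show "ennreal (d k) * mellin s (\<mu> k) = ennreal (\<mu> k powr s * d k) * mellin s 1"
      unfolding mellin_scale[OF assms(1), of s k] 
        ennreal_mult[OF powr_ge_zero assms(2)] by (simp only: mult_ac)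
  qed
  also have "\<dots> = ennreal (\<Sum>k<N. \<mu> k powr s * d k) * mellin s 1"
    unfolding sum_distrib_right[symmetric]
    by (intro arg_cong[of _ _ "\<lambda>x. x * mellin s 1"] sum_ennreal mult_nonneg_nonneg assms) simp
  finally show ?thesis .
qed

text \<open>\<open>K_functional_bound\<close> holds for each \<open>t > 0\<close>. Integrating it
  against the interpolation weight gives both sides the factor \<open>mellin s 1\<close>, which is
  positive and finite and cancels.\<close>

lemma interpolation_partial:
  assumes a: "dirichlet_system \<Omega> \<theta> a \<mu> e" and b: "dirichlet_system \<Omega> \<theta> b lam \<phi>" and s: "0 < s" "s < 1"
  shows "(\<Sum>j<M. lam j powr s * (L2_inner \<Omega> (\<lambda>x. \<Sum>k<N. c k * e k x) (\<phi> j))\<^sup>2)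
    \<le> max 1 ((inverse \<theta>)\<^sup>2) * (\<Sum>k<N. \<mu> k powr s * (c k)\<^sup>2)"
proof -
  interpret A: dirichlet_system \<Omega> \<theta> a \<mu> e by fact
  interpret B: dirichlet_system \<Omega> \<theta> b lam \<phi> by fact
  define C where "C = max 1 ((inverse \<theta>)\<^sup>2)"
  define d where "d j = (L2_inner \<Omega> (\<lambda>x. \<Sum>k<N. c k * e k x) (\<phi> j))\<^sup>2" for j
  have C: "C \<ge> 0" by (simp add: C_def)
  let ?l = "\<Sum>j<M. lam j powr s * d j" and ?r = "\<Sum>k<N. \<mu> k powr s * (C * (c k)\<^sup>2)"
  have r: "0 \<le> ?r" using C by (intro sum_nonneg) auto
  have "ennreal ?l * mellin s 1 =
      (\<integral>\<^sup>+t. ennreal (if 0 < t then t powr (- 1 - s) * (\<Sum>j<M. t * lam j / (1 + t * lam j) * d j) else 0) \<partial>lborel)"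
    by (rule nn_integral_mellin_sum[symmetric]) (simp_all add: B.eigenvalue_pos d_def)
  also have "\<dots> \<le> (\<integral>\<^sup>+t. ennreal (if 0 < t then t powr (- 1 - s) * (\<Sum>k<N. t * \<mu> k / (1 + t * \<mu> k) * (C * (c k)\<^sup>2)) else 0) \<partial>lborel)"
  proof (rule nn_integral_mono, rule ennreal_leI)
    fix t :: real
    have "(\<Sum>j<M. t * lam j / (1 + t * lam j) * d j) \<le> (\<Sum>k<N. t * \<mu> k / (1 + t * \<mu> k) * (C * (c k)\<^sup>2))" if "0 < t"
      using K_functional_bound[OF a b that, of c N M] unfolding C_def d_def sum_distrib_left
      by (simp add: mult.left_commute)
    then show "(if 0 < t then t powr (- 1 - s) * (\<Sum>j<M. t * lam j / (1 + t * lam j) * d j) else 0) \<le>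
        (if 0 < t then t powr (- 1 - s) * (\<Sum>k<N. t * \<mu> k / (1 + t * \<mu> k) * (C * (c k)\<^sup>2)) else 0)"
      by (auto intro: mult_left_mono)
  qed
  also have "\<dots> = ennreal ?r * mellin s 1"
    by (rule nn_integral_mellin_sum) (simp_all add: A.eigenvalue_pos C)
  finally have "ennreal ?l * mellin s 1 \<le> ennreal ?r * mellin s 1" .
  then have "ennreal ?l \<le> ennreal ?r"
    using mellin_pos[of s] mellin_finite[OF s]
    by (subst (asm) (1 2) mult.commute, subst (asm) ennreal_mult_le_mult_iff) auto
  then have "?l \<le> ?r" using r by simp
  then show ?thesis by (simp add: d_def C_def sum_distrib_left mult_ac)
qed

text \<open>As the roles of the two systems can be exchanged, the domain of the fractional form is
  the same for all coefficients with ellipticity constant \<open>\<theta>\<close>.\<close>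

lemma interpolation_summable:
  assumes a: "dirichlet_system \<Omega> \<theta> a \<mu> e" and b: "dirichlet_system \<Omega> \<theta> b lam \<phi>" and s: "0 < s" "s < 1"
    and u: "u \<in> L2 \<Omega>" and sum: "summable (\<lambda>k. \<mu> k powr s * (L2_inner \<Omega> u (e k))\<^sup>2)"
  shows "summable (\<lambda>k. lam k powr s * (L2_inner \<Omega> u (\<phi> k))\<^sup>2)"
proof -
  interpret A: dirichlet_system \<Omega> \<theta> a \<mu> e by fact
  interpret B: dirichlet_system \<Omega> \<theta> b lam \<phi> by fact
  let ?C = "max 1 ((inverse \<theta>)\<^sup>2)"
  let ?R = "?C * (\<Sum>k. \<mu> k powr s * (L2_inner \<Omega> u (e k))\<^sup>2)"
  have "(\<Sum>j<M. lam j powr s * (L2_inner \<Omega> u (\<phi> j))\<^sup>2) \<le> ?R" for M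
  \<comment> \<open>With \<open>M\<close> fixed only finitely many coefficients occur, and each
    converges as the expansion of \<open>u\<close> in the first system grows.\<close>
  proof (rule LIMSEQ_le_const2)
    show "(\<lambda>N. \<Sum>j<M. lam j powr s * (L2_inner \<Omega> (\<lambda>x. \<Sum>k<N. L2_inner \<Omega> u (e k) * e k x) (\<phi> j))\<^sup>2)
        \<longlonglongrightarrow> (\<Sum>j<M. lam j powr s * (L2_inner \<Omega> u (\<phi> j))\<^sup>2)"
      by (intro tendsto_intros L2_tendsto_inner[OF A.partial_in_L2 u B.in_L2 A.expansion[OF u]])
    have "(\<Sum>j<M. lam j powr s * (L2_inner \<Omega> (\<lambda>x. \<Sum>k<N. L2_inner \<Omega> u (e k) * e k x) (\<phi> j))\<^sup>2) \<le> ?R" for N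
      using interpolation_partial[OF a b s, where c="\<lambda>k. L2_inner \<Omega> u (e k)"]
        mult_left_mono[OF sum_le_suminf[OF sum, of "{..<N}"], of ?C]
      by (rule order_trans) auto
    then show "\<exists>N. \<forall>n\<ge>N. (\<Sum>j<M. lam j powr s * (L2_inner \<Omega> (\<lambda>x. \<Sum>k<n. L2_inner \<Omega> u (e k) * e k x) (\<phi> j))\<^sup>2) \<le> ?R"
      by blast
  qed
  then show ?thesis by (intro summableI_nonneg_bounded) auto
qed

section \<open>Independence of the eigensystem\<close>

text \<open>The symmetric energy of the two functions equals either eigenvalue times their inner
  product.\<close>

lemma eigenfunctions_orthogonal:
  assumes "dirichlet_system \<Omega> \<theta> a lam \<phi>" "dirichlet_system \<Omega> \<theta> a lam' \<phi>'" "lam j \<noteq> lam' k"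
  shows "L2_inner \<Omega> (\<phi> j) (\<phi>' k) = 0"
proof -
  interpret A: dirichlet_system \<Omega> \<theta> a lam \<phi> by fact
  interpret B: dirichlet_system \<Omega> \<theta> a lam' \<phi>' by fact
  have "lam j * L2_inner \<Omega> (\<phi> j) (\<phi>' k) = lam' k * L2_inner \<Omega> (\<phi> j) (\<phi>' k)"
    unfolding L2_inner_commute[of \<Omega> "\<phi> j"] A.energy_basis[OF B.basis_H10, symmetric]
    unfolding L2_inner_commute[of \<Omega> "\<phi>' k"] B.energy_basis[OF A.basis_H10, symmetric]
    by (rule A.energy_sym)
  then show ?thesis using assms(3) by simp
qed

text \<open>\<open>w\<close> is the half power of order \<open>s/2\<close> applied to
  \<open>u\<close>, built in one system; the second claim says that the other system produces the
  same function.\<close>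

lemma half_power_coefficients:
  assumes A: "dirichlet_system \<Omega> \<theta> a lam \<phi>" and B: "dirichlet_system \<Omega> \<theta> a lam' \<phi>'" and u: "u \<in> L2 \<Omega>"
    and sum: "summable (\<lambda>k. lam k powr s * (L2_inner \<Omega> u (\<phi> k))\<^sup>2)"
  shows "\<exists>w\<in>L2 \<Omega>. (\<forall>k. L2_inner \<Omega> w (\<phi> k) = lam k powr (s/2) * L2_inner \<Omega> u (\<phi> k)) \<and>
    (\<forall>k. L2_inner \<Omega> w (\<phi>' k) = lam' k powr (s/2) * L2_inner \<Omega> u (\<phi>' k))"
proof -
  interpret A: dirichlet_system \<Omega> \<theta> a lam \<phi> by fact
  interpret B: dirichlet_system \<Omega> \<theta> a lam' \<phi>' by fact
  have "lam k powr s = (lam k powr (s/2))\<^sup>2" for k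
    by (simp add: power2_eq_square powr_add[symmetric])
  then have "summable (\<lambda>k. (lam k powr (s/2) * L2_inner \<Omega> u (\<phi> k))\<^sup>2)"
    using sum by (simp add: power_mult_distrib)
  then obtain w where w: "w \<in> L2 \<Omega>" and wk: "\<And>k. L2_inner \<Omega> w (\<phi> k) = lam k powr (s/2) * L2_inner \<Omega> u (\<phi> k)"
    by (rule A.Riesz_Fischer) (rule that)
  have "L2_inner \<Omega> w (\<phi>' j) = lam' j powr (s/2) * L2_inner \<Omega> u (\<phi>' j)" for j
  proof (rule sums_unique2)
    show "(\<lambda>k. L2_inner \<Omega> w (\<phi> k) * L2_inner \<Omega> (\<phi>' j) (\<phi> k)) sums L2_inner \<Omega> w (\<phi>' j)"
      by (rule A.Parseval[OF w B.in_L2])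
    \<comment> \<open>Terms with \<open>lam k\<close> different from \<open>lam' j\<close> vanish by
      orthogonality, so the eigenvalue can be pulled out of the series.\<close>
    have "L2_inner \<Omega> w (\<phi> k) * L2_inner \<Omega> (\<phi>' j) (\<phi> k) =
        lam' j powr (s/2) * (L2_inner \<Omega> u (\<phi> k) * L2_inner \<Omega> (\<phi>' j) (\<phi> k))" for k
      using eigenfunctions_orthogonal[OF B A, of j k] by (cases "lam' j = lam k") (auto simp: wk)
    then show "(\<lambda>k. L2_inner \<Omega> w (\<phi> k) * L2_inner \<Omega> (\<phi>' j) (\<phi> k)) sums (lam' j powr (s/2) * L2_inner \<Omega> u (\<phi>' j))"
      by (simp only: sums_mult[OF A.Parseval[OF u B.in_L2]])
  qed
  then show ?thesis using w wk by blast
qed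

text \<open>Either series is the \<open>L2\<close> inner product of the half powers of
  \<open>u\<close> and \<open>v\<close>, which do not depend on the system.\<close>

lemma fractional_form_unique:
  assumes A: "dirichlet_system \<Omega> \<theta> a lam \<phi>" and B: "dirichlet_system \<Omega> \<theta> a lam' \<phi>'"
    and u: "u \<in> L2 \<Omega>" "summable (\<lambda>k. lam k powr s * (L2_inner \<Omega> u (\<phi> k))\<^sup>2)"
    and v: "v \<in> L2 \<Omega>" "summable (\<lambda>k. lam k powr s * (L2_inner \<Omega> v (\<phi> k))\<^sup>2)"
  shows "(\<Sum>k. lam k powr s * L2_inner \<Omega> u (\<phi> k) * L2_inner \<Omega> (\<phi> k) v) =
    (\<Sum>k. lam' k powr s * L2_inner \<Omega> u (\<phi>' k) * L2_inner \<Omega> (\<phi>' k) v)"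
proof -
  interpret A: dirichlet_system \<Omega> \<theta> a lam \<phi> by fact
  interpret B: dirichlet_system \<Omega> \<theta> a lam' \<phi>' by fact
  obtain w z where w: "w \<in> L2 \<Omega>" "\<And>k. L2_inner \<Omega> w (\<phi> k) = lam k powr (s/2) * L2_inner \<Omega> u (\<phi> k)"
      "\<And>k. L2_inner \<Omega> w (\<phi>' k) = lam' k powr (s/2) * L2_inner \<Omega> u (\<phi>' k)"
    and z: "z \<in> L2 \<Omega>" "\<And>k. L2_inner \<Omega> z (\<phi> k) = lam k powr (s/2) * L2_inner \<Omega> v (\<phi> k)"
      "\<And>k. L2_inner \<Omega> z (\<phi>' k) = lam' k powr (s/2) * L2_inner \<Omega> v (\<phi>' k)"
    using half_power_coefficients[OF A B u] half_power_coefficients[OF A B v] by metis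
  have p: "r powr s * x * y = (r powr (s/2) * x) * (r powr (s/2) * y)" for r x y :: real
    by (simp add: powr_add[symmetric] mult_ac flip: mult.assoc[of "r powr (s/2)" "r powr (s/2)"])
  have "(\<lambda>k. lam k powr s * L2_inner \<Omega> u (\<phi> k) * L2_inner \<Omega> (\<phi> k) v) sums L2_inner \<Omega> w z"
    using A.Parseval[OF w(1) z(1)] unfolding w(2) z(2) p L2_inner_commute[of \<Omega> "\<phi> _" v] .
  moreover have "(\<lambda>k. lam' k powr s * L2_inner \<Omega> u (\<phi>' k) * L2_inner \<Omega> (\<phi>' k) v) sums L2_inner \<Omega> w z"
    using B.Parseval[OF w(1) z(1)] unfolding w(3) z(3) p L2_inner_commute[of \<Omega> "\<phi>' _" v] .
  ultimately show ?thesis by (simp add: sums_iff)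
qed

section \<open>Transport of the fractional operators\<close>

text \<open>\<open>pullback\<close> makes \<open>b\<close> the push-forward of \<open>a\<close>
  under \<open>\<Phi>\<close>, and \<open>pushforward\<close> is the same relation for the inverse.
  Carrying both makes the setting symmetric, so each result is available in both directions through
  \<open>swap\<close>.\<close>

locale transport_pair =
  fwd: transport \<Omega> \<Phi> T + bwd: transport \<Omega> \<Psi> S
  for \<Omega> :: "(real^'n::finite) set" and \<Phi> \<Psi> :: "real^'n \<Rightarrow> real^'n" and T S :: "real^'n \<Rightarrow> real^'n^'n" +
  fixes \<theta> :: real and a b :: "real^'n \<Rightarrow> real^'n^'n"
  assumes inverse [simp]: "\<Phi> (\<Psi> x) = x" "\<Psi> (\<Phi> x) = x"
    and elliptic: "elliptic_coeff \<Omega> \<theta> a" "elliptic_coeff \<Omega> \<theta> b"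
    and pullback: "x \<in> \<Omega> \<Longrightarrow> (T x *v \<xi>) \<bullet> (a x *v (T x *v \<zeta>)) = \<xi> \<bullet> (b (\<Phi> x) *v \<zeta>)"
    and pushforward: "x \<in> \<Omega> \<Longrightarrow> (S x *v \<xi>) \<bullet> (b x *v (S x *v \<zeta>)) = \<xi> \<bullet> (a (\<Psi> x) *v \<zeta>)"
begin

lemma swap: "transport_pair \<Omega> \<Psi> \<Phi> S T \<theta> b a"
  by unfold_locales (auto simp: elliptic pullback pushforward)

text \<open>Composition with \<open>\<Phi>\<close> is unitary, so its adjoint is composition with
  the inverse.\<close>

lemma L2_inner_comp_shift:
  assumes "u \<in> L2 \<Omega>" "v \<in> L2 \<Omega>"
  shows "L2_inner \<Omega> (\<lambda>x. u (\<Phi> x)) v = L2_inner \<Omega> u (\<lambda>x. v (\<Psi> x))"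
  using fwd.L2_inner_comp[OF assms(1) bwd.L2_comp[OF assms(2)]] by simp

text \<open>Testing \<open>\<phi> k \<circ> \<Phi>\<close> with \<open>v\<close> in the form of
  \<open>a\<close> is testing \<open>\<phi> k\<close> with \<open>v \<circ> \<Psi>\<close> in the
  form of \<open>b\<close>; completeness moves across in the same way.\<close>

lemma eigensystem_comp:
  assumes sys: "is_dirichlet_eigensystem \<Omega> b lam \<phi>"
  shows "is_dirichlet_eigensystem \<Omega> a lam (\<lambda>k x. \<phi> k (\<Phi> x))"
proof -
  interpret B: dirichlet_system \<Omega> \<theta> b lam \<phi>
    by unfold_locales (use sys elliptic fwd.open_domain in auto)
  have bd: "bounded_coeff \<Omega> a" "bounded_coeff \<Omega> b" using elliptic by (auto simp: elliptic_coeff_def)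
  show ?thesis
    unfolding is_dirichlet_eigensystem_def
  proof (intro conjI allI ballI impI)
    show "0 < lam 0" "mono lam" using sys by (auto simp: is_dirichlet_eigensystem_def)
    show "(\<lambda>x. \<phi> k (\<Phi> x)) \<in> H10 \<Omega>" for k by (rule fwd.H10_comp(1)[OF B.basis_H10])
    show "L2_inner \<Omega> (\<lambda>x. \<phi> j (\<Phi> x)) (\<lambda>x. \<phi> k (\<Phi> x)) = (if j = k then 1 else 0)" for j k
      by (simp add: fwd.L2_inner_comp B.in_L2 B.orthonormal)
  next
    fix k v assume v: "v \<in> H10 \<Omega>"
    have v': "(\<lambda>x. v (\<Psi> x)) \<in> H10 \<Omega>" by (rule bwd.H10_comp(1)[OF v])
    have "energy \<Omega> a v (\<lambda>x. \<phi> k (\<Phi> x)) = energy \<Omega> b (\<lambda>x. v (\<Psi> x)) (\<phi> k)"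
      using fwd.energy_comp[OF bd pullback B.basis_H10 v'] by simp
    also have "\<dots> = lam k * L2_inner \<Omega> (\<phi> k) (\<lambda>x. v (\<Psi> x))"
      using B.energy_basis[OF v'] B.energy_sym L2_inner_commute by metis
    also have "\<dots> = lam k * L2_inner \<Omega> (\<lambda>x. \<phi> k (\<Phi> x)) v"
      by (simp add: L2_inner_comp_shift B.in_L2 H10_L2[OF v])
    finally show "(LINT x|lebesgue_on \<Omega>. weak_grad \<Omega> v x \<bullet> (a x *v weak_grad \<Omega> (\<lambda>x. \<phi> k (\<Phi> x)) x)) =
        lam k * L2_inner \<Omega> (\<lambda>x. \<phi> k (\<Phi> x)) v"
      by (simp add: energy_def)
  next
    fix u assume u: "u \<in> L2 \<Omega>" "\<forall>k. L2_inner \<Omega> u (\<lambda>x. \<phi> k (\<Phi> x)) = 0"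
    have "AE x in lebesgue_on \<Omega>. u (\<Psi> x) = 0"
    proof (rule B.complete[OF bwd.L2_comp[OF u(1)]])
      fix k
      show "L2_inner \<Omega> (\<lambda>x. u (\<Psi> x)) (\<phi> k) = 0"
        using L2_inner_comp_shift[OF B.in_L2 u(1), of k] u(2) by (simp add: L2_inner_commute)
    qed
    from fwd.AE_comp[OF this] show "AE x in lebesgue_on \<Omega>. u x = 0" by simp
  qed
qed

end

section \<open>Spectral spaces of positive and negative order\<close>

lemma L2_in_Hs_zero: "(\<lambda>x. 0) \<in> Hs \<Omega> s" "Hs_norm \<Omega> s (\<lambda>x. 0) = 0"
  by (auto simp: Hs_def Hs_norm_def L2_zero)

lemma Hs_quot_norm_zero:
  assumes "AE x in lebesgue_on W. w x = 0"
  shows "Hs_quot_norm \<Omega> W s w = 0"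
proof -
  have "Hs_quot_norm \<Omega> W s w \<le> ennreal (Hs_norm \<Omega> s (\<lambda>x. 0))"
    unfolding Hs_quot_norm_def
  proof (rule INF_lower)
    have "AE x in lebesgue_on W. 0 = w x" using assms by eventually_elim simp
    then show "(\<lambda>x. 0) \<in> {U \<in> Hs \<Omega> s. AE x in lebesgue_on W. U x = w x}"
      using L2_in_Hs_zero(1) by simp
  qed
  then show ?thesis by (simp add: L2_in_Hs_zero(2))
qed

text \<open>The selected pair is assumed here to be an eigensystem; nothing below constructs
  one.\<close>

locale laplace_system = dirichlet_system \<Omega> \<theta> "\<lambda>x. mat 1" "lap_eigval \<Omega>" "lap_eigfun \<Omega>"
  for \<Omega> :: "(real^'n::finite) set" and \<theta> +
  fixes s :: real
  assumes s: "0 < s" "s < 1"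
begin

abbreviation "\<mu> \<equiv> lap_eigval \<Omega>"
abbreviation "e \<equiv> lap_eigfun \<Omega>"

lemma Hs_L2: "u \<in> Hs \<Omega> s \<Longrightarrow> u \<in> L2 \<Omega>"
  by (simp add: Hs_def)

lemma Hs_summable: "u \<in> Hs \<Omega> s \<Longrightarrow> summable (\<lambda>k. \<mu> k powr s * (L2_inner \<Omega> u (e k))\<^sup>2)"
  by (simp add: Hs_def)

lemma Hs_finite:
  assumes "u \<in> L2 \<Omega>" "\<And>k. k \<notin> I \<Longrightarrow> L2_inner \<Omega> u (e k) = 0" "finite I"
  shows "u \<in> Hs \<Omega> s"
  using assms unfolding Hs_def by (auto intro!: summable_finite[of I])

lemma Hs_partial: "finite I \<Longrightarrow> (\<lambda>x. \<Sum>k\<in>I. c k * e k x) \<in> Hs \<Omega> s"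
  by (rule Hs_finite[of _ I]) (auto simp: partial_in_L2 inner_partial_basis)

lemma Hs_basis: "e k \<in> Hs \<Omega> s"
  using Hs_partial[of "{k}" "\<lambda>_. 1"] by simp

lemma Hs_norm_partial: "finite I \<Longrightarrow> Hs_norm \<Omega> s (\<lambda>x. \<Sum>k\<in>I. c k * e k x) = sqrt (\<Sum>k\<in>I. \<mu> k powr s * (c k)\<^sup>2)"
  unfolding Hs_norm_def
  by (subst suminf_finite[of I]) (auto simp: inner_partial_basis intro!: arg_cong[of _ _ sqrt] sum.cong)

lemma remainder_coeff:
  assumes "v \<in> L2 \<Omega>"
  shows "L2_inner \<Omega> (\<lambda>x. v x - (\<Sum>k<N. L2_inner \<Omega> v (e k) * e k x)) (e j) = (if j < N then 0 else L2_inner \<Omega> v (e j))"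
  by (subst L2_inner_diff_left[OF assms partial_in_L2 in_L2]) (simp add: inner_partial_basis)

lemma remainder_norm:
  assumes v: "v \<in> Hs \<Omega> s"
  shows "(\<lambda>x. v x - (\<Sum>k<N. L2_inner \<Omega> v (e k) * e k x)) \<in> Hs \<Omega> s"
    and "Hs_norm \<Omega> s (\<lambda>x. v x - (\<Sum>k<N. L2_inner \<Omega> v (e k) * e k x)) =
      sqrt ((\<Sum>k. \<mu> k powr s * (L2_inner \<Omega> v (e k))\<^sup>2) - (\<Sum>k<N. \<mu> k powr s * (L2_inner \<Omega> v (e k))\<^sup>2))"
proof -
  let ?f = "\<lambda>k. \<mu> k powr s * (L2_inner \<Omega> v (e k))\<^sup>2"
  have f: "?f sums suminf ?f" using Hs_summable[OF v] by (rule summable_sums)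
  have eq: "(\<lambda>k. \<mu> k powr s * (L2_inner \<Omega> (\<lambda>x. v x - (\<Sum>k<N. L2_inner \<Omega> v (e k) * e k x)) (e k))\<^sup>2) =
      (\<lambda>k. ?f k - (if k \<in> {..<N} then ?f k else 0))"
    unfolding remainder_coeff[OF Hs_L2[OF v]] by auto
  have sums: "(\<lambda>k. ?f k - (if k \<in> {..<N} then ?f k else 0)) sums (suminf ?f - (\<Sum>k\<in>{..<N}. ?f k))"
    by (intro sums_diff f sums_If_finite_set) simp
  show "(\<lambda>x. v x - (\<Sum>k<N. L2_inner \<Omega> v (e k) * e k x)) \<in> Hs \<Omega> s"
    unfolding Hs_def mem_Collect_eq eq 
    by (rule conjI[OF L2_diff[OF Hs_L2[OF v] partial_in_L2] sums_summable[OF sums]])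
  show "Hs_norm \<Omega> s (\<lambda>x. v x - (\<Sum>k<N. L2_inner \<Omega> v (e k) * e k x)) = sqrt (suminf ?f - (\<Sum>k<N. ?f k))"
    unfolding Hs_norm_def eq using sums_unique[OF sums] by simp
qed

lemma Hminus_linear:
  "h \<in> Hminus \<Omega> s \<Longrightarrow> u \<in> Hs \<Omega> s \<Longrightarrow> v \<in> Hs \<Omega> s \<Longrightarrow> h (\<lambda>x. b * u x + c * v x) = b * h u + c * h v"
  unfolding Hminus_def by blast

lemma Hminus_partial:
  assumes h: "h \<in> Hminus \<Omega> s" and "finite I"
  shows "h (\<lambda>x. \<Sum>k\<in>I. c k * e k x) = (\<Sum>k\<in>I. c k * h (e k))"
  using assms(2)
proof (induction I rule: finite_induct)
  case empty
  show ?case using Hminus_linear[OF h Hs_basis Hs_basis, of 0 _ 0] by simp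
next
  case (insert k I)
  then show ?case using Hminus_linear[OF h Hs_basis Hs_partial[OF insert.hyps(1)], of "c k" k 1 c] by simp
qed

text \<open>Boundedness of \<open>h\<close>, tested on truncations of its own Riesz representative,
  gives \<open>S \<le> C * sqrt S\<close> for each partial sum \<open>S\<close>.\<close>

lemma Hminus_summable:
  assumes h: "h \<in> Hminus \<Omega> s"
  shows "summable (\<lambda>k. \<mu> k powr (- s) * (h (e k))\<^sup>2)"
proof -
  obtain C where C: "\<And>u. u \<in> Hs \<Omega> s \<Longrightarrow> \<bar>h u\<bar> \<le> C * Hs_norm \<Omega> s u" using h unfolding Hminus_def by blast
  have "(\<Sum>k<N. \<mu> k powr (- s) * (h (e k))\<^sup>2) \<le> C\<^sup>2" for N
  proof -
    let ?S = "\<Sum>k<N. \<mu> k powr (- s) * (h (e k))\<^sup>2"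
    \<comment> \<open>These are the coefficients of the representative of \<open>h\<close> with
      respect to the inner product of \<open>Hs\<close>.\<close>
    let ?c = "\<lambda>k. \<mu> k powr (- s) * h (e k)"
    have S: "0 \<le> ?S" by (intro sum_nonneg) auto
    have eq: "\<mu> k powr s * (?c k)\<^sup>2 = \<mu> k powr (- s) * (h (e k))\<^sup>2" for k
      using eigenvalue_pos[of k] by (simp add: power_mult_distrib power2_eq_square powr_minus field_simps)
    have "?S = h (\<lambda>x. \<Sum>k<N. ?c k * e k x)"
      unfolding Hminus_partial[OF h finite_lessThan] by (intro sum.cong refl) (simp add: power2_eq_square)
    also have "\<dots> \<le> C * Hs_norm \<Omega> s (\<lambda>x. \<Sum>k<N. ?c k * e k x)"
      using C[OF Hs_partial[of "{..<N}" ?c]] by simp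
    also have "\<dots> = C * sqrt ?S" by (simp add: Hs_norm_partial eq)
    finally have le: "sqrt ?S * sqrt ?S \<le> C * sqrt ?S" using S by simp
    show ?thesis
    proof (cases "?S = 0")
      case False
      then have "0 < sqrt ?S" using S by simp
      then have "sqrt ?S \<le> C" using le mult_right_le_imp_le by blast
      then have "(sqrt ?S)\<^sup>2 \<le> C\<^sup>2" using \<open>0 < sqrt ?S\<close> by (intro power_mono) auto
      then show ?thesis using S by simp
    qed simp
  qed
  then show ?thesis by (intro summableI_nonneg_bounded) auto
qed

text \<open>\<open>Hminus_norm\<close> only sees the values at eigenfunctions. Boundedness of
  \<open>h\<close> lets it pass to the limit along the expansion of \<open>v\<close>, and the
  Cauchy-Schwarz inequality with weights \<open>\<mu> powr (- s/2)\<close> and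
  \<open>\<mu> powr (s/2)\<close> does the rest.\<close>

lemma Hminus_bound:
  assumes h: "h \<in> Hminus \<Omega> s" and v: "v \<in> Hs \<Omega> s"
  shows "\<bar>h v\<bar> \<le> Hminus_norm \<Omega> s h * Hs_norm \<Omega> s v"
proof -
  let ?c = "\<lambda>k. L2_inner \<Omega> v (e k)"
  let ?v = "\<lambda>N x. \<Sum>k<N. ?c k * e k x"
  obtain C where C: "\<And>u. u \<in> Hs \<Omega> s \<Longrightarrow> \<bar>h u\<bar> \<le> C * Hs_norm \<Omega> s u" using h unfolding Hminus_def by blast
  have "(\<lambda>N. h v - h (?v N)) \<longlonglongrightarrow> 0"
  proof (rule Lim_null_comparison)
    have "h (\<lambda>x. 1 * v x + (-1) * ?v N x) = 1 * h v + (-1) * h (?v N)" for N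
      by (rule Hminus_linear[OF h v Hs_partial]) simp
    then have "\<bar>h v - h (?v N)\<bar> \<le> C * Hs_norm \<Omega> s (\<lambda>x. v x - ?v N x)" for N
      using C[OF remainder_norm(1)[OF v, of N]] by simp
    then show "\<forall>\<^sub>F N in sequentially. norm (h v - h (?v N)) \<le> C * Hs_norm \<Omega> s (\<lambda>x. v x - ?v N x)" by simp
    let ?f = "\<lambda>k. \<mu> k powr s * (?c k)\<^sup>2"
    have "(\<lambda>N. C * sqrt (suminf ?f - (\<Sum>k<N. ?f k))) \<longlonglongrightarrow> C * sqrt (suminf ?f - suminf ?f)"
      by (intro tendsto_intros summable_LIMSEQ Hs_summable v)
    then show "(\<lambda>N. C * Hs_norm \<Omega> s (\<lambda>x. v x - ?v N x)) \<longlonglongrightarrow> 0"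
      unfolding remainder_norm(2)[OF v] by simp
  qed
  from tendsto_diff[OF tendsto_const this, of "h v"]
  have lim: "(\<lambda>N. \<bar>h (?v N)\<bar>) \<longlonglongrightarrow> \<bar>h v\<bar>" by (intro tendsto_rabs) simp
  have "\<bar>h (?v N)\<bar> \<le> Hminus_norm \<Omega> s h * Hs_norm \<Omega> s v" for N
  proof -
    have m: "?c k * h (e k) = (\<mu> k powr (- s/2) * h (e k)) * (\<mu> k powr (s/2) * ?c k)" for k
      using eigenvalue_pos[of k] by (simp add: powr_minus)
    have sq: "(\<mu> k powr (r/2) * x)\<^sup>2 = \<mu> k powr r * x\<^sup>2" for k r x
      by (simp add: power_mult_distrib power2_eq_square[of "\<mu> k powr _"] powr_add[symmetric])
    have "(h (?v N))\<^sup>2 = (\<Sum>k<N. (\<mu> k powr (- s/2) * h (e k)) * (\<mu> k powr (s/2) * ?c k))\<^sup>2"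
      unfolding Hminus_partial[OF h finite_lessThan] m ..
    also have "\<dots> \<le> (\<Sum>k<N. (\<mu> k powr (- s/2) * h (e k))\<^sup>2) * (\<Sum>k<N. (\<mu> k powr (s/2) * ?c k)\<^sup>2)"
      by (rule Cauchy_Schwarz_ineq_sum)
    also have "\<dots> = (\<Sum>k<N. \<mu> k powr (- s) * (h (e k))\<^sup>2) * (\<Sum>k<N. \<mu> k powr s * (?c k)\<^sup>2)"
      unfolding sq ..
    also have "\<dots> \<le> (\<Sum>k. \<mu> k powr (- s) * (h (e k))\<^sup>2) * (\<Sum>k. \<mu> k powr s * (?c k)\<^sup>2)"
      by (intro mult_mono sum_le_suminf Hminus_summable h Hs_summable v suminf_nonneg sum_nonneg) auto
    finally have "sqrt ((h (?v N))\<^sup>2) \<le> sqrt ((\<Sum>k. \<mu> k powr (- s) * (h (e k))\<^sup>2) * (\<Sum>k. \<mu> k powr s * (?c k)\<^sup>2))"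
      by (rule real_sqrt_le_mono)
    then show ?thesis by (simp add: real_sqrt_mult Hminus_norm_def Hs_norm_def)
  qed
  then show ?thesis by (intro LIMSEQ_le_const2[OF lim]) auto
qed

text \<open>All eigenvalues are at least the first one, which is positive.\<close>

lemma L2_norm_le_Hs_norm:
  assumes v: "v \<in> Hs \<Omega> s"
  shows "L2_norm \<Omega> v \<le> sqrt (\<mu> 0 powr (- s)) * Hs_norm \<Omega> s v"
proof -
  let ?c = "\<lambda>k. L2_inner \<Omega> v (e k)"
  have "L2_inner \<Omega> v v = (\<Sum>k. (?c k)\<^sup>2)"
    using Parseval[OF Hs_L2[OF v] Hs_L2[OF v]] by (simp add: sums_iff power2_eq_square)
  also have "\<dots> \<le> (\<Sum>k. \<mu> 0 powr (- s) * (\<mu> k powr s * (?c k)\<^sup>2))"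
  proof (intro suminf_le summable_coeff summable_mult Hs_summable v Hs_L2)
    fix k
    have "\<mu> 0 powr s \<le> \<mu> k powr s"
      using s eigenvalue_pos[of 0] eigenvalue_ge[of k] by (intro powr_mono2) auto
    then have "1 \<le> \<mu> 0 powr (- s) * \<mu> k powr s"
      using eigenvalue_pos[of 0] by (simp add: powr_minus field_simps)
    then have "1 * (?c k)\<^sup>2 \<le> (\<mu> 0 powr (- s) * \<mu> k powr s) * (?c k)\<^sup>2" by (rule mult_right_mono) simp
    then show "(?c k)\<^sup>2 \<le> \<mu> 0 powr (- s) * (\<mu> k powr s * (?c k)\<^sup>2)" by (simp add: mult.assoc)
  qed
  also have "\<dots> = \<mu> 0 powr (- s) * (\<Sum>k. \<mu> k powr s * (?c k)\<^sup>2)"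
    by (rule suminf_mult[OF Hs_summable[OF v]])
  finally have "sqrt (L2_inner \<Omega> v v) \<le> sqrt (\<mu> 0 powr (- s) * (\<Sum>k. \<mu> k powr s * (?c k)\<^sup>2))"
    by (rule real_sqrt_le_mono)
  then show ?thesis by (simp add: L2_norm_def Hs_norm_def real_sqrt_mult)
qed

text \<open>Makes \<open>Hminus_bound\<close> applicable to the error between a source and an
  approximating test function.\<close>

lemma Hminus_diff_L2:
  assumes f: "f \<in> Hminus \<Omega> s" and \<phi>: "\<phi> \<in> L2 \<Omega>"
  shows "(\<lambda>v. f v - L2_inner \<Omega> \<phi> v) \<in> Hminus \<Omega> s"
proof -
  obtain C where C: "\<And>u. u \<in> Hs \<Omega> s \<Longrightarrow> \<bar>f u\<bar> \<le> C * Hs_norm \<Omega> s u" using f unfolding Hminus_def by blast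
  have "\<bar>f u - L2_inner \<Omega> \<phi> u\<bar> \<le> (C + L2_norm \<Omega> \<phi> * sqrt (\<mu> 0 powr (- s))) * Hs_norm \<Omega> s u" if u: "u \<in> Hs \<Omega> s" for u
  proof -
    have "\<bar>f u - L2_inner \<Omega> \<phi> u\<bar> \<le> \<bar>f u\<bar> + \<bar>L2_inner \<Omega> \<phi> u\<bar>" by (rule abs_triangle_ineq4)
    also have "\<dots> \<le> C * Hs_norm \<Omega> s u + L2_norm \<Omega> \<phi> * (sqrt (\<mu> 0 powr (- s)) * Hs_norm \<Omega> s u)"
      using C[OF u] L2_inner_le_norm[OF \<phi> Hs_L2[OF u]] mult_left_mono[OF L2_norm_le_Hs_norm[OF u] L2_norm_nonneg[of \<Omega> \<phi>]]
      by linarith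
    finally show ?thesis by (simp add: algebra_simps)
  qed
  then have "\<exists>C. \<forall>u\<in>Hs \<Omega> s. \<bar>f u - L2_inner \<Omega> \<phi> u\<bar> \<le> C * Hs_norm \<Omega> s u" by blast
  then show ?thesis
    unfolding Hminus_def mem_Collect_eq
    by (intro conjI) (auto simp: Hminus_linear[OF f] L2_inner_lincomb_right[OF _ _ \<phi>] Hs_L2 algebra_simps)
qed

end

section \<open>Transport of sources and solutions\<close>

locale transport_laplace = transport_pair \<Omega> \<Phi> \<Psi> T S \<theta> "\<lambda>x. mat 1" b
  for \<Omega> :: "(real^'n::finite) set" and \<Phi> \<Psi> T S \<theta> b +
  fixes W :: "(real^'n) set" and s :: real
  assumes W: "open W" "W \<subseteq> \<Omega>" and s01: "0 < s" "s < 1"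
    and fixed: "x \<in> W \<Longrightarrow> \<Phi> x = x"
begin

lemma fixed': "x \<in> W \<Longrightarrow> \<Psi> x = x"
  using fixed inverse(2) by metis

lemma test_comp_eq: "\<phi> \<in> test_functions W \<Longrightarrow> \<phi> (\<Phi> x) = \<phi> x"
proof (cases "x \<in> W")
  case False
  assume \<phi>: "\<phi> \<in> test_functions W"
  \<comment> \<open>A value in \<open>W\<close> would be a fixed point, and injectivity would force
    \<open>\<Phi> x = x\<close>.\<close>
  have "\<Phi> x \<notin> W" using False fixed[of "\<Phi> x"] inverse(2) by metis
  then show ?thesis using False test_zero_outside[OF \<phi>] by simp
qed (simp add: fixed)

context
  assumes ex: "\<exists>lam \<phi>. is_dirichlet_eigensystem \<Omega> (\<lambda>x. mat 1) lam \<phi>"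
begin

lemma selected_laplace: "is_dirichlet_eigensystem \<Omega> (\<lambda>x. mat 1) (lap_eigval \<Omega>) (lap_eigfun \<Omega>)"
proof -
  have "\<exists>p. is_dirichlet_eigensystem \<Omega> (\<lambda>x. mat 1) (fst p) (snd p)" using ex by simp
  from someI_ex[OF this] show ?thesis by (simp add: eigval_def eigfun_def dirichlet_eigensystem_def)
qed

text \<open>This system of \<open>b\<close> may differ from the one that \<open>eigval\<close> and
  \<open>eigfun\<close> select; \<open>frac_power_comp\<close> reconciles the two.\<close>

lemma transported: "is_dirichlet_eigensystem \<Omega> b (lap_eigval \<Omega>) (\<lambda>k x. lap_eigfun \<Omega> k (\<Psi> x))"
  by (rule transport_pair.eigensystem_comp[OF swap selected_laplace])

lemma selected: "is_dirichlet_eigensystem \<Omega> b (eigval \<Omega> b) (eigfun \<Omega> b)"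
proof -
  have "\<exists>p. is_dirichlet_eigensystem \<Omega> b (fst p) (snd p)" using transported by force
  from someI_ex[OF this] show ?thesis by (simp add: eigval_def eigfun_def dirichlet_eigensystem_def)
qed

interpretation L: laplace_system \<Omega> \<theta> s
  by unfold_locales (use fwd.open_domain elliptic selected_laplace s01 in auto)

interpretation P: dirichlet_system \<Omega> \<theta> b "lap_eigval \<Omega>" "\<lambda>k x. lap_eigfun \<Omega> k (\<Psi> x)"
  by unfold_locales (use fwd.open_domain elliptic transported in auto)

interpretation Q: dirichlet_system \<Omega> \<theta> b "eigval \<Omega> b" "eigfun \<Omega> b"
  by unfold_locales (use fwd.open_domain elliptic selected in auto)

lemma coefficient_shift: "w \<in> L2 \<Omega> \<Longrightarrow> L2_inner \<Omega> w (\<lambda>x. L.e k (\<Psi> x)) = L2_inner \<Omega> (\<lambda>x. w (\<Phi> x)) (L.e k)"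
  by (simp add: L2_inner_comp_shift L.in_L2)

text \<open>In the transported system of \<open>b\<close> the function
  \<open>u \<circ> \<Psi>\<close> has the coefficients of \<open>u\<close> in the Laplace system.
  Interpolation then passes from the system of \<open>b\<close> to the Laplace system that defines
  \<open>Hs\<close>.\<close>

lemma Hs_comp_backward:
  assumes u: "u \<in> Hs \<Omega> s"
  shows "(\<lambda>x. u (\<Psi> x)) \<in> Hs \<Omega> s"
proof -
  have L2: "(\<lambda>x. u (\<Psi> x)) \<in> L2 \<Omega>" by (rule bwd.L2_comp[OF L.Hs_L2[OF u]])
  have "summable (\<lambda>k. L.\<mu> k powr s * (L2_inner \<Omega> (\<lambda>x. u (\<Psi> x)) (\<lambda>x. L.e k (\<Psi> x)))\<^sup>2)"
    using L.Hs_summable[OF u] by (simp add: coefficient_shift[OF L2])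
  from interpolation_summable[OF P.dirichlet_system_axioms L.dirichlet_system_axioms s01 L2 this]
  show ?thesis using L2 by (simp add: Hs_def)
qed

lemma Hs_summable_transported:
  "u \<in> Hs \<Omega> s \<Longrightarrow> summable (\<lambda>k. L.\<mu> k powr s * (L2_inner \<Omega> u (\<lambda>x. L.e k (\<Psi> x)))\<^sup>2)"
  by (rule interpolation_summable[OF L.dirichlet_system_axioms P.dirichlet_system_axioms s01 L.Hs_L2 L.Hs_summable])

lemma Hs_comp_forward:
  assumes u: "u \<in> Hs \<Omega> s"
  shows "(\<lambda>x. u (\<Phi> x)) \<in> Hs \<Omega> s"
  using fwd.L2_comp[OF L.Hs_L2[OF u]] Hs_summable_transported[OF u]
  by (simp add: Hs_def coefficient_shift[OF L.Hs_L2[OF u]])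

text \<open>The series over the selected system is first exchanged for the one over the transported
  system, whose coefficients are Laplace coefficients of the composed functions.\<close>

lemma frac_power_comp:
  assumes w: "w \<in> Hs \<Omega> s" and v: "v \<in> Hs \<Omega> s"
  shows "frac_power \<Omega> b s w v = frac_power \<Omega> (\<lambda>x. mat 1) s (\<lambda>x. w (\<Phi> x)) (\<lambda>x. v (\<Phi> x))"
proof -
  have "frac_power \<Omega> b s w v = (\<Sum>k. L.\<mu> k powr s * L2_inner \<Omega> w (\<lambda>x. L.e k (\<Psi> x)) * L2_inner \<Omega> (\<lambda>x. L.e k (\<Psi> x)) v)"
    unfolding frac_power_def
    by (rule fractional_form_unique[OF P.dirichlet_system_axioms Q.dirichlet_system_axioms, symmetric])
      (intro L.Hs_L2 w v Hs_summable_transported)+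
  then show ?thesis
    unfolding frac_power_def L2_inner_commute[of \<Omega> "\<lambda>x. L.e _ (\<Psi> x)" v] L2_inner_commute[of \<Omega> "L.e _" "\<lambda>x. v (\<Phi> x)"]
    by (simp add: coefficient_shift L.Hs_L2 w v)
qed

text \<open>Pairing with a test function on \<open>W\<close> is invariant because
  \<open>\<Phi>\<close> preserves both that function and the measure. A source differs from such a
  pairing by an arbitrarily small functional in \<open>Hminus_norm\<close>.\<close>

lemma source_invariant:
  assumes f: "f \<in> Hminus_tilde \<Omega> W s" and v: "v \<in> Hs \<Omega> s"
  shows "f (\<lambda>x. v (\<Phi> x)) = f v"
proof -
  let ?v = "\<lambda>x. v (\<Phi> x)"
  let ?K = "Hs_norm \<Omega> s ?v + Hs_norm \<Omega> s v"
  have v': "?v \<in> Hs \<Omega> s" by (rule Hs_comp_forward[OF v])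
  have K: "0 \<le> ?K"
    unfolding Hs_norm_def by (intro add_nonneg_nonneg real_sqrt_ge_zero suminf_nonneg L.Hs_summable v v') auto
  have fH: "f \<in> Hminus \<Omega> s" using f by (simp add: Hminus_tilde_def)
  have le: "\<bar>f ?v - f v\<bar> \<le> \<delta> * ?K" if \<delta>: "0 < \<delta>" for \<delta>
  proof -
    obtain \<phi> where \<phi>: "\<phi> \<in> test_functions W" and less: "Hminus_norm \<Omega> s (\<lambda>v. f v - L2_inner \<Omega> \<phi> v) < \<delta>"
      using f \<delta> unfolding Hminus_tilde_def by blast
    have \<phi>2: "\<phi> \<in> L2 \<Omega>" by (rule test_L2[OF test_mono[OF \<phi> W(2)] fwd.open_domain])
    let ?h = "\<lambda>v. f v - L2_inner \<Omega> \<phi> v"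
    have h: "?h \<in> Hminus \<Omega> s" by (rule L.Hminus_diff_L2[OF fH \<phi>2])
    have "L2_inner \<Omega> \<phi> ?v = L2_inner \<Omega> \<phi> v"
      using fwd.L2_inner_comp[OF \<phi>2 L.Hs_L2[OF v]] by (simp add: test_comp_eq[OF \<phi>])
    then have "\<bar>f ?v - f v\<bar> = \<bar>?h ?v - ?h v\<bar>" by simp
    also have "\<dots> \<le> \<bar>?h ?v\<bar> + \<bar>?h v\<bar>" by (rule abs_triangle_ineq4)
    also have "\<dots> \<le> Hminus_norm \<Omega> s ?h * ?K"
      using L.Hminus_bound[OF h v'] L.Hminus_bound[OF h v] by (simp add: distrib_left)
    also have "\<dots> \<le> \<delta> * ?K" using less K by (intro mult_right_mono) auto
    finally show ?thesis .
  qed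
  have "\<bar>f ?v - f v\<bar> \<le> 1 / Suc n * ?K" for n by (rule le) simp
  moreover have "(\<lambda>n. 1 / Suc n * ?K) \<longlonglongrightarrow> 0 * ?K"
    by (intro tendsto_mult tendsto_const LIMSEQ_Suc lim_1_over_n)
  ultimately have "\<bar>f ?v - f v\<bar> \<le> 0 * ?K" by (intro LIMSEQ_le_const) blast+
  then show ?thesis by simp
qed

lemma solution_forward:
  assumes f: "f \<in> Hminus_tilde \<Omega> W s"
    and u: "u \<in> Hs \<Omega> s" "\<forall>v\<in>Hs \<Omega> s. frac_power \<Omega> (\<lambda>x. mat 1) s u v = f v"
  shows "(\<lambda>x. u (\<Psi> x)) \<in> Hs \<Omega> s \<and> (\<forall>v\<in>Hs \<Omega> s. frac_power \<Omega> b s (\<lambda>x. u (\<Psi> x)) v = f v)"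
  using u source_invariant[OF f] by (simp add: Hs_comp_backward frac_power_comp Hs_comp_forward)

text \<open>Serves to show that solvability for \<open>b\<close> implies solvability for the
  identity, so that both equations fail together if one does.\<close>

lemma solution_backward:
  assumes f: "f \<in> Hminus_tilde \<Omega> W s"
    and w: "w \<in> Hs \<Omega> s" "\<forall>v\<in>Hs \<Omega> s. frac_power \<Omega> b s w v = f v"
  shows "(\<lambda>x. w (\<Phi> x)) \<in> Hs \<Omega> s \<and> (\<forall>v\<in>Hs \<Omega> s. frac_power \<Omega> (\<lambda>x. mat 1) s (\<lambda>x. w (\<Phi> x)) v = f v)"
proof (intro conjI ballI Hs_comp_forward w)
  fix v assume v: "v \<in> Hs \<Omega> s"
  have v': "(\<lambda>x. v (\<Psi> x)) \<in> Hs \<Omega> s" by (rule Hs_comp_backward[OF v])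
  show "frac_power \<Omega> (\<lambda>x. mat 1) s (\<lambda>x. w (\<Phi> x)) v = f v"
    using frac_power_comp[OF w(1) v'] source_invariant[OF f v'] w(2) v' by simp
qed

text \<open>Testing with an eigenfunction of \<open>b\<close> isolates one coefficient. Such an
  eigenfunction has a single coefficient in its own system, so interpolation places it in
  \<open>Hs\<close>.\<close>

lemma solution_unique:
  assumes w: "w \<in> Hs \<Omega> s" "\<forall>v\<in>Hs \<Omega> s. frac_power \<Omega> b s w v = f v"
    and w': "w' \<in> Hs \<Omega> s" "\<forall>v\<in>Hs \<Omega> s. frac_power \<Omega> b s w' v = f v"
  shows "AE x in lebesgue_on \<Omega>. w x = w' x"
proof -
  have basis: "eigfun \<Omega> b k \<in> Hs \<Omega> s" for k
  proof -
    have "summable (\<lambda>j. eigval \<Omega> b j powr s * (L2_inner \<Omega> (eigfun \<Omega> b k) (eigfun \<Omega> b j))\<^sup>2)"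
      by (rule summable_finite[of "{k}"]) (auto simp: Q.orthonormal)
    from interpolation_summable[OF Q.dirichlet_system_axioms L.dirichlet_system_axioms s01 Q.in_L2 this]
    show ?thesis using Q.in_L2 by (simp add: Hs_def)
  qed
  have single: "frac_power \<Omega> b s u (eigfun \<Omega> b k) = eigval \<Omega> b k powr s * L2_inner \<Omega> u (eigfun \<Omega> b k)" for u k
    unfolding frac_power_def by (subst suminf_finite[of "{k}"]) (auto simp: Q.orthonormal)
  have "L2_inner \<Omega> w (eigfun \<Omega> b k) = L2_inner \<Omega> w' (eigfun \<Omega> b k)" for k
  proof -
    have "eigval \<Omega> b k powr s * L2_inner \<Omega> w (eigfun \<Omega> b k) = eigval \<Omega> b k powr s * L2_inner \<Omega> w' (eigfun \<Omega> b k)"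
      unfolding single[symmetric] using w(2) w'(2) basis by simp
    then show ?thesis using Q.eigenvalue_pos[of k] by simp
  qed
  then have "AE x in lebesgue_on \<Omega>. w x - w' x = 0"
    using L.Hs_L2[OF w(1)] L.Hs_L2[OF w'(1)]
    by (intro Q.complete L2_diff) (auto simp: L2_inner_diff_left Q.in_L2)
  then show ?thesis by eventually_elim simp
qed

text \<open>A solution \<open>u\<close> for the identity yields the solution
  \<open>u \<circ> \<Psi>\<close> for \<open>b\<close>, and \<open>\<Psi>\<close> fixes
  \<open>W\<close>; uniqueness covers the arbitrary representative chosen by
  \<open>solution\<close>.\<close>

lemma solutions_agree:
  assumes f: "f \<in> Hminus_tilde \<Omega> W s"
  shows "AE x in lebesgue_on W. solution \<Omega> (\<lambda>x. mat 1) s f x = solution \<Omega> b s f x"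
proof (cases "\<exists>u. u \<in> Hs \<Omega> s \<and> (\<forall>v\<in>Hs \<Omega> s. frac_power \<Omega> (\<lambda>x. mat 1) s u v = f v)")
  case True
  from someI_ex[OF this] have u: "solution \<Omega> (\<lambda>x. mat 1) s f \<in> Hs \<Omega> s"
    "\<forall>v\<in>Hs \<Omega> s. frac_power \<Omega> (\<lambda>x. mat 1) s (solution \<Omega> (\<lambda>x. mat 1) s f) v = f v"
    by (auto simp: solution_def)
  note uf = solution_forward[OF f u]
  then have "\<exists>w. w \<in> Hs \<Omega> s \<and> (\<forall>v\<in>Hs \<Omega> s. frac_power \<Omega> b s w v = f v)" by blast
  from someI_ex[OF this] have w: "solution \<Omega> b s f \<in> Hs \<Omega> s"
    "\<forall>v\<in>Hs \<Omega> s. frac_power \<Omega> b s (solution \<Omega> b s f) v = f v"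
    by (auto simp: solution_def)
  have "AE x in lebesgue_on \<Omega>. solution \<Omega> (\<lambda>x. mat 1) s f (\<Psi> x) = solution \<Omega> b s f x"
    using uf w by (intro solution_unique) auto
  then have "AE x in lebesgue. x \<in> \<Omega> \<longrightarrow> solution \<Omega> (\<lambda>x. mat 1) s f (\<Psi> x) = solution \<Omega> b s f x"
    using fwd.open_domain by (subst (asm) AE_restrict_space_iff) auto
  then have "AE x in lebesgue. x \<in> W \<longrightarrow> solution \<Omega> (\<lambda>x. mat 1) s f x = solution \<Omega> b s f x"
    by eventually_elim (use W fixed' in force)
  then show ?thesis using W by (subst AE_restrict_space_iff) auto
next
  case False
  then have "\<not> (\<exists>w. w \<in> Hs \<Omega> s \<and> (\<forall>v\<in>Hs \<Omega> s. frac_power \<Omega> b s w v = f v))"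
    using solution_backward[OF f] by blast
  \<comment> \<open>Both choices are made from the same unsatisfiable predicate, hence they return
    the same function.\<close>
  with False have "solution \<Omega> (\<lambda>x. mat 1) s f = solution \<Omega> b s f"
    unfolding solution_def by (intro arg_cong[of _ _ Eps] ext) blast
  then show ?thesis by simp
qed

end

text \<open>If the Dirichlet Laplacian had no eigensystem, then neither would the operator with
  coefficient \<open>b\<close>, and the same arbitrary pair would be selected for both; so the existence of
  eigensystems is not needed.\<close>

theorem sts_dist_zero: "sts_dist \<Omega> W s (\<lambda>x. mat 1) b = 0"
proof -
  have agree: "AE x in lebesgue_on W. solution \<Omega> (\<lambda>x. mat 1) s f x = solution \<Omega> b s f x"
    if f: "f \<in> Hminus_tilde \<Omega> W s" for f
  proof (cases "\<exists>lam \<phi>. is_dirichlet_eigensystem \<Omega> (\<lambda>x. mat 1) lam \<phi>")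
    case True
    then show ?thesis using solutions_agree f by blast
  next
    case False
    have "\<not> is_dirichlet_eigensystem \<Omega> b lam \<phi>" for lam \<phi>
      using False eigensystem_comp by blast
    then have "dirichlet_eigensystem \<Omega> (\<lambda>x. mat 1) = dirichlet_eigensystem \<Omega> b"
      unfolding dirichlet_eigensystem_def using False by (intro arg_cong[of _ _ Eps] ext) blast
    then have "frac_power \<Omega> (\<lambda>x. mat 1) s = frac_power \<Omega> b s"
      by (intro ext) (simp add: frac_power_def eigval_def eigfun_def)
    then show ?thesis by (simp add: solution_def)
  qed
  have "Hs_quot_norm \<Omega> W s (\<lambda>x. source_to_solution \<Omega> W s (\<lambda>x. mat 1) f x - source_to_solution \<Omega> W s b f x) = 0"
    if f: "f \<in> Hminus_tilde \<Omega> W s" for f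
  proof (rule Hs_quot_norm_zero)
    show "AE x in lebesgue_on W. source_to_solution \<Omega> W s (\<lambda>x. mat 1) f x - source_to_solution \<Omega> W s b f x = 0"
      using agree[OF f] by eventually_elim (simp add: source_to_solution_def restrict_def)
  qed
  then show ?thesis
    unfolding sts_dist_def op_norm_def by (intro antisym SUP_least) auto
qed

end

section \<open>Volume preserving rotations\<close>

text \<open>The swirl around \<open>p\<close> rotates the sphere of radius \<open>\<rho>\<close> around \<open>p\<close> in the \<open>(i,j)\<close>-plane by
  an angle that depends on \<open>\<rho>\<close> and vanishes for \<open>\<rho> \<ge> R\<close>.\<close>

locale swirl =
  fixes i j :: "'n::finite" and p :: "real^'n" and R :: real
  assumes ij: "i \<noteq> j" and R: "0 < R"
begin

text \<open>The generator of rotations in the coordinate plane of \<open>i\<close> and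
  \<open>j\<close>, zero on the orthogonal complement of that plane.\<close>

definition J :: "real^'n \<Rightarrow> real^'n" where
  "J z = z $ i *\<^sub>R axis j 1 - z $ j *\<^sub>R axis i 1"

text \<open>The exponential of \<open>\<alpha>\<close> times \<open>J\<close>: the identity
  \<open>J (J (J z)) = - J z\<close> collapses the series to this Rodrigues formula.\<close>

definition rot :: "real \<Rightarrow> real^'n \<Rightarrow> real^'n" where
  "rot \<alpha> z = z + sin \<alpha> *\<^sub>R J z + (1 - cos \<alpha>) *\<^sub>R J (J z)"

text \<open>Using the squared distance keeps the rotation angle smooth at the centre
  \<open>p\<close>.\<close>

definition profile :: "real^'n \<Rightarrow> real" where
  "profile x = flat 1 (R\<^sup>2 - (x - p) \<bullet> (x - p))"

text \<open>Normalised so that \<open>slope x *\<^sub>R (x - p)\<close> is the gradient of the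
  profile.\<close>

definition slope :: "real^'n \<Rightarrow> real" where
  "slope x = - 2 * flat (flat_deriv 1) (R\<^sup>2 - (x - p) \<bullet> (x - p))"

definition \<Phi> :: "real \<Rightarrow> real^'n \<Rightarrow> real^'n" where
  "\<Phi> t x = p + rot (t * profile x) (x - p)"

text \<open>The second term comes from the dependence of the angle on \<open>x\<close>: the
  differential of the angle times the generator at the rotated vector.\<close>

definition D\<Phi> :: "real \<Rightarrow> real^'n \<Rightarrow> real^'n \<Rightarrow> real^'n" where
  "D\<Phi> t x h = rot (t * profile x) h + (t * slope x * ((x - p) \<bullet> h)) *\<^sub>R J (\<Phi> t x - p)"

text \<open>The time independent vector field whose flow is \<open>\<Phi>\<close>.\<close>

definition velocity :: "real^'n \<Rightarrow> real^'n" where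
  "velocity x = profile x *\<^sub>R J (x - p)"

lemma scaleR_component_real: "(c *\<^sub>R z) $ k = c * z $ k" for z :: "real^'n"
  by simp

lemma J_component: "J z $ k = (if k = j then z $ i else if k = i then - z $ j else 0)"
  using ij by (auto simp: J_def axis_def)

lemma linear_J: "linear J"
  by (rule linearI) (simp_all add: vec_eq_iff J_component)

lemma J_simps [simp]:
  "J (x + y) = J x + J y" "J (x - y) = J x - J y" "J (c *\<^sub>R x) = c *\<^sub>R J x" "J (- x) = - J x"
  using linear_J by (simp_all add: linear_add linear_diff linear_scale linear_neg)

lemma J_inner: "J z \<bullet> w = z $ i * w $ j - z $ j * w $ i"
  by (simp add: J_def inner_diff_left inner_axis' )

lemma J_skew: "J z \<bullet> w = - (z \<bullet> J w)"
  by (simp add: J_inner inner_commute[of z])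

lemma J_orthogonal [simp]: "J z \<bullet> z = 0" "z \<bullet> J z = 0"
  by (simp_all add: J_inner inner_commute[of z])

lemma J_cube [simp]: "J (J (J z)) = - J z"
  using ij by (simp add: vec_eq_iff J_component)

lemma bounded_linear_J: "bounded_linear J"
  using linear_J by (simp add: linear_conv_bounded_linear)

lemma rot_J: "rot \<alpha> (J z) = J (rot \<alpha> z)"
  by (simp add: rot_def)

lemma rot_simps [simp]:
  "rot \<alpha> (x + y) = rot \<alpha> x + rot \<alpha> y" "rot \<alpha> (x - y) = rot \<alpha> x - rot \<alpha> y" "rot \<alpha> (c *\<^sub>R x) = c *\<^sub>R rot \<alpha> x"
  "rot 0 x = x"
  by (simp_all add: rot_def algebra_simps)

lemma rot_add: "rot \<alpha> (rot \<beta> z) = rot (\<alpha> + \<beta>) z"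
proof -
  have "rot \<alpha> (rot \<beta> z) = z + (sin \<beta> + sin \<alpha> - sin \<alpha> * (1 - cos \<beta>) - (1 - cos \<alpha>) * sin \<beta>) *\<^sub>R J z
      + ((1 - cos \<beta>) + sin \<alpha> * sin \<beta> + (1 - cos \<alpha>) - (1 - cos \<alpha>) * (1 - cos \<beta>)) *\<^sub>R J (J z)"
    by (simp add: rot_def algebra_simps)
  also have "sin \<beta> + sin \<alpha> - sin \<alpha> * (1 - cos \<beta>) - (1 - cos \<alpha>) * sin \<beta> = sin (\<alpha> + \<beta>)"
    by (simp add: sin_add algebra_simps)
  also have "(1 - cos \<beta>) + sin \<alpha> * sin \<beta> + (1 - cos \<alpha>) - (1 - cos \<alpha>) * (1 - cos \<beta>) = 1 - cos (\<alpha> + \<beta>)"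
    by (simp add: cos_add algebra_simps)
  finally show ?thesis by (simp add: rot_def)
qed

lemma rot_adjoint: "rot \<alpha> z \<bullet> w = z \<bullet> rot (- \<alpha>) w"
  by (simp add: rot_def inner_add_left inner_add_right inner_diff_right J_skew)

lemma rot_inner [simp]: "rot \<alpha> z \<bullet> rot \<alpha> w = z \<bullet> w"
  by (simp add: rot_adjoint rot_add)

lemma \<Phi>_minus: "\<Phi> t x - p = rot (t * profile x) (x - p)"
  by (simp add: \<Phi>_def)

lemma \<Phi>_radius: "(\<Phi> t x - p) \<bullet> (\<Phi> t x - p) = (x - p) \<bullet> (x - p)"
  by (simp add: \<Phi>_minus del: rot_simps(2))

lemma \<Phi>_profile [simp]: "profile (\<Phi> t x) = profile x" "slope (\<Phi> t x) = slope x"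
  by (simp_all add: profile_def slope_def \<Phi>_radius)

lemma \<Phi>_norm: "norm (\<Phi> t x - p) = norm (x - p)"
  using \<Phi>_radius by (simp add: norm_eq_sqrt_inner)

text \<open>Rotation keeps the distance from \<open>p\<close>, so the angle at
  \<open>\<Phi> t x\<close> is that at \<open>x\<close> and the angles add up.\<close>

lemma \<Phi>_add: "\<Phi> s (\<Phi> t x) = \<Phi> (s + t) x"
  unfolding \<Phi>_def[of s] \<Phi>_minus \<Phi>_profile rot_add by (simp add: \<Phi>_def distrib_right)

lemma \<Phi>_0 [simp]: "\<Phi> 0 x = x"
  by (simp add: \<Phi>_def del: rot_simps(2))

lemma outside:
  assumes "x \<notin> ball p R"
  shows "profile x = 0" "slope x = 0"
proof -
  have "R \<le> norm (x - p)" using assms by (simp add: dist_norm norm_minus_commute)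
  then have "R\<^sup>2 \<le> (norm (x - p))\<^sup>2" using R by (intro power_mono) auto
  then show "profile x = 0" "slope x = 0" by (auto simp: profile_def slope_def flat_def power2_norm_eq_inner)
qed

lemma \<Phi>_outside: "x \<notin> ball p R \<Longrightarrow> \<Phi> t x = x"
  by (simp add: \<Phi>_def outside del: rot_simps(2))

lemma profile_derivative: "(profile has_derivative (\<lambda>h. slope x * ((x - p) \<bullet> h))) (at x)"
proof -
  have q: "((\<lambda>x. R\<^sup>2 - (x - p) \<bullet> (x - p)) has_derivative (\<lambda>h. - 2 * ((x - p) \<bullet> h))) (at x)"
    by (auto intro!: derivative_eq_intros simp: inner_commute)
  have "((\<lambda>x. flat 1 (R\<^sup>2 - (x - p) \<bullet> (x - p))) has_derivative
      (\<lambda>h. flat (flat_deriv 1) (R\<^sup>2 - (x - p) \<bullet> (x - p)) * (- 2 * ((x - p) \<bullet> h)))) (at x)"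
    using has_derivative_compose[OF q flat_has_derivative[unfolded has_field_derivative_def]] .
  then show ?thesis
    unfolding profile_def[abs_def] slope_def by (rule has_derivative_eq_rhs) (simp add: fun_eq_iff)
qed

lemma \<Phi>_derivative: "(\<Phi> t has_derivative D\<Phi> t x) (at x)"
proof -
  note J' = bounded_linear.has_derivative[OF bounded_linear_J]
  have "(\<Phi> t has_derivative (\<lambda>h. h + (sin (t * profile x) *\<^sub>R J h + (t * (slope x * ((x - p) \<bullet> h)) * cos (t * profile x)) *\<^sub>R J (x - p))
      + ((1 - cos (t * profile x)) *\<^sub>R J (J h) + (t * (slope x * ((x - p) \<bullet> h)) * sin (t * profile x)) *\<^sub>R J (J (x - p))))) (at x)"
    unfolding \<Phi>_def[abs_def] rot_def
    by (rule derivative_eq_intros J' profile_derivative refl | simp)+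
  moreover have "D\<Phi> t x = (\<lambda>h. h + (sin (t * profile x) *\<^sub>R J h + (t * (slope x * ((x - p) \<bullet> h)) * cos (t * profile x)) *\<^sub>R J (x - p))
      + ((1 - cos (t * profile x)) *\<^sub>R J (J h) + (t * (slope x * ((x - p) \<bullet> h)) * sin (t * profile x)) *\<^sub>R J (J (x - p))))"
  proof
    fix h
    have "J (\<Phi> t x - p) = cos (t * profile x) *\<^sub>R J (x - p) + sin (t * profile x) *\<^sub>R J (J (x - p))"
      unfolding \<Phi>_minus rot_def J_simps J_cube by (simp add: algebra_simps)
    then show "D\<Phi> t x h = h + (sin (t * profile x) *\<^sub>R J h + (t * (slope x * ((x - p) \<bullet> h)) * cos (t * profile x)) *\<^sub>R J (x - p))
      + ((1 - cos (t * profile x)) *\<^sub>R J (J h) + (t * (slope x * ((x - p) \<bullet> h)) * sin (t * profile x)) *\<^sub>R J (J (x - p)))"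
      unfolding D\<Phi>_def by (simp add: rot_def scaleR_add_right mult_ac)
  qed
  ultimately show ?thesis by simp
qed

lemma \<Phi>_time_derivative: "((\<lambda>t. \<Phi> t x) has_vector_derivative velocity (\<Phi> t x)) (at t)"
proof -
  have J\<Phi>: "J (\<Phi> t x - p) = cos (t * profile x) *\<^sub>R J (x - p) + sin (t * profile x) *\<^sub>R J (J (x - p))"
    unfolding \<Phi>_minus rot_def J_simps J_cube by (simp add: algebra_simps)
  have "((\<lambda>t. \<Phi> t x) has_vector_derivative
      (profile x * cos (t * profile x)) *\<^sub>R J (x - p) + (profile x * sin (t * profile x)) *\<^sub>R J (J (x - p))) (at t)"
    unfolding \<Phi>_def rot_def by (auto intro!: derivative_eq_intros simp: mult_ac)
  then show ?thesis
    unfolding velocity_def \<Phi>_profile J\<Phi> by (simp add: scaleR_add_right)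
qed

text \<open>A flow carries its velocity field to itself. Here the second term of
  \<open>D\<Phi>\<close> drops out because the velocity is orthogonal to
  \<open>x - p\<close>.\<close>

lemma velocity_invariant: "velocity (\<Phi> t x) = D\<Phi> t x (velocity x)"
  unfolding velocity_def \<Phi>_profile D\<Phi>_def by (simp add: \<Phi>_minus rot_J del: rot_simps(2) J_simps(2))

lemma Ck_radius: "Ck_on k UNIV (\<lambda>x. R\<^sup>2 - (x - p) \<bullet> (x - p))"
  unfolding inner_vec_def inner_real_def vector_minus_component
  by (intro Ck_diff Ck_sum Ck_mult Ck_component Ck_const)

lemma Ck_profile: "Ck_on k UNIV profile"
  unfolding profile_def[abs_def] by (intro Ck_flat Ck_radius)

lemma Ck_slope: "Ck_on k UNIV slope"
  unfolding slope_def[abs_def] by (intro Ck_mult Ck_const Ck_flat Ck_radius)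

lemma Ck_shift: "Ck_on k UNIV (\<lambda>x. (x - p) $ l)"
  unfolding vector_minus_component by (intro Ck_diff Ck_component Ck_const)

lemma Ck_J: "(\<And>l. Ck_on k UNIV (\<lambda>x. f x $ l)) \<Longrightarrow> Ck_on k UNIV (\<lambda>x. J (f x) $ l)"
  using Ck_mult[OF Ck_const[of k "-1"], of "\<lambda>x. f x $ j"]
  unfolding J_component by (cases "l = j"; cases "l = i") (auto intro: Ck_const)

lemma Ck_\<Phi>: "Ck_on k UNIV (\<lambda>x. \<Phi> t x $ l)"
  unfolding \<Phi>_def rot_def vector_add_component scaleR_component_real
  by (intro Ck_add Ck_mult Ck_diff Ck_const Ck_sin Ck_cos Ck_J Ck_shift Ck_profile)

lemma Ck_velocity: "Ck_on k UNIV (\<lambda>x. velocity x $ l)"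
  unfolding velocity_def scaleR_component_real by (intro Ck_mult Ck_profile Ck_J Ck_shift)

lemma test_\<Phi>:
  assumes S: "cball p R \<subseteq> S" and \<phi>: "\<phi> \<in> test_functions S"
  shows "(\<lambda>x. \<phi> (\<Phi> t x)) \<in> test_functions S"
proof -
  obtain K where K: "compact K" "K \<subseteq> S" "\<And>x. x \<notin> K \<Longrightarrow> \<phi> x = 0" using \<phi> unfolding test_functions_iff by blast
  \<comment> \<open>The support can be moved only inside the closed ball, since
    \<open>\<Phi> t\<close> is the identity elsewhere.\<close>
  have "\<phi> (\<Phi> t x) = 0" if "x \<notin> K \<union> cball p R" for x
    using that K(3) \<Phi>_outside[of x t] by auto
  moreover have "Ck_on k UNIV (\<lambda>x. \<phi> (\<Phi> t x))" for k
    by (rule Ck_compose[OF \<Phi>_derivative test_Ck[OF \<phi>] Ck_\<Phi>])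
  ultimately show ?thesis
    unfolding test_functions_iff smooth_on_def using K S by (intro conjI exI[of _ "K \<union> cball p R"]) auto
qed

section \<open>Preservation of Lebesgue measure by the flow\<close>

lemma velocity_divergence: "(\<Sum>k\<in>UNIV. pderiv_at k (\<lambda>x. velocity x $ k) x) = 0"
proof -
  have D: "((\<lambda>x. velocity x $ k) has_derivative
      (\<lambda>h. (slope x * ((x - p) \<bullet> h)) * J (x - p) $ k + profile x * J h $ k)) (at x)" for k
  proof -
    have "((\<lambda>x. J (x - p) $ k) has_derivative (\<lambda>h. J (h - 0) $ k)) (at x)"
      by (intro bounded_linear.has_derivative[OF bounded_linear_vec_nth]
          bounded_linear.has_derivative[OF bounded_linear_J] derivative_intros)
    from has_derivative_mult[OF profile_derivative this] show ?thesis
      unfolding velocity_def scaleR_component_real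
      by (rule has_derivative_eq_rhs) (simp add: fun_eq_iff del: J_simps)
  qed
  \<comment> \<open>The divergence consists of \<open>profile\<close> times the trace of
    \<open>J\<close> and \<open>slope\<close> times \<open>(x - p) \<bullet> J (x - p)\<close>;
    skewness kills both.\<close>
  have "J (axis k 1) $ k = 0" for k using ij by (auto simp: J_component axis_def)
  then have "(\<Sum>k\<in>UNIV. pderiv_at k (\<lambda>x. velocity x $ k) x) = (\<Sum>k\<in>UNIV. slope x * ((x - p) $ k * J (x - p) $ k))"
    by (intro sum.cong refl) (simp add: pderiv_at_eq[OF D] inner_axis del: J_simps)
  also have "\<dots> = slope x * ((x - p) \<bullet> J (x - p))"
    unfolding sum_distrib_left[symmetric] by (simp only: inner_vec_def inner_real_def)
  finally show ?thesis by (simp del: J_simps)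
qed

text \<open>The integrand is the divergence of \<open>\<phi>\<close> times the velocity, a sum of
  partial derivatives of test functions.\<close>

lemma integral_velocity:
  assumes \<phi>: "\<phi> \<in> test_functions UNIV"
  shows "(LINT x|lborel. grad \<phi> x \<bullet> velocity x) = 0"
proof -
  have t: "(\<lambda>x. velocity x $ k * \<phi> x) \<in> test_functions UNIV" for k
    by (intro test_mult \<phi> Ck_velocity)
  have d: "(\<lambda>x. velocity x $ k) differentiable (at x)" for k x
    using Ck_velocity[of "Suc 0" k] by simp
  have "(\<Sum>k\<in>UNIV. pderiv_at k (\<lambda>x. velocity x $ k * \<phi> x) x) = grad \<phi> x \<bullet> velocity x" for x
  proof -
    have "(\<Sum>k\<in>UNIV. pderiv_at k (\<lambda>x. velocity x $ k * \<phi> x) x) =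
        (\<Sum>k\<in>UNIV. velocity x $ k * pderiv_at k \<phi> x) + (\<Sum>k\<in>UNIV. pderiv_at k (\<lambda>x. velocity x $ k) x) * \<phi> x"
      by (simp add: pderiv_mult[OF d test_differentiable[OF \<phi>]] sum.distrib sum_distrib_right)
    then show ?thesis by (simp add: velocity_divergence inner_vec_def grad_def mult.commute)
  qed
  then have "(LINT x|lborel. grad \<phi> x \<bullet> velocity x) = (LINT x|lborel. (\<Sum>k\<in>UNIV. pderiv_at k (\<lambda>x. velocity x $ k * \<phi> x) x))"
    by simp
  also have "\<dots> = (\<Sum>k\<in>UNIV. LINT x|lborel. pderiv_at k (\<lambda>x. velocity x $ k * \<phi> x) x)"
    by (intro Bochner_Integration.integral_sum test_integrable[OF test_pderiv[OF t]])
  also have "\<dots> = 0" by (simp add: integral_pderiv_test[OF t])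
  finally show ?thesis .
qed

text \<open>The derivative in time of the integral of \<open>\<phi> \<circ> \<Phi> t\<close> is the integral of
  \<open>grad (\<phi> \<circ> \<Phi> t) \<bullet> velocity\<close>, which vanishes because the velocity is divergence free.\<close>

lemma integral_\<Phi>_test:
  assumes \<phi>: "\<phi> \<in> test_functions UNIV"
  shows "(LINT x|lborel. \<phi> (\<Phi> t x)) = (LINT x|lborel. \<phi> x)"
proof -
  let ?G = "\<lambda>x. grad \<phi> x \<bullet> velocity x"
  have \<phi>t: "(\<lambda>x. \<phi> (\<Phi> t x)) \<in> test_functions UNIV" for t by (rule test_\<Phi>[OF subset_UNIV \<phi>])
  \<comment> \<open>The chain rule and \<open>velocity_invariant\<close> move the flow from the
    evaluation point into the test function.\<close>
  have grad_\<phi>t: "grad (\<lambda>x. \<phi> (\<Phi> t x)) x \<bullet> velocity x = ?G (\<Phi> t x)" for t x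
  proof -
    have "((\<lambda>x. \<phi> (\<Phi> t x)) has_derivative (\<lambda>h. grad \<phi> (\<Phi> t x) \<bullet> D\<Phi> t x h)) (at x)"
      by (rule has_derivative_compose[OF \<Phi>_derivative test_has_derivative[OF \<phi>]])
    then have "(\<lambda>h. grad (\<lambda>x. \<phi> (\<Phi> t x)) x \<bullet> h) = (\<lambda>h. grad \<phi> (\<Phi> t x) \<bullet> D\<Phi> t x h)"
      by (rule has_derivative_unique[OF test_has_derivative[OF \<phi>t]])
    then show ?thesis unfolding velocity_invariant by meson
  qed
  obtain K where K: "compact K" "\<And>x. x \<notin> K \<Longrightarrow> \<phi> x = 0" using \<phi> unfolding test_functions_iff by blast
  have cG: "continuous_on UNIV ?G"
    unfolding inner_vec_def inner_real_def grad_def vec_lambda_beta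
  proof (intro continuous_on_sum continuous_on_mult test_continuous[OF test_pderiv[OF \<phi>]])
    show "continuous_on UNIV (\<lambda>x. velocity x $ k)" for k using Ck_velocity[of 0 k] by simp
  qed
  have G: "?G x = 0" if "x \<notin> K" for x
  proof -
    have "(\<phi> has_derivative (\<lambda>h. 0)) (at x)"
      by (rule has_derivative_transform_within_open[where s="- K" and f="\<lambda>x. 0"])
        (use K that in \<open>auto intro: compact_imp_closed\<close>)
    then have "grad \<phi> x = 0" by (intro gradI) simp
    then show ?thesis by simp
  qed
  have "bounded (?G ` K)"
    by (intro compact_imp_bounded compact_continuous_image continuous_on_subset[OF cG] K) auto
  then obtain B where B: "\<And>x. x \<in> K \<Longrightarrow> \<bar>?G x\<bar> \<le> B" by (auto simp: bounded_iff)
  obtain \<rho> where \<rho>: "\<And>x. x \<in> K \<Longrightarrow> dist p x \<le> \<rho>"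
    using compact_imp_bounded[OF K(1)] unfolding bounded_any_center[of _ p] by auto
  have c\<Phi>: "continuous_on UNIV (\<Phi> t)" for t
    by (meson \<Phi>_derivative has_derivative_continuous continuous_at_imp_continuous_on)
  have "((\<lambda>t. LINT x|lborel. \<phi> (\<Phi> t x)) has_real_derivative (LINT x|lborel. ?G (\<Phi> t x))) (at t)" for t
  \<comment> \<open>The flow preserves distances from \<open>p\<close>, so one ball around
    \<open>p\<close> contains the preimages of \<open>K\<close> for all times.\<close>
  proof (rule has_derivative_integral_parameter[where w="\<lambda>x. \<bar>B\<bar> * indicator (cball p \<rho>) x"])
    show "integrable lborel (\<lambda>x. \<phi> (\<Phi> t x))" for t by (rule test_integrable[OF \<phi>t])
    show "((\<lambda>t. \<phi> (\<Phi> t x)) has_real_derivative ?G (\<Phi> t x)) (at t)" for t x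
      using has_derivative_compose[OF \<Phi>_time_derivative[unfolded has_vector_derivative_def] test_has_derivative[OF \<phi>]]
      unfolding has_field_derivative_def by (rule has_derivative_eq_rhs) (auto simp: fun_eq_iff)
    show "(\<lambda>x. ?G (\<Phi> t x)) \<in> borel_measurable lborel" for t
      using continuous_on_compose2[OF cG c\<Phi>] by (simp add: borel_measurable_continuous_onI)
    show "\<bar>?G (\<Phi> s x)\<bar> \<le> \<bar>B\<bar> * indicator (cball p \<rho>) x" for s x
    proof (cases "\<Phi> s x \<in> K")
      case True
      have "dist p x \<le> \<rho>" using \<rho>[OF True] \<Phi>_norm[of s x] by (simp add: dist_norm norm_minus_commute)
      then show ?thesis using B[OF True] by simp
    qed (simp add: G)
    show "integrable lborel (\<lambda>x. \<bar>B\<bar> * indicator (cball p \<rho>) x :: real)"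
      using emeasure_bounded_finite[of "cball p \<rho>"] by (intro integrable_mult_right integrable_real_indicator) auto
  qed
  moreover have "(LINT x|lborel. ?G (\<Phi> t x)) = 0" for t
    unfolding grad_\<phi>t[symmetric] by (rule integral_velocity[OF \<phi>t])
  ultimately have "((\<lambda>t. LINT x|lborel. \<phi> (\<Phi> t x)) has_real_derivative 0) (at t)" for t by simp
  from DERIV_isconst_all[of "\<lambda>t. LINT x|lborel. \<phi> (\<Phi> t x)" t 0] this show ?thesis by simp
qed

lemma \<Phi>_measurable [measurable]: "\<Phi> t \<in> borel \<rightarrow>\<^sub>M borel"
  by (meson \<Phi>_derivative has_derivative_continuous continuous_at_imp_continuous_on borel_measurable_continuous_onI)

text \<open>Preserved integrals of \<open>box_bump\<close> pass to indicators of boxes by dominated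
  convergence, and the measures of boxes determine \<open>lborel\<close>.\<close>

lemma \<Phi>_lborel: "distr lborel borel (\<Phi> t) = lborel"
proof (rule lborel_eqI[symmetric])
  fix l u :: "real^'n" assume lu: "\<And>b. b \<in> Basis \<Longrightarrow> l \<bullet> b \<le> u \<bullet> b"
  let ?b = "\<lambda>m. box_bump l u (Suc m)"
  have test: "?b m \<in> test_functions UNIV" for m by (rule test_mono[OF box_bump_test]) auto
  have bump: "\<bar>box_bump l u m x\<bar> \<le> indicator (box l u) x" for m x
    using box_bump_bounds[of l u m x] box_bump_eq_0[of x l u m] by (auto simp: indicator_def)
  obtain \<rho> where \<rho>: "\<And>x. x \<in> box l u \<Longrightarrow> dist p x \<le> \<rho>"
    using bounded_box[of l u] unfolding bounded_any_center[of _ p] by auto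
  \<comment> \<open>Boundedness of the preimage makes its measure finite and its indicator an
    integrable dominating function.\<close>
  have sub: "\<Phi> t -` box l u \<subseteq> cball p \<rho>"
  proof
    fix x assume "x \<in> \<Phi> t -` box l u"
    then have "dist p (\<Phi> t x) \<le> \<rho>" using \<rho> by simp
    then show "x \<in> cball p \<rho>" using \<Phi>_norm[of t x] by (simp add: dist_norm norm_minus_commute)
  qed
  have pre: "\<Phi> t -` box l u \<in> sets borel" using measurable_sets[OF \<Phi>_measurable, of "box l u" t] by simp
  have fin: "emeasure lborel (\<Phi> t -` box l u) < \<infinity>"
    using emeasure_bounded_finite[OF bounded_subset[OF bounded_cball sub]] .
  have ind: "(\<lambda>x. indicator (box l u) (\<Phi> t x)) = (indicator (\<Phi> t -` box l u) :: _ \<Rightarrow> real)"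
    by (auto simp: indicator_def)
  have "(\<lambda>m. LINT x|lborel. ?b m (\<Phi> t x)) \<longlonglongrightarrow> (LINT x|lborel. indicator (box l u) (\<Phi> t x))"
  proof (rule integral_dominated_convergence)
    show "integrable lborel (\<lambda>x. indicator (box l u) (\<Phi> t x) :: real)"
      unfolding ind using pre fin by (intro integrable_real_indicator) auto
    show "AE x in lborel. (\<lambda>m. ?b m (\<Phi> t x)) \<longlonglongrightarrow> indicator (box l u) (\<Phi> t x)"
      by (intro AE_I2 LIMSEQ_Suc[OF box_bump_tendsto])
    show "AE x in lborel. norm (?b m (\<Phi> t x)) \<le> indicator (box l u) (\<Phi> t x)" for m
      using bump by simp
  qed measurable
  moreover have "(\<lambda>m. LINT x|lborel. ?b m x) \<longlonglongrightarrow> (LINT x|lborel. indicator (box l u) x)"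
  proof (rule integral_dominated_convergence)
    show "integrable lborel (indicator (box l u) :: _ \<Rightarrow> real)"
      using emeasure_bounded_finite[OF bounded_box] by (intro integrable_real_indicator) auto
    show "AE x in lborel. (\<lambda>m. ?b m x) \<longlonglongrightarrow> indicator (box l u) x"
      by (intro AE_I2 LIMSEQ_Suc[OF box_bump_tendsto])
    show "AE x in lborel. norm (?b m x) \<le> indicator (box l u) x" for m
      using bump by simp
  qed measurable
  ultimately have "(LINT x|lborel. indicator (box l u) (\<Phi> t x) :: real) = (LINT x|lborel. indicator (box l u) x)"
    unfolding integral_\<Phi>_test[OF test] by (rule LIMSEQ_unique)
  then have "measure lborel (\<Phi> t -` box l u) = measure lborel (box l u)"
    unfolding ind by simp
  then have "emeasure lborel (\<Phi> t -` box l u) = emeasure lborel (box l u)"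
    using fin emeasure_bounded_finite[OF bounded_box[of l u]]
    by (simp add: emeasure_eq_ennreal_measure)
  then show "emeasure (distr lborel borel (\<Phi> t)) (box l u) = (\<Prod>b\<in>Basis. (u - l) \<bullet> b)"
    using lu by (simp add: emeasure_distr emeasure_lborel_box)
qed simp

lemma \<Phi>_lebesgue:
  "\<Phi> t \<in> lebesgue \<rightarrow>\<^sub>M lebesgue" "distr lebesgue lebesgue (\<Phi> t) = lebesgue"
proof -
  have m: "\<Phi> t \<in> lborel \<rightarrow>\<^sub>M lborel" by simp
  have d: "distr lborel lborel (\<Phi> t) = lborel"
    using \<Phi>_lborel[of t] by (metis distr_cong sets_lborel)
  have m': "\<Phi> t \<in> lebesgue \<rightarrow>\<^sub>M lborel" using measurable_completion[OF m] .
  have d': "distr lebesgue lborel (\<Phi> t) = lborel" using distr_completion[OF m] d by simp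
  show "\<Phi> t \<in> lebesgue \<rightarrow>\<^sub>M lebesgue"
    by (rule completion.measurable_completion2[OF m']) (simp add: d')
  show "distr lebesgue lebesgue (\<Phi> t) = lebesgue"
    using completion.completion_distr_eq[OF m'] by (simp add: d')
qed

text \<open>\<open>\<Phi> t\<close> maps the ball to itself and fixes all other points, so
  \<open>S\<close> is its own preimage.\<close>

lemma \<Phi>_lebesgue_on:
  assumes "open S" "cball p R \<subseteq> S"
  shows "\<Phi> t \<in> lebesgue_on S \<rightarrow>\<^sub>M lebesgue_on S" "distr (lebesgue_on S) (lebesgue_on S) (\<Phi> t) = lebesgue_on S"
proof -
  have maps: "\<Phi> t x \<in> S \<longleftrightarrow> x \<in> S" for x t
  proof (cases "x \<in> ball p R")
    case True
    then have "\<Phi> t x \<in> ball p R" using \<Phi>_norm[of t x] by (simp add: dist_norm norm_minus_commute)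
    then show ?thesis using True assms by (meson ball_subset_cball subsetD)
  qed (simp add: \<Phi>_outside)
  show m: "\<Phi> t \<in> lebesgue_on S \<rightarrow>\<^sub>M lebesgue_on S"
    by (rule measurable_restrict_space3[OF \<Phi>_lebesgue(1)]) (use maps in auto)
  show "distr (lebesgue_on S) (lebesgue_on S) (\<Phi> t) = lebesgue_on S"
  proof (rule measure_eqI)
    fix A assume "A \<in> sets (distr (lebesgue_on S) (lebesgue_on S) (\<Phi> t))"
    then have A: "A \<in> sets (lebesgue_on S)" by simp
    then have AS: "A \<subseteq> S" "A \<in> sets lebesgue" using assms by (auto simp: sets_restrict_space_iff)
    have pre: "\<Phi> t -` A \<inter> space (lebesgue_on S) = \<Phi> t -` A" using maps AS by (auto simp: space_restrict_space)
    have "emeasure (distr (lebesgue_on S) (lebesgue_on S) (\<Phi> t)) A = emeasure (lebesgue_on S) (\<Phi> t -` A)"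
      using emeasure_distr[OF m A] pre by simp
    also have "\<dots> = emeasure lebesgue (\<Phi> t -` A)"
      using maps AS assms by (intro emeasure_restrict_space) auto
    also have "\<dots> = emeasure (distr lebesgue lebesgue (\<Phi> t)) A"
      using emeasure_distr[OF \<Phi>_lebesgue(1) AS(2)] by simp
    also have "\<dots> = emeasure (lebesgue_on S) A"
      unfolding \<Phi>_lebesgue(2) using AS assms by (intro emeasure_restrict_space[symmetric]) auto
    finally show "emeasure (distr (lebesgue_on S) (lebesgue_on S) (\<Phi> t)) A = emeasure (lebesgue_on S) A" .
  qed simp
qed

end

section \<open>The transported coefficient\<close>

lemma bounded_coeff_continuous:
  fixes a :: "real^'n::finite \<Rightarrow> real^'n^'n"
  assumes \<Omega>: "bounded \<Omega>" and a: "\<And>k l. continuous_on UNIV (\<lambda>x. a x $ k $ l)"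
  shows "bounded_coeff \<Omega> a"
proof -
  have "\<exists>C. \<forall>x\<in>\<Omega>. \<bar>a x $ k $ l\<bar> \<le> C" for k l
  proof -
    have "bounded ((\<lambda>x. a x $ k $ l) ` closure \<Omega>)"
      using \<Omega> by (intro compact_imp_bounded compact_continuous_image continuous_on_subset[OF a]) auto
    then show ?thesis using closure_subset[of \<Omega>] by (auto simp: bounded_iff)
  qed
  then obtain C where C: "\<And>k l x. x \<in> \<Omega> \<Longrightarrow> \<bar>a x $ k $ l\<bar> \<le> C k l" by metis
  have "\<bar>a x $ k $ l\<bar> \<le> (\<Sum>k\<in>UNIV. \<Sum>l\<in>UNIV. \<bar>C k l\<bar>)" if "x \<in> \<Omega>" for x k l
  proof -
    have "\<bar>a x $ k $ l\<bar> \<le> \<bar>C k l\<bar>" using C[OF that, of k l] by linarith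
    also have "\<dots> \<le> (\<Sum>l\<in>UNIV. \<bar>C k l\<bar>)" by (rule member_le_sum) auto
    also have "\<dots> \<le> (\<Sum>k\<in>UNIV. \<Sum>l\<in>UNIV. \<bar>C k l\<bar>)"
      by (rule member_le_sum[of k UNIV "\<lambda>k. \<Sum>l\<in>UNIV. \<bar>C k l\<bar>"]) (auto intro: sum_nonneg)
    finally show ?thesis .
  qed
  moreover have "(\<lambda>x. a x $ k $ l) \<in> borel_measurable (lebesgue_on \<Omega>)" for k l
    using borel_measurable_continuous_onI[OF a] by (intro measurable_restrict_space1 measurable_completion) simp
  ultimately show ?thesis unfolding bounded_coeff_def by blast
qed

lemma norm_matrix_le_sum: "norm A \<le> (\<Sum>k\<in>UNIV. \<Sum>l\<in>UNIV. \<bar>A $ k $ l\<bar>)" for A :: "real^'n::finite^'m::finite"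
proof -
  have "norm A \<le> (\<Sum>k\<in>UNIV. norm (A $ k))"
    unfolding norm_vec_def by (rule L2_set_le_sum) simp
  also have "\<dots> \<le> (\<Sum>k\<in>UNIV. \<Sum>l\<in>UNIV. \<bar>A $ k $ l\<bar>)" by (intro sum_mono norm_le_l1_cart)
  finally show ?thesis .
qed

lemma quadratic_form_le_sum:
  fixes A :: "real^'n::finite^'n"
  shows "\<bar>\<xi> \<bullet> (A *v \<xi>)\<bar> \<le> (\<Sum>k\<in>UNIV. \<Sum>l\<in>UNIV. \<bar>A $ k $ l\<bar>) * (norm \<xi>)\<^sup>2"
proof -
  have "\<bar>\<xi> \<bullet> (A *v \<xi>)\<bar> = \<bar>\<Sum>k\<in>UNIV. \<Sum>l\<in>UNIV. \<xi> $ k * (A $ k $ l * \<xi> $ l)\<bar>"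
    by (simp add: inner_vec_def matrix_vector_mult_def sum_distrib_left)
  also have "\<dots> \<le> (\<Sum>k\<in>UNIV. \<bar>\<Sum>l\<in>UNIV. \<xi> $ k * (A $ k $ l * \<xi> $ l)\<bar>)" by (rule sum_abs)
  also have "\<dots> \<le> (\<Sum>k\<in>UNIV. \<Sum>l\<in>UNIV. \<bar>\<xi> $ k * (A $ k $ l * \<xi> $ l)\<bar>)" by (intro sum_mono sum_abs)
  also have "\<dots> \<le> (\<Sum>k\<in>UNIV. \<Sum>l\<in>UNIV. \<bar>A $ k $ l\<bar> * (norm \<xi>)\<^sup>2)"
  proof (intro sum_mono)
    fix k l
    have "\<bar>\<xi> $ k\<bar> * \<bar>\<xi> $ l\<bar> \<le> norm \<xi> * norm \<xi>"
      by (intro mult_mono component_le_norm_cart) auto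
    then have "\<bar>A $ k $ l\<bar> * (\<bar>\<xi> $ k\<bar> * \<bar>\<xi> $ l\<bar>) \<le> \<bar>A $ k $ l\<bar> * (norm \<xi> * norm \<xi>)"
      by (rule mult_left_mono) simp
    then show "\<bar>\<xi> $ k * (A $ k $ l * \<xi> $ l)\<bar> \<le> \<bar>A $ k $ l\<bar> * (norm \<xi>)\<^sup>2"
      by (simp add: abs_mult power2_eq_square mult.left_commute)
  qed
  finally show ?thesis by (simp add: sum_distrib_right)
qed

lemma matrix_differentiable:
  fixes F :: "real^'n::finite \<Rightarrow> real^'n^'n"
  assumes "\<And>k l. (\<lambda>x. F x $ k $ l) differentiable (at x)"
  shows "F differentiable (at x)"
proof (rule differentiable_componentwise_within[THEN iffD2], rule ballI)
  fix u :: "real^'n^'n" assume "u \<in> Basis"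
  then obtain k l where "u = axis k (axis l 1)" by (auto simp: Basis_vec_def)
  then show "(\<lambda>x. F x \<bullet> u) differentiable (at x)" using assms by (simp add: inner_axis)
qed

lemma pderiv_matrix_component:
  fixes F :: "real^'n::finite \<Rightarrow> real^'n^'n"
  assumes "F differentiable (at x)"
  shows "pderiv_at m F x $ k $ l = pderiv_at m (\<lambda>x. F x $ k $ l) x"
proof -
  obtain D where D: "(F has_derivative D) (at x)" using assms by (auto simp: differentiable_def)
  have "((\<lambda>x. F x $ k $ l) has_derivative (\<lambda>h. D h $ k $ l)) (at x)"
    by (intro bounded_linear.has_derivative[OF bounded_linear_vec_nth] D)
  then show ?thesis by (simp add: pderiv_at_eq[OF D] pderiv_at_eq)
qed

lemma matrix_Ck_1:
  fixes F :: "real^'n::finite \<Rightarrow> real^'n^'n"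
  assumes "\<And>k l. Ck_on 1 UNIV (\<lambda>x. F x $ k $ l)"
  shows "Ck_on 1 U F"
proof -
  have d: "F differentiable (at x)" for x
    using assms by (intro matrix_differentiable) simp
  have "pderiv_at m F = (\<lambda>x. \<chi> k l. pderiv_at m (\<lambda>x. F x $ k $ l) x)" for m
    by (simp add: fun_eq_iff vec_eq_iff pderiv_matrix_component[OF d])
  moreover have "continuous_on UNIV (pderiv_at m (\<lambda>x. F x $ k $ l))" for m k l
    using assms[of k l] by simp
  then have "continuous_on U (\<lambda>x. \<chi> k l. pderiv_at m (\<lambda>x. F x $ k $ l) x)" for m
    by (intro continuous_on_vec_lambda) (rule continuous_on_subset[OF _ subset_UNIV])
  ultimately show ?thesis using d by simp
qed

text \<open>The Frobenius norm is at most the sum of the \<open>CARD('n)\<close> squared entries'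
  absolute values; the factor \<open>1 + CARD('n)\<close> counts the field and its partial
  derivatives.\<close>

lemma C1_norm_le:
  fixes F :: "real^'n::finite \<Rightarrow> real^'n^'n"
  assumes d: "\<And>x k l. (\<lambda>x. F x $ k $ l) differentiable (at x)" and c: "0 \<le> c"
    and F: "\<And>x k l. \<bar>F x $ k $ l\<bar> \<le> c" and dF: "\<And>m x k l. \<bar>pderiv_at m (\<lambda>x. F x $ k $ l) x\<bar> \<le> c"
  shows "C1_norm U F \<le> ennreal ((1 + real CARD('n)) * (real CARD('n) * real CARD('n) * c))"
proof -
  let ?M = "real CARD('n) * real CARD('n) * c"
  have M: "norm A \<le> ?M" if "\<And>k l. \<bar>A $ k $ l\<bar> \<le> c" for A :: "real^'n^'n"
  proof -
    have "norm A \<le> (\<Sum>k\<in>(UNIV :: 'n set). \<Sum>l\<in>(UNIV :: 'n set). c)"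
      using that by (intro order_trans[OF norm_matrix_le_sum] sum_mono)
    then show ?thesis by simp
  qed
  have "(SUP x\<in>U. ennreal (norm (F x))) \<le> ennreal ?M"
    by (intro SUP_least ennreal_leI M F)
  moreover have "(SUP x\<in>U. ennreal (norm (pderiv_at m F x))) \<le> ennreal ?M" for m
    by (intro SUP_least ennreal_leI M) (simp add: pderiv_matrix_component[OF matrix_differentiable[OF d]] dF)
  ultimately have "C1_norm U F \<le> ennreal ?M + (\<Sum>m\<in>(UNIV :: 'n set). ennreal ?M)"
    unfolding C1_norm_def by (intro add_mono sum_mono) auto
  also have "(\<Sum>m\<in>(UNIV :: 'n set). ennreal ?M) = ennreal (\<Sum>m\<in>(UNIV :: 'n set). ?M)"
    using c by (intro sum_ennreal) auto
  also have "ennreal ?M + ennreal (\<Sum>m\<in>(UNIV :: 'n set). ?M) = ennreal (?M + (\<Sum>m\<in>(UNIV :: 'n set). ?M))"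
    using c by (intro ennreal_plus[symmetric]) auto
  also have "?M + (\<Sum>m\<in>(UNIV :: 'n set). ?M) = (1 + real CARD('n)) * ?M"
    by (simp add: algebra_simps)
  finally show ?thesis .
qed

lemma test_family_bounded:
  fixes F :: "'i::finite \<Rightarrow> real^'n::finite \<Rightarrow> real"
  assumes "\<And>q. F q \<in> test_functions S"
  shows "\<exists>K\<ge>0. \<forall>q x. \<bar>F q x\<bar> \<le> K"
proof -
  have "\<forall>q. \<exists>B\<ge>0. \<forall>x. \<bar>F q x\<bar> \<le> B" using test_bounded[OF assms] by blast
  then obtain B where B: "\<And>q. B q \<ge> 0" "\<And>q x. \<bar>F q x\<bar> \<le> B q" by metis
  have "B q \<le> (\<Sum>q\<in>UNIV. B q)" for q
    by (rule member_le_sum) (use B in auto)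
  then have "\<bar>F q x\<bar> \<le> (\<Sum>q\<in>UNIV. B q)" for q x
    using B(2) order_trans by blast
  then show ?thesis using B by (intro exI[of _ "\<Sum>q\<in>UNIV. B q"]) (auto intro: sum_nonneg)
qed

section \<open>The push-forward of the identity under the swirl\<close>

context swirl
begin

text \<open>The adjoint of \<open>D\<Phi> t x\<close>: the rotation is inverted and the two vectors
  of the rank one term change places.\<close>

definition T :: "real \<Rightarrow> real^'n \<Rightarrow> real^'n^'n" where
  "T t x = matrix (\<lambda>\<xi>. rot (- (t * profile x)) \<xi> + (t * slope x * (J (\<Phi> t x - p) \<bullet> \<xi>)) *\<^sub>R (x - p))"

text \<open>With \<open>w = y - p\<close> and \<open>\<kappa> = t * slope y\<close> this is the matrix
  \<open>1 + \<kappa> (J w w\<^sup>T + w (J w)\<^sup>T) + \<kappa>\<^sup>2 |w|\<^sup>2 J w (J w)\<^sup>T\<close>, the push-forward of the identity under \<open>\<Phi> t\<close>.\<close>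

definition coeff1 :: "'n \<times> 'n \<Rightarrow> real^'n \<Rightarrow> real" where
  "coeff1 q y = slope y * (J (y - p) $ fst q * (y - p) $ snd q + (y - p) $ fst q * J (y - p) $ snd q)"

definition coeff2 :: "'n \<times> 'n \<Rightarrow> real^'n \<Rightarrow> real" where
  "coeff2 q y = slope y * slope y * ((y - p) \<bullet> (y - p)) * (J (y - p) $ fst q * J (y - p) $ snd q)"

definition coeff :: "real \<Rightarrow> real^'n \<Rightarrow> real^'n^'n" where
  "coeff t y = (\<chi> k l. (if k = l then 1 else 0) + (t * coeff1 (k, l) y + t\<^sup>2 * coeff2 (k, l) y))"

lemma T_mult: "T t x *v \<xi> = rot (- (t * profile x)) \<xi> + (t * slope x * (J (\<Phi> t x - p) \<bullet> \<xi>)) *\<^sub>R (x - p)"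
proof -
  have "linear (\<lambda>\<xi>. rot (- (t * profile x)) \<xi> + (t * slope x * (J (\<Phi> t x - p) \<bullet> \<xi>)) *\<^sub>R (x - p))"
    by (rule linearI)
      (simp_all only: rot_simps inner_add_right inner_scaleR_right scaleR_add_left scaleR_add_right distrib_left
        scaleR_scaleR mult.left_commute add_ac)
  then show ?thesis
    unfolding T_def by (intro matrix_works) (simp only: linear_matrix_vector_mul_eq)
qed

lemma grad_\<Phi>:
  assumes \<phi>: "\<phi> \<in> test_functions S"
  shows "grad (\<lambda>x. \<phi> (\<Phi> t x)) x = T t x *v grad \<phi> (\<Phi> t x)"
proof (rule gradI)
  have "((\<lambda>x. \<phi> (\<Phi> t x)) has_derivative (\<lambda>h. grad \<phi> (\<Phi> t x) \<bullet> D\<Phi> t x h)) (at x)"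
    by (rule has_derivative_compose[OF \<Phi>_derivative test_has_derivative[OF \<phi>]])
  moreover have "grad \<phi> (\<Phi> t x) \<bullet> D\<Phi> t x h = (T t x *v grad \<phi> (\<Phi> t x)) \<bullet> h" for h
    using rot_adjoint[of "- (t * profile x)" "grad \<phi> (\<Phi> t x)" h]
    by (simp add: T_mult D\<Phi>_def inner_add_left inner_add_right inner_commute[of "grad \<phi> (\<Phi> t x)" "J (\<Phi> t x - p)"] del: J_simps)
  ultimately show "((\<lambda>x. \<phi> (\<Phi> t x)) has_derivative (\<lambda>h. (T t x *v grad \<phi> (\<Phi> t x)) \<bullet> h)) (at x)" by simp
qed

lemma Ck_\<Phi>_shift: "Ck_on k UNIV (\<lambda>x. (\<Phi> t x - p) $ l)"
  unfolding vector_minus_component by (intro Ck_diff Ck_\<Phi> Ck_const)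

lemma Ck_T: "Ck_on k UNIV (\<lambda>x. T t x $ l $ m)"
proof -
  have eq: "T t x $ l $ m = axis m 1 $ l + sin (- t * profile x) * J (axis m 1) $ l
      + (1 - cos (- t * profile x)) * J (J (axis m 1)) $ l
      + (t * slope x * (\<Sum>q\<in>UNIV. J (\<Phi> t x - p) $ q * axis m 1 $ q)) * (x - p) $ l" for x
  proof -
    have "T t x $ l $ m = (T t x *v axis m 1) $ l" by (simp add: matrix_vector_mult_basis column_def)
    then show ?thesis
      unfolding T_mult rot_def
      by (simp only: vector_add_component scaleR_component_real inner_vec_def inner_real_def minus_mult_left)
  qed
  show ?thesis unfolding eq
    by (intro Ck_add Ck_mult Ck_diff Ck_sum Ck_const Ck_sin Ck_cos Ck_profile Ck_slope Ck_shift Ck_J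
        Ck_\<Phi>_shift)
qed

lemma transport_\<Phi>:
  assumes S: "open S" "bounded S" "cball p R \<subseteq> S"
  shows "transport S (\<Phi> t) (T t)"
proof
  show "open S" by fact
  show "\<Phi> t \<in> lebesgue_on S \<rightarrow>\<^sub>M lebesgue_on S" "distr (lebesgue_on S) (lebesgue_on S) (\<Phi> t) = lebesgue_on S"
    using \<Phi>_lebesgue_on[OF S(1,3)] by auto
  show "(\<lambda>x. \<phi> (\<Phi> t x)) \<in> test_functions S" if "\<phi> \<in> test_functions S" for \<phi>
    by (rule test_\<Phi>[OF S(3) that])
  show "grad (\<lambda>x. \<phi> (\<Phi> t x)) x = T t x *v grad \<phi> (\<Phi> t x)" if "\<phi> \<in> test_functions S" for \<phi> x
    by (rule grad_\<Phi>[OF that])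
  show "bounded_coeff S (T t)"
    using Ck_T[of 0] by (intro bounded_coeff_continuous S) simp
qed

lemma coeff_mult:
  "\<xi> \<bullet> (coeff t y *v \<zeta>) = \<xi> \<bullet> \<zeta>
    + t * slope y * ((J (y - p) \<bullet> \<xi>) * ((y - p) \<bullet> \<zeta>) + ((y - p) \<bullet> \<xi>) * (J (y - p) \<bullet> \<zeta>))
    + (t * slope y)\<^sup>2 * ((y - p) \<bullet> (y - p)) * ((J (y - p) \<bullet> \<xi>) * (J (y - p) \<bullet> \<zeta>))"
proof -
  define w v where "w = y - p" and "v = J (y - p)"
  have "coeff t y *v \<zeta> = \<zeta> + (t * slope y) *\<^sub>R ((w \<bullet> \<zeta>) *\<^sub>R v + (v \<bullet> \<zeta>) *\<^sub>R w)
      + ((t * slope y)\<^sup>2 * (w \<bullet> w) * (v \<bullet> \<zeta>)) *\<^sub>R v"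
  proof (rule vec_eq_iff[THEN iffD2], intro allI)
    fix k
    have "(coeff t y *v \<zeta>) $ k = (\<Sum>l\<in>UNIV. (if k = l then 1 else 0) * \<zeta> $ l
        + (t * slope y) * (v $ k * (w $ l * \<zeta> $ l) + w $ k * (v $ l * \<zeta> $ l))
        + ((t * slope y)\<^sup>2 * (w \<bullet> w) * v $ k) * (v $ l * \<zeta> $ l))"
      unfolding matrix_vector_mult_def coeff_def coeff1_def coeff2_def w_def v_def
      by (simp add: algebra_simps power2_eq_square del: J_simps vector_minus_component)
    also have "\<dots> = \<zeta> $ k + (t * slope y) * (v $ k * (w \<bullet> \<zeta>) + w $ k * (v \<bullet> \<zeta>))
        + ((t * slope y)\<^sup>2 * (w \<bullet> w) * v $ k) * (v \<bullet> \<zeta>)"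
    proof -
      have "(\<Sum>l\<in>UNIV. (if k = l then 1 else 0) * \<zeta> $ l) = (\<Sum>l\<in>UNIV. if l = k then \<zeta> $ l else 0)"
        by (intro sum.cong) auto
      then show ?thesis
        unfolding sum.distrib sum_distrib_left[symmetric]
        by (simp add: inner_vec_def[of w \<zeta>] inner_vec_def[of v \<zeta>])
    qed
    finally show "(coeff t y *v \<zeta>) $ k = (\<zeta> + (t * slope y) *\<^sub>R ((w \<bullet> \<zeta>) *\<^sub>R v + (v \<bullet> \<zeta>) *\<^sub>R w)
      + ((t * slope y)\<^sup>2 * (w \<bullet> w) * (v \<bullet> \<zeta>)) *\<^sub>R v) $ k"
      by (simp add: algebra_simps)
  qed
  then show ?thesis
    unfolding v_def[symmetric] unfolding w_def[symmetric]
    by (simp add: inner_add_right inner_commute[of \<xi> v] inner_commute[of \<xi> w] algebra_simps)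
qed

text \<open>With \<open>w = rot \<alpha> z\<close> the adjoint relation turns every product of
  \<open>z\<close> with a rotated vector into a product with \<open>w\<close>; the square of the
  rank one term contributes \<open>z \<bullet> z = w \<bullet> w\<close>.\<close>

lemma T_pullback: "(T t x *v \<xi>) \<bullet> (T t x *v \<zeta>) = \<xi> \<bullet> (coeff t (\<Phi> t x) *v \<zeta>)"
proof -
  define \<alpha> z w \<kappa> where "\<alpha> = t * profile x" and "z = x - p" and "w = \<Phi> t x - p" and "\<kappa> = t * slope x"
  have w: "w = rot \<alpha> z" unfolding w_def \<Phi>_minus \<alpha>_def z_def ..
  have zr: "z \<bullet> rot (- \<alpha>) \<eta> = w \<bullet> \<eta>" for \<eta> unfolding w by (rule rot_adjoint[symmetric])
  have rz: "rot (- \<alpha>) \<eta> \<bullet> z = w \<bullet> \<eta>" for \<eta> using zr by (simp add: inner_commute)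
  have ww: "w \<bullet> w = z \<bullet> z" unfolding w by simp
  show ?thesis
    unfolding T_mult coeff_mult \<Phi>_profile \<alpha>_def[symmetric] z_def[symmetric] w_def[symmetric] \<kappa>_def[symmetric]
    unfolding inner_add_left inner_add_right inner_scaleR_left inner_scaleR_right zr rz ww rot_inner
    by (simp add: power2_eq_square distrib_left mult_ac)
qed

text \<open>The transposed chain rule for \<open>\<Phi> (- t)\<close> after \<open>\<Phi> t\<close>.
  The rank one terms cancel since \<open>J\<close> commutes with rotations and \<open>J w\<close> is
  orthogonal to \<open>w\<close>.\<close>

lemma T_inverse: "T t x *v (T (- t) (\<Phi> t x) *v \<xi>) = \<xi>"
proof -
  define \<alpha> z w \<kappa> where "\<alpha> = t * profile x" and "z = x - p" and "w = \<Phi> t x - p" and "\<kappa> = t * slope x"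
  have w: "w = rot \<alpha> z" unfolding w_def \<Phi>_minus \<alpha>_def z_def ..
  have Jw: "J w \<bullet> rot \<alpha> \<xi> = J z \<bullet> \<xi>" unfolding w rot_J[symmetric] by simp
  have rw: "rot (- \<alpha>) w = z" unfolding w by (simp add: rot_add)
  have "\<Phi> (- t) (\<Phi> t x) - p = z" by (simp add: \<Phi>_add z_def)
  then have S: "T (- t) (\<Phi> t x) *v \<xi> = rot \<alpha> \<xi> - (\<kappa> * (J z \<bullet> \<xi>)) *\<^sub>R w"
    unfolding T_mult \<Phi>_profile w_def[symmetric] by (simp add: \<alpha>_def \<kappa>_def)
  have "T t x *v (rot \<alpha> \<xi> - (\<kappa> * (J z \<bullet> \<xi>)) *\<^sub>R w) = \<xi>"
    unfolding T_mult \<alpha>_def[symmetric] z_def[symmetric] w_def[symmetric] \<kappa>_def[symmetric]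
    by (simp add: rot_add rw inner_diff_right Jw)
  then show ?thesis unfolding S .
qed

text \<open>Follows from \<open>T_pullback\<close> at the preimage of \<open>y\<close>, where the
  two Jacobians are inverse to each other.\<close>

lemma T_pushforward: "(T (- t) y *v \<xi>) \<bullet> (coeff t y *v (T (- t) y *v \<zeta>)) = \<xi> \<bullet> \<zeta>"
proof -
  define x where "x = \<Phi> (- t) y"
  have y: "y = \<Phi> t x" by (simp add: x_def \<Phi>_add)
  have "(T (- t) y *v \<xi>) \<bullet> (coeff t y *v (T (- t) y *v \<zeta>)) =
      (T t x *v (T (- t) y *v \<xi>)) \<bullet> (T t x *v (T (- t) y *v \<zeta>))"
    unfolding T_pullback y[symmetric] ..
  then show ?thesis unfolding y T_inverse .
qed

lemma Ck_coeff1: "Ck_on k UNIV (coeff1 q)"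
  unfolding coeff1_def[abs_def] by (intro Ck_mult Ck_add Ck_slope Ck_shift Ck_J)

lemma Ck_coeff2: "Ck_on k UNIV (coeff2 q)"
  unfolding coeff2_def[abs_def] inner_vec_def inner_real_def
  by (intro Ck_mult Ck_sum Ck_slope Ck_shift Ck_J)

lemma test_coeff: "coeff1 q \<in> test_functions UNIV" "coeff2 q \<in> test_functions UNIV"
proof -
  have "x \<notin> cball p R \<Longrightarrow> slope x = 0" for x using outside(2)[of x] by auto
  then show "coeff1 q \<in> test_functions UNIV" "coeff2 q \<in> test_functions UNIV"
    unfolding test_functions_iff smooth_on_def
    by (auto intro!: exI[of _ "cball p R"] Ck_coeff1 Ck_coeff2 simp: coeff1_def coeff2_def)
qed

lemma coeff_component: "coeff t y $ k $ l = (if k = l then 1 else 0) + (t * coeff1 (k, l) y + t\<^sup>2 * coeff2 (k, l) y)"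
  by (simp add: coeff_def)

lemma Ck_coeff: "Ck_on m UNIV (\<lambda>y. coeff t y $ k $ l)"
  unfolding coeff_component by (intro Ck_add Ck_mult Ck_const Ck_coeff1 Ck_coeff2)

lemma coeff_symmetric: "transpose (coeff t y) = coeff t y"
  by (simp add: vec_eq_iff transpose_def coeff_component coeff1_def coeff2_def mult_ac add_ac)

lemma coeff_outside: "y \<notin> ball p R \<Longrightarrow> coeff t y = mat 1"
  by (simp add: vec_eq_iff coeff_component coeff1_def coeff2_def outside mat_def)

lemma coeff_0: "coeff 0 y = mat 1"
  by (simp add: vec_eq_iff coeff_component mat_def)

text \<open>\<open>coeff t - mat 1\<close> is a quadratic polynomial in \<open>t\<close> without
  constant term whose coefficients are test functions, hence bounded with their derivatives. The
  range \<open>{0..1}\<close> gives \<open>t\<^sup>2 \<le> t\<close>.\<close>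

lemma coeff_perturbation_bound:
  "\<exists>K\<ge>0. \<forall>t\<in>{0..1}. \<forall>k l m x. \<bar>(coeff t x - mat 1) $ k $ l\<bar> \<le> t * K \<and>
     \<bar>pderiv_at m (\<lambda>x. (coeff t x - mat 1) $ k $ l) x\<bar> \<le> t * K"
proof -
  obtain K1 where K1: "K1 \<ge> 0" "\<And>q x. \<bar>coeff1 q x\<bar> \<le> K1" using test_family_bounded[of coeff1, OF test_coeff(1)] by blast
  obtain K2 where K2: "K2 \<ge> 0" "\<And>q x. \<bar>coeff2 q x\<bar> \<le> K2" using test_family_bounded[of coeff2, OF test_coeff(2)] by blast
  obtain L1 where L1: "L1 \<ge> 0" "\<And>m q x. \<bar>pderiv_at m (coeff1 q) x\<bar> \<le> L1"
    using test_family_bounded[of "\<lambda>(m, q). pderiv_at m (coeff1 q)" UNIV] test_pderiv[OF test_coeff(1)] by fastforce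
  obtain L2 where L2: "L2 \<ge> 0" "\<And>m q x. \<bar>pderiv_at m (coeff2 q) x\<bar> \<le> L2"
    using test_family_bounded[of "\<lambda>(m, q). pderiv_at m (coeff2 q)" UNIV] test_pderiv[OF test_coeff(2)] by fastforce
  have lin: "\<bar>t * x + t\<^sup>2 * y\<bar> \<le> t * (a + b)" if "0 \<le> t" "t \<le> 1" "\<bar>x\<bar> \<le> a" "\<bar>y\<bar> \<le> b" for t x y a b :: real
  proof -
    have "\<bar>t * x + t\<^sup>2 * y\<bar> \<le> t * \<bar>x\<bar> + t * (t * \<bar>y\<bar>)"
      using that abs_triangle_ineq[of "t * x" "t\<^sup>2 * y"] by (simp add: abs_mult power2_eq_square mult.assoc)
    also have "t * \<bar>y\<bar> \<le> 1 * \<bar>y\<bar>" using that by (intro mult_right_mono) auto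
    then have "t * \<bar>x\<bar> + t * (t * \<bar>y\<bar>) \<le> t * a + t * b" using that by (intro add_mono mult_left_mono) auto
    finally show ?thesis by (simp add: distrib_left)
  qed
  have c: "(coeff t x - mat 1) $ k $ l = t * coeff1 (k, l) x + t\<^sup>2 * coeff2 (k, l) x" for t x k l
    by (simp add: coeff_component mat_def)
  have d: "pderiv_at m (\<lambda>x. (coeff t x - mat 1) $ k $ l) x = t * pderiv_at m (coeff1 (k, l)) x + t\<^sup>2 * pderiv_at m (coeff2 (k, l)) x" for t m k l x
  proof -
    have "grad (\<lambda>x. t * coeff1 (k, l) x + t\<^sup>2 * coeff2 (k, l) x) x = t *\<^sub>R grad (coeff1 (k, l)) x + t\<^sup>2 *\<^sub>R grad (coeff2 (k, l)) x"
      by (intro grad_lincomb test_differentiable[OF test_coeff(1)] test_differentiable[OF test_coeff(2)])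
    then have "grad (\<lambda>x. t * coeff1 (k, l) x + t\<^sup>2 * coeff2 (k, l) x) x $ m = (t *\<^sub>R grad (coeff1 (k, l)) x + t\<^sup>2 *\<^sub>R grad (coeff2 (k, l)) x) $ m"
      by simp
    then show ?thesis unfolding c by (simp add: grad_def)
  qed
  show ?thesis
  proof (intro exI[of _ "(K1 + K2) + (L1 + L2)"] conjI ballI allI)
    fix t :: real and k l m x assume t: "t \<in> {0..1}"
    have "t * (K1 + K2) \<le> t * ((K1 + K2) + (L1 + L2))" "t * (L1 + L2) \<le> t * ((K1 + K2) + (L1 + L2))"
      using t K1 K2 L1 L2 by (auto intro!: mult_left_mono)
    moreover have "\<bar>(coeff t x - mat 1) $ k $ l\<bar> \<le> t * (K1 + K2)"
      unfolding c using t K1 K2 by (intro lin) auto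
    moreover have "\<bar>pderiv_at m (\<lambda>x. (coeff t x - mat 1) $ k $ l) x\<bar> \<le> t * (L1 + L2)"
      unfolding d using t L1 L2 by (intro lin) auto
    ultimately show "\<bar>(coeff t x - mat 1) $ k $ l\<bar> \<le> t * ((K1 + K2) + (L1 + L2))"
      "\<bar>pderiv_at m (\<lambda>x. (coeff t x - mat 1) $ k $ l) x\<bar> \<le> t * ((K1 + K2) + (L1 + L2))"
      by linarith+
  qed (use K1 K2 L1 L2 in auto)
qed

text \<open>The interval includes 0, so the identity, which is \<open>coeff 0\<close>, is covered by
  the same argument.\<close>

lemma coeff_in_class:
  assumes A: "ball p R \<subseteq> A" and r0: "0 < r0" and \<theta>: "0 < \<theta>" "\<theta> < 1"
  shows "\<exists>t0>0. \<forall>t\<in>{0..t0}. coeff t \<in> coeff_class \<Omega> A r0 \<theta>"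
proof -
  let ?N = "real CARD('n)"
  obtain K where K: "K \<ge> 0"
    and b0: "\<And>t k l x. t \<in> {0..1} \<Longrightarrow> \<bar>(coeff t x - mat 1) $ k $ l\<bar> \<le> t * K"
    and b1: "\<And>t k l m x. t \<in> {0..1} \<Longrightarrow> \<bar>pderiv_at m (\<lambda>x. (coeff t x - mat 1) $ k $ l) x\<bar> \<le> t * K"
    using coeff_perturbation_bound by blast
  \<comment> \<open>\<open>t * M\<close> is the bound of \<open>C1_norm_le\<close> for entries at
    most \<open>t * K\<close>, and it also dominates the bound for the quadratic form.\<close>
  define M where "M = (1 + ?N) * (?N * ?N * K)"
  have M: "0 \<le> M" "?N * ?N * K \<le> M" using K by (auto simp: M_def distrib_right)
  \<comment> \<open>The cap 1 is the range of the perturbation bound; the other terms give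
    \<open>t * M \<le> r0\<close> and \<open>t * M \<le> 1 - \<theta>\<close>. The denominator
    \<open>M + 1\<close> stays positive even for \<open>M = 0\<close>.\<close>
  define t0 where "t0 = min 1 (min (r0 / (M + 1)) ((1 - \<theta>) / (M + 1)))"
  have t0: "0 < t0" using r0 \<theta> M by (simp add: t0_def)
  have "coeff t \<in> coeff_class \<Omega> A r0 \<theta>" if t: "t \<in> {0..t0}" for t
  proof -
    have t1: "t \<in> {0..1}" using t by (simp add: t0_def)
    have bd: "t * M \<le> c" if "t0 \<le> c / (M + 1)" "0 \<le> c" for c
    proof -
      have "t * M \<le> t * (M + 1)" using t by (simp add: distrib_left)
      also have "\<dots> \<le> c / (M + 1) * (M + 1)" using t that M by (intro mult_right_mono) auto
      finally show ?thesis using M by simp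
    qed
    have tr: "t * M \<le> r0" by (rule bd) (use r0 in \<open>auto simp: t0_def\<close>)
    have t\<theta>: "t * M \<le> 1 - \<theta>" by (rule bd) (use \<theta> in \<open>auto simp: t0_def\<close>)
    have "C1_norm \<Omega> (\<lambda>x. coeff t x - mat 1) \<le> ennreal ((1 + ?N) * (?N * ?N * (t * K)))"
    proof (rule C1_norm_le)
      fix x k l
      have "Ck_on (Suc 0) UNIV (\<lambda>x. coeff t x $ k $ l - mat 1 $ k $ l)" by (intro Ck_diff Ck_coeff Ck_const)
      then show "(\<lambda>x. (coeff t x - mat 1) $ k $ l) differentiable at x" by simp
    qed (use b0[OF t1] b1[OF t1] t1 K in auto)
    also have "\<dots> \<le> ennreal r0" using tr by (intro ennreal_leI) (simp add: M_def mult_ac)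
    finally have C1: "C1_norm \<Omega> (\<lambda>x. coeff t x - mat 1) \<le> ennreal r0" .
    have form: "\<bar>\<xi> \<bullet> (coeff t x *v \<xi>) - (norm \<xi>)\<^sup>2\<bar> \<le> (1 - \<theta>) * (norm \<xi>)\<^sup>2" for x \<xi>
    proof -
      have "\<xi> \<bullet> (coeff t x *v \<xi>) - (norm \<xi>)\<^sup>2 = \<xi> \<bullet> ((coeff t x - mat 1) *v \<xi>)"
        by (simp add: matrix_vector_mult_diff_rdistrib inner_diff_right power2_norm_eq_inner)
      also have "\<bar>\<dots>\<bar> \<le> (\<Sum>k\<in>UNIV. \<Sum>l\<in>UNIV. \<bar>(coeff t x - mat 1) $ k $ l\<bar>) * (norm \<xi>)\<^sup>2"
        by (rule quadratic_form_le_sum)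
      also have "\<dots> \<le> (\<Sum>k\<in>(UNIV :: 'n set). \<Sum>l\<in>(UNIV :: 'n set). t * K) * (norm \<xi>)\<^sup>2"
        by (intro mult_right_mono sum_mono b0[OF t1]) auto
      also have "\<dots> = t * (?N * ?N * K) * (norm \<xi>)\<^sup>2" by simp
      also have "\<dots> \<le> (1 - \<theta>) * (norm \<xi>)\<^sup>2"
      proof (rule mult_right_mono)
        have "t * (?N * ?N * K) \<le> t * M" using t M by (intro mult_left_mono) auto
        then show "t * (?N * ?N * K) \<le> 1 - \<theta>" using t\<theta> by simp
      qed simp
      finally show ?thesis .
    qed
    \<comment> \<open>A deviation of at most \<open>1 - \<theta>\<close> from the identity gives the
      lower bound at once; this inequality turns its upper counterpart \<open>2 - \<theta>\<close>
      into the required one.\<close>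
    have "2 - \<theta> \<le> inverse \<theta>"
    proof -
      have "(2 - \<theta>) * \<theta> \<le> 1" using zero_le_power2[of "1 - \<theta>"] by (simp add: power2_eq_square algebra_simps)
      then show ?thesis using \<theta> by (simp add: inverse_eq_divide pos_le_divide_eq)
    qed
    then have up: "(2 - \<theta>) * (norm \<xi>)\<^sup>2 \<le> inverse \<theta> * (norm \<xi>)\<^sup>2" for \<xi> :: "real^'n" by (rule mult_right_mono) simp
    have "\<theta> * (norm \<xi>)\<^sup>2 \<le> \<xi> \<bullet> (coeff t x *v \<xi>) \<and> \<xi> \<bullet> (coeff t x *v \<xi>) \<le> inverse \<theta> * (norm \<xi>)\<^sup>2" for x \<xi>
      using form[of \<xi> x] up[of \<xi>] unfolding abs_le_iff by (simp add: left_diff_distrib)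
    moreover have "Ck_on 1 \<Omega> (coeff t)" by (rule matrix_Ck_1[OF Ck_coeff])
    moreover have "coeff t x = mat 1" if "x \<in> \<Omega> - A" for x using that A by (intro coeff_outside) auto
    ultimately show ?thesis
      using C1 unfolding coeff_class_def mem_Collect_eq by (intro conjI) (auto simp: coeff_symmetric)
  qed
  then show ?thesis using t0 by blast
qed

lemma elliptic_coeff:
  assumes "coeff t \<in> coeff_class \<Omega> A r0 \<theta>" "0 < \<theta>" "bounded \<Omega>"
  shows "elliptic_coeff \<Omega> \<theta> (coeff t)"
proof -
  have "bounded_coeff \<Omega> (coeff t)"
    using Ck_coeff[of 0 t] by (intro bounded_coeff_continuous assms(3)) simp
  then show ?thesis using assms by (simp add: elliptic_coeff_def coeff_class_def)
qed

text \<open>A nonzero value of the continuous difference persists on a nonempty open set, which is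
  not negligible, so the essential supremum sees it.\<close>

lemma coeff_distance:
  assumes \<Omega>: "open \<Omega>" "ball p R \<subseteq> \<Omega>" and t: "0 < t"
  shows "\<exists>m>0. ereal m \<le> Linf_norm \<Omega> (\<lambda>x. mat 1 - coeff t x)"
proof -
  let ?f = "\<lambda>x. norm (mat 1 - coeff t x)"
  \<comment> \<open>At this point \<open>J (y - p)\<close> has no \<open>i\<close> component, so the
    quadratic part of the entry \<open>(i, j)\<close> vanishes while the linear part is
    \<open>slope y * (R / 2)\<^sup>2\<close>.\<close>
  define y where "y = p + (R / 2) *\<^sub>R axis i 1"
  have yp: "y - p = (R / 2) *\<^sub>R axis i 1" by (simp add: y_def)
  have in_ball: "y \<in> ball p R" using R by (simp add: dist_norm y_def norm_axis_1)
  have sl: "slope y \<noteq> 0"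
  proof -
    have "(y - p) \<bullet> (y - p) = (R / 2)\<^sup>2" by (simp add: yp inner_axis' power2_eq_square)
    moreover have "(R / 2)\<^sup>2 < R\<^sup>2" using R by (intro power_strict_mono) auto
    ultimately show ?thesis by (simp add: slope_def flat_def flat_deriv_def poly_monom pderiv_1)
  qed
  have yc: "J (y - p) $ i = 0" "J (y - p) $ j = R / 2" "(y - p) $ i = R / 2" "(y - p) $ j = 0"
    unfolding yp using ij by (auto simp: J_component axis_def)
  have "coeff1 (i, j) y \<noteq> 0" "coeff2 (i, j) y = 0"
    unfolding coeff1_def coeff2_def fst_conv snd_conv yc using sl R by simp_all
  then have "(mat 1 - coeff t y) $ i $ j \<noteq> 0"
    using ij sl R t by (simp add: coeff_component mat_def)
  then have "mat 1 - coeff t y \<noteq> 0" by (metis zero_index)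
  then have fy: "0 < ?f y" by simp
  \<comment> \<open>Half the value at \<open>y\<close> leaves room for a neighbourhood on which the
    norm stays above \<open>m\<close>.\<close>
  define m where "m = ?f y / 2"
  have m: "0 < m" "m < ?f y" using fy by (auto simp: m_def)
  have "coeff t = (\<lambda>x. \<chi> k l. coeff t x $ k $ l)" by simp
  moreover have "continuous_on UNIV (\<lambda>x. \<chi> k l. coeff t x $ k $ l)"
    using Ck_coeff[of 0 t] by (intro continuous_on_vec_lambda) simp
  ultimately have cont: "continuous_on UNIV ?f" by (intro continuous_intros) simp
  define U where "U = {x. m < ?f x} \<inter> \<Omega>"
  have "open {x. m < ?f x}" by (rule open_Collect_less[OF continuous_on_const cont])
  then have U: "open U" "y \<in> U" "U \<subseteq> \<Omega>" using \<Omega> in_ball m by (auto simp: U_def)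
  have "ereal m \<le> Linf_norm \<Omega> (\<lambda>x. mat 1 - coeff t x)"
  proof (rule ccontr)
    assume "\<not> ?thesis"
    then have less: "Linf_norm \<Omega> (\<lambda>x. mat 1 - coeff t x) < ereal m" by simp
    have "AE x in lebesgue_on \<Omega>. ereal (?f x) \<le> Linf_norm \<Omega> (\<lambda>x. mat 1 - coeff t x)"
      unfolding Linf_norm_def by (rule esssup_AE)
    then have "AE x in lebesgue_on \<Omega>. x \<notin> U"
    proof eventually_elim
      case (elim x)
      then have "ereal (?f x) < ereal m" using less by (rule order_le_less_trans)
      then show ?case by (simp add: U_def)
    qed
    then have "AE x in lebesgue. x \<notin> U"
      using \<Omega> U by (subst (asm) AE_restrict_space_iff) (auto elim!: eventually_mono)
    then have "U \<in> null_sets lebesgue" using U by (subst AE_iff_null_sets) auto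
    then show False using open_not_negligible[of U] U by (auto simp: negligible_iff_null_sets)
  qed
  then show ?thesis using m by blast
qed

end

text \<open>With a single coordinate, \<Omega> has points beyond both extremes of the compact
  \<open>closure A\<close>. A connected complement would contain the whole interval between them,
  including the maximum of \<open>closure A\<close>.\<close>

lemma exists_two_directions:
  fixes \<Omega> A :: "(real^'n::finite) set"
  assumes \<Omega>: "open \<Omega>" and A: "A \<noteq> {}" "A \<Subset> \<Omega>" and conn: "connected (\<Omega> - closure A)"
  shows "\<exists>i j :: 'n. i \<noteq> j"
proof (rule ccontr)
  assume no: "\<not> ?thesis"
  define i :: 'n where "i = undefined"
  have i: "k = i" for k using no by blast
  have eqI: "x = y" if "x $ i = y $ i" for x y :: "real^'n"
    using that i by (metis vec_eq_iff)
  have cA: "compact (closure A)" "closure A \<subseteq> \<Omega>" using A by (auto simp: compactly_contained_def)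
  have ne: "closure A \<noteq> {}" using A by simp
  have cont: "continuous_on (closure A) (\<lambda>x. x $ i)" by (intro continuous_intros)
  \<comment> \<open>The sign \<open>d\<close> treats both ends at once: 1 steps above the maximum,
    \<open>- 1\<close> below the minimum.\<close>
  have outside: "\<exists>z\<in>\<Omega> - closure A. d * q $ i < d * z $ i"
    if q: "q \<in> closure A" "\<forall>y\<in>closure A. d * y $ i \<le> d * q $ i" and d: "d = 1 \<or> d = - 1" for q d
  proof -
    obtain e where e: "e > 0" "ball q e \<subseteq> \<Omega>" using \<Omega> q cA open_contains_ball by (metis subsetD)
    define z where "z = q + (d * (e / 2)) *\<^sub>R axis i 1"
    have "dist q z < e" using e d by (auto simp: z_def dist_norm norm_axis_1)
    then have "z \<in> \<Omega>" using e by auto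
    moreover have "d * q $ i < d * z $ i" using e d by (auto simp: z_def)
    ultimately show ?thesis using q(2) by (intro bexI[of _ z]) (auto simp: not_le[symmetric])
  qed
  obtain q where q: "q \<in> closure A" "\<forall>y\<in>closure A. y $ i \<le> q $ i"
    using continuous_attains_sup[OF cA(1) ne cont] by auto
  obtain r where r: "r \<in> closure A" "\<forall>y\<in>closure A. r $ i \<le> y $ i"
    using continuous_attains_inf[OF cA(1) ne cont] by auto
  obtain y where y: "y \<in> \<Omega> - closure A" "q $ i < y $ i" using outside[of q 1] q by auto
  obtain z where z: "z \<in> \<Omega> - closure A" "z $ i < r $ i" using outside[of r "- 1"] r by auto
  have "connected ((\<lambda>x. x $ i) ` (\<Omega> - closure A))"
    by (intro connected_continuous_image conn continuous_intros)
  then have "{z $ i..y $ i} \<subseteq> (\<lambda>x. x $ i) ` (\<Omega> - closure A)"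
    using y z by (intro connected_contains_Icc) auto
  moreover have "r $ i \<le> q $ i" using r q by blast
  then have "q $ i \<in> {z $ i..y $ i}" using y z by simp
  ultimately obtain x where "x \<in> \<Omega> - closure A" "q $ i = x $ i" by auto
  then show False using q(1) eqI[of q x] by simp
qed

section \<open>Instability\<close>

text \<open>The pair is the identity and \<open>coeff t\<close>. The ball of the swirl lies in
  \<open>A\<close>, and \<open>W\<close> avoids \<open>closure A\<close>, so the swirl fixes
  \<open>W\<close>.\<close>

lemma indistinguishable_pair:
  fixes \<Omega> A W :: "(real^'n::finite) set" and s r0 \<theta> :: real
  assumes s: "0 < s" "s < 1" and \<Omega>: "open \<Omega>" "bounded \<Omega>" and A: "open A" "A \<noteq> {}" "A \<Subset> \<Omega>"
    and conn: "connected (\<Omega> - closure A)" and W: "open W" "W \<Subset> \<Omega> - closure A"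
    and r0: "0 < r0" and \<theta>: "0 < \<theta>" "\<theta> < 1"
  shows "\<exists>a1\<in>coeff_class \<Omega> A r0 \<theta>. \<exists>a2\<in>coeff_class \<Omega> A r0 \<theta>. \<exists>m>0.
    sts_dist \<Omega> W s a1 a2 = 0 \<and> ereal m \<le> Linf_norm \<Omega> (\<lambda>x. a1 x - a2 x)"
proof -
  obtain i j :: 'n where ij: "i \<noteq> j" using exists_two_directions[OF \<Omega>(1) A(2,3) conn] by blast
  obtain p R where rad: "0 < R" "cball p R \<subseteq> A" using A(1,2) open_contains_cball by blast
  interpret swirl i j p R by unfold_locales (use ij rad in auto)
  have A\<Omega>: "A \<subseteq> \<Omega>" using A(3) closure_subset by (auto simp: compactly_contained_def)
  have ball1: "ball p R \<subseteq> A" by (rule order_trans[OF ball_subset_cball rad(2)])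
  note ball = ball1 order_trans[OF rad(2) A\<Omega>] order_trans[OF ball1 A\<Omega>]
  obtain t where t: "0 < t" and cl: "\<And>r. r \<in> {0..t} \<Longrightarrow> coeff r \<in> coeff_class \<Omega> A r0 \<theta>"
    using coeff_in_class[OF ball(1) r0 \<theta>] by blast
  have c0: "coeff 0 = (\<lambda>x. mat 1)" by (simp add: fun_eq_iff coeff_0)
  have in_class: "coeff t \<in> coeff_class \<Omega> A r0 \<theta>" "(\<lambda>x. mat 1) \<in> coeff_class \<Omega> A r0 \<theta>"
    using cl[of t] cl[of 0] t by (auto simp: c0)
  have ell: "elliptic_coeff \<Omega> \<theta> (coeff t)" "elliptic_coeff \<Omega> \<theta> (\<lambda>x. mat 1)"
    using elliptic_coeff[OF in_class(1) \<theta>(1) \<Omega>(2)] elliptic_coeff[of 0 \<Omega> A r0 \<theta>] in_class(2) \<theta>(1) \<Omega>(2)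
    by (auto simp: c0)
  have W': "W \<subseteq> \<Omega>" "W \<inter> closure A = {}" using W(2) closure_subset[of W] by (auto simp: compactly_contained_def)
  interpret tp: transport_laplace \<Omega> "\<Phi> t" "\<Phi> (- t)" "T t" "T (- t)" \<theta> "coeff t" W s
  proof (intro transport_laplace.intro transport_pair.intro transport_\<Phi> \<Omega> ball)
    show "transport_pair_axioms \<Omega> (\<Phi> t) (\<Phi> (- t)) (T t) (T (- t)) \<theta> (\<lambda>x. mat 1) (coeff t)"
      by unfold_locales (simp_all add: \<Phi>_add ell T_pullback T_pushforward)
    have "\<Phi> t x = x" if "x \<in> W" for x
      by (rule \<Phi>_outside) (use that W'(2) ball(1) closure_subset[of A] in blast)
    then show "transport_laplace_axioms \<Omega> (\<Phi> t) W s"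
      by unfold_locales (use W(1) W'(1) s in auto)
  qed
  obtain m where "0 < m" "ereal m \<le> Linf_norm \<Omega> (\<lambda>x. mat 1 - coeff t x)"
    using coeff_distance[OF \<Omega>(1) ball(3) t] by blast
  then show ?thesis using in_class tp.sts_dist_zero by blast
qed

theorem proposition5p11:
  fixes \<Omega> A W :: "(real^'n::finite) set" and s r0 \<theta> :: real
  assumes "0 < s" and "s < 1"
    and "smooth_domain \<Omega>" and "smooth_domain A" and "smooth_domain W"
    and "A \<Subset> \<Omega>" and "connected (\<Omega> - closure A)" and "W \<Subset> \<Omega> - closure A"
    and "0 < r0" and "0 < \<theta>" and "\<theta> < 1"
  shows "(\<exists>c>0. \<exists>\<epsilon>0>0. \<forall>\<epsilon>. 0 < \<epsilon> \<and> \<epsilon> < r0 \<and> \<epsilon> < \<epsilon>0 \<longrightarrow>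
            (\<exists>a1\<in>coeff_class \<Omega> A r0 \<theta>. \<exists>a2\<in>coeff_class \<Omega> A r0 \<theta>.
               sts_dist \<Omega> W s a1 a2
                 \<le> ennreal (exp (- c * \<epsilon> powr (- (1 / (2 + 7 / real CARD('n)))))) \<and>
               Linf_norm \<Omega> (\<lambda>x. a1 x - a2 x) \<ge> ereal \<epsilon>)) \<and>
         (\<forall>\<omega>. modulus_of_continuity \<omega> \<and>
            (\<forall>a1\<in>coeff_class \<Omega> A r0 \<theta>. \<forall>a2\<in>coeff_class \<Omega> A r0 \<theta>.
               Linf_norm \<Omega> (\<lambda>x. a1 x - a2 x) \<le> ereal (\<omega> (enn2real (sts_dist \<Omega> W s a1 a2)))) \<longrightarrow>
            (\<exists>c'>0. \<exists>t0>0. \<forall>t. 0 < t \<and> t < t0 \<longrightarrow>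
               \<omega> t \<ge> c' * \<bar>ln t\<bar> powr (- (2 + 7 / real CARD('n)))))"
proof -
  obtain a1 a2 m where a: "a1 \<in> coeff_class \<Omega> A r0 \<theta>" "a2 \<in> coeff_class \<Omega> A r0 \<theta>" and m: "0 < m"
    and dist: "sts_dist \<Omega> W s a1 a2 = 0" and Linf: "ereal m \<le> Linf_norm \<Omega> (\<lambda>x. a1 x - a2 x)"
    using indistinguishable_pair[of s \<Omega> A W r0 \<theta>] assms unfolding smooth_domain_def by blast
  show ?thesis
  proof (intro conjI allI impI)
    show "\<exists>c>0. \<exists>\<epsilon>0>0. \<forall>\<epsilon>. 0 < \<epsilon> \<and> \<epsilon> < r0 \<and> \<epsilon> < \<epsilon>0 \<longrightarrow>
            (\<exists>a1\<in>coeff_class \<Omega> A r0 \<theta>. \<exists>a2\<in>coeff_class \<Omega> A r0 \<theta>.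
               sts_dist \<Omega> W s a1 a2
                 \<le> ennreal (exp (- c * \<epsilon> powr (- (1 / (2 + 7 / real CARD('n)))))) \<and>
               Linf_norm \<Omega> (\<lambda>x. a1 x - a2 x) \<ge> ereal \<epsilon>)"
    \<comment> \<open>The two operators coincide, so any \<open>c\<close> would serve;
      \<open>m\<close> is the threshold below which one pair works for all
      \<open>\<epsilon>\<close>.\<close>
    proof (rule exI[of _ 1], intro conjI zero_less_one, rule exI[of _ m], intro conjI m allI impI)
      fix \<epsilon> assume "0 < \<epsilon> \<and> \<epsilon> < r0 \<and> \<epsilon> < m"
      then have "ereal \<epsilon> \<le> ereal m" by simp
      then have "ereal \<epsilon> \<le> Linf_norm \<Omega> (\<lambda>x. a1 x - a2 x)" using Linf by (rule order_trans)
      then show "\<exists>a1\<in>coeff_class \<Omega> A r0 \<theta>. \<exists>a2\<in>coeff_class \<Omega> A r0 \<theta>.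
               sts_dist \<Omega> W s a1 a2
                 \<le> ennreal (exp (- 1 * \<epsilon> powr (- (1 / (2 + 7 / real CARD('n)))))) \<and>
               Linf_norm \<Omega> (\<lambda>x. a1 x - a2 x) \<ge> ereal \<epsilon>"
        using a dist by (intro bexI[of _ a1] bexI[of _ a2] conjI) auto
    qed
  next
    fix \<omega>
    assume \<omega>: "modulus_of_continuity \<omega> \<and>
            (\<forall>a1\<in>coeff_class \<Omega> A r0 \<theta>. \<forall>a2\<in>coeff_class \<Omega> A r0 \<theta>.
               Linf_norm \<Omega> (\<lambda>x. a1 x - a2 x) \<le> ereal (\<omega> (enn2real (sts_dist \<Omega> W s a1 a2))))"
    \<comment> \<open>Applied to the pair, the stability estimate bounds \<open>\<omega> 0\<close>
      below by \<open>m\<close>. A modulus vanishes at 0, so this already excludes stability; the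
      stated bound is deduced directly by monotonicity.\<close>
    have "ereal m \<le> ereal (\<omega> (enn2real (sts_dist \<Omega> W s a1 a2)))"
      using Linf \<omega> a by (meson order_trans)
    then have m0: "m \<le> \<omega> 0" by (simp add: dist)
    \<comment> \<open>Below \<open>exp (- 1)\<close> the logarithm exceeds 1 in absolute value, so
      its negative power is at most 1.\<close>
    have "m * \<bar>ln t\<bar> powr (- (2 + 7 / real CARD('n))) \<le> \<omega> t" if t: "0 < t" "t < exp (- 1)" for t
    proof -
      have "ln t < - 1" using t by (metis ln_exp ln_less_cancel_iff exp_gt_zero)
      moreover have "- (2 + 7 / real CARD('n)) \<le> 0"
        using divide_nonneg_nonneg[of 7 "real CARD('n)"] by linarith
      ultimately have "\<bar>ln t\<bar> powr (- (2 + 7 / real CARD('n))) \<le> \<bar>ln t\<bar> powr 0"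
        by (intro powr_mono) auto
      also have "\<dots> = 1" using \<open>ln t < - 1\<close> by simp
      finally have "m * \<bar>ln t\<bar> powr (- (2 + 7 / real CARD('n))) \<le> m * 1" using m by (intro mult_left_mono) auto
      also have "\<dots> \<le> \<omega> 0" using m0 by simp
      also have "\<omega> 0 \<le> \<omega> t"
        using \<omega> t unfolding modulus_of_continuity_def mono_on_def by simp
      finally show ?thesis .
    qed
    then show "\<exists>c'>0. \<exists>t0>0. \<forall>t. 0 < t \<and> t < t0 \<longrightarrow> \<omega> t \<ge> c' * \<bar>ln t\<bar> powr (- (2 + 7 / real CARD('n)))"
      using m by (intro exI[of _ m] conjI exI[of _ "exp (- 1)"]) auto
  qed
qed

end
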